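(* Let $\alpha,\beta\ge-1/2$ and let $P_\ast^{(\alpha,\beta)}f(n)=\sup_{t>0}|P_t^{(\alpha,\beta)}f(n)|$, where $P_t^{(\alpha,\beta)}$ is the Poisson operator defined in the context. (a) If $1<p<\infty$ and $w\in A_p(\mathbb{N})$, then there is a constant $C>0$, independent of $f$, such that $$\|P_\ast^{(\alpha,\beta)}f\|_{\ell^p(\mathbb{N},w)}\le C\|f\|_{\ell^p(\mathbb{N},w)}\quad\text{for all } f\in\ell^p(\mathbb{N},w).$$ (b) If $w\in A_1(\mathbb{N})$, then there is a constant $C>0$, independent of $f$, such that $$\|P_\ast^{(\alpha,\beta)}f\|_{\ell^{1,\infty}(\mathbb{N},w)}\le C\|f\|_{\ell^1(\mathbb{N},w)}\quad\text{for all } f\in\ell^1(\mathbb{N},w).$$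
   Context: Here $\mathbb{N}=\{0,1,2,\dots\}$. Let $P_n^{(\alpha,\beta)}(x)$ be the Jacobi polynomials, defined by $(1-x)^\alpha(1+x)^\beta P_n^{(\alpha,\beta)}(x)=\frac{(-1)^n}{2^nn!}\frac{d^n}{dx^n}\big((1-x)^{\alpha+n}(1+x)^{\beta+n}\big)$, let $d\mu_{\alpha,\beta}(x)=(1-x)^\alpha(1+x)^\beta dx$ on $[-1,1]$, and let $p_n^{(\alpha,\beta)}=P_n^{(\alpha,\beta)}/\|P_n^{(\alpha,\beta)}\|_{L^2([-1,1],d\mu_{\alpha,\beta})}$. For $t\ge0$, $$K_t^{(\alpha,\beta)}(m,n)=\int_{-1}^1e^{-(1-x)t}p_m^{(\alpha,\beta)}(x)p_n^{(\alpha,\beta)}(x)\,d\mu_{\alpha,\beta}(x),\qquad W_t^{(\alpha,\beta)}f(n)=\sum_{m=0}^\infty f(m)K_t^{(\alpha,\beta)}(m,n).$$ The Poisson operator (not to be confused with the polynomials) is $$P_t^{(\alpha,\beta)}f(n)=\frac{1}{\sqrt{\pi}}\int_0^\infty\frac{e^{-u}}{\sqrt u}W_{t^2/(4u)}^{(\alpha,\beta)}f(n)\,du,\qquad t\ge0,$$ the same formula being used for $f\in\ell^\infty(\mathbb{N})$ and for $f$ in the weighted spaces of the statement. A weight is a strictly positive sequence $w=\{w(n)\}_{n\ge0}$. The space $\ell^p(\mathbb{N},w)$, $1\le p<\infty$, has norm $\|f\|_{\ell^p(\mathbb{N},w)}=\big(\sum_{m\ge0}|f(m)|^pw(m)\big)^{1/p}$,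 and $\|f\|_{\ell^{1,\infty}(\mathbb{N},w)}=\sup_{t>0}t\sum_{\{m\in\mathbb{N}:|f(m)|>t\}}w(m)$. For $1<p<\infty$, $w\in A_p(\mathbb{N})$ means $$\sup_{0\le n\le m}\frac{1}{(m-n+1)^p}\Big(\sum_{k=n}^mw(k)\Big)\Big(\sum_{k=n}^mw(k)^{-1/(p-1)}\Big)^{p-1}<\infty,$$ and $w\in A_1(\mathbb{N})$ means $$\sup_{0\le n\le m}\frac{1}{m-n+1}\Big(\sum_{k=n}^mw(k)\Big)\max_{n\le k\le m}w(k)^{-1}<\infty,$$ the suprema being over integers $n,m$. *)

theory Defs
  imports "HOL-Analysis.Analysis" "HOL-Computational_Algebra.Polynomial"
begin

definition rodrigues :: "real \<Rightarrow> real \<Rightarrow> nat \<Rightarrow> real \<Rightarrow> real" where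
  "rodrigues \<alpha> \<beta> n x =
     (-1) ^ n / (2 ^ n * fact n) *
     (deriv ^^ n) (\<lambda>y. (1 - y) powr (\<alpha> + real n) * (1 + y) powr (\<beta> + real n)) x"

text \<open>The defining identity is imposed on the open interval only: at the endpoints the
  powers of \<open>1 - x\<close> and \<open>1 + x\<close> vanish or are undefined.  The unique existence of such a
  polynomial is shown below.\<close>

definition jacobi_poly :: "real \<Rightarrow> real \<Rightarrow> nat \<Rightarrow> real poly" where
  "jacobi_poly \<alpha> \<beta> n =
     (THE q. \<forall>x\<in>{-1<..<1}. (1 - x) powr \<alpha> * (1 + x) powr \<beta> * poly q x = rodrigues \<alpha> \<beta> n x)"

lemma deriv_iter_powr_mult:
  fixes a b :: real
  shows "\<exists>q :: real poly. \<forall>x\<in>{-1<..<1}.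
     (deriv ^^ k) (\<lambda>y. (1 - y) powr a * (1 + y) powr b) x =
     (1 - x) powr (a - real k) * (1 + x) powr (b - real k) * poly q x"
proof (induction k)
  case 0
  show ?case by (rule exI[of _ 1]) simp
next
  case (Suc k)
  let ?g = "\<lambda>y::real. (1 - y) powr a * (1 + y) powr b"
  define c d where "c = a - real k" and "d = b - real k"
  from Suc obtain q where
    q: "\<And>x. x \<in> {-1<..<1} \<Longrightarrow> (deriv ^^ k) ?g x = (1 - x) powr c * (1 + x) powr d * poly q x"
    unfolding c_def d_def by blast
  define r where
    "r = smult (- c) ([:1, 1:] * q) + smult d ([:1, -1:] * q) + [:1, -1:] * [:1, 1:] * pderiv q"
  have "(deriv ^^ Suc k) ?g x =
      (1 - x) powr (a - real (Suc k)) * (1 + x) powr (b - real (Suc k)) * poly r x"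
    if x: "x \<in> {-1<..<1}" for x
  proof -
    define u v where "u = (1 - x) powr (c - 1)" and "v = (1 + x) powr (d - 1)"
    have u: "(1 - x) powr c = u * (1 - x)" and v: "(1 + x) powr d = v * (1 + x)"
      using x by (simp_all add: u_def v_def powr_diff)
    have D1: "((\<lambda>y. (1 - y) powr c) has_real_derivative (- c) * u) (at x)"
      using x unfolding u_def by (auto intro!: derivative_eq_intros simp: powr_diff)
    have D2: "((\<lambda>y. (1 + y) powr d) has_real_derivative d * v) (at x)"
      using x unfolding v_def by (auto intro!: derivative_eq_intros simp: powr_diff)
    have "((\<lambda>y. (1 - y) powr c * (1 + y) powr d * poly q y) has_real_derivative
        (((- c) * u) * (1 + x) powr d + (d * v) * (1 - x) powr c) * poly q x
          + poly (pderiv q) x * ((1 - x) powr c * (1 + x) powr d)) (at x)"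
      by (rule DERIV_mult[OF DERIV_mult[OF D1 D2] poly_DERIV])
    also have "(((- c) * u) * (1 + x) powr d + (d * v) * (1 - x) powr c) * poly q x
          + poly (pderiv q) x * ((1 - x) powr c * (1 + x) powr d) = u * v * poly r x"
      unfolding u v r_def by (simp add: algebra_simps)
    finally have D: "((\<lambda>y. (1 - y) powr c * (1 + y) powr d * poly q y)
        has_real_derivative u * v * poly r x) (at x)" .
    have "((deriv ^^ k) ?g has_real_derivative u * v * poly r x) (at x)"
      by (rule has_field_derivative_transform_within_open[OF D, of "{-1<..<1}"])
         (use x q in auto)
    then have "(deriv ^^ Suc k) ?g x = u * v * poly r x"
      by (simp add: DERIV_imp_deriv)
    then show ?thesis
      by (simp add: u_def v_def c_def d_def algebra_simps)
  qed
  then show ?case by blast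
qed

lemma jacobi_poly_ex1:
  "\<exists>!q :: real poly. \<forall>x\<in>{-1<..<1}.
     (1 - x) powr \<alpha> * (1 + x) powr \<beta> * poly q x = rodrigues \<alpha> \<beta> n x"
proof (rule ex_ex1I)
  obtain q where q: "\<forall>x\<in>{-1<..<1}.
      (deriv ^^ n) (\<lambda>y. (1 - y) powr (\<alpha> + real n) * (1 + y) powr (\<beta> + real n)) x =
      (1 - x) powr \<alpha> * (1 + x) powr \<beta> * poly q x"
    using deriv_iter_powr_mult[of n "\<alpha> + real n" "\<beta> + real n"] by auto
  show "\<exists>q :: real poly. \<forall>x\<in>{-1<..<1}.
     (1 - x) powr \<alpha> * (1 + x) powr \<beta> * poly q x = rodrigues \<alpha> \<beta> n x"
    by (rule exI[of _ "smult ((-1) ^ n / (2 ^ n * fact n)) q"])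
       (use q in \<open>simp add: rodrigues_def\<close>)
next
  fix q q' :: "real poly"
  assume q: "\<forall>x\<in>{-1<..<1}. (1 - x) powr \<alpha> * (1 + x) powr \<beta> * poly q x = rodrigues \<alpha> \<beta> n x"
    and q': "\<forall>x\<in>{-1<..<1}. (1 - x) powr \<alpha> * (1 + x) powr \<beta> * poly q' x = rodrigues \<alpha> \<beta> n x"
  have "poly (q - q') x = 0" if x: "x \<in> {-1<..<1}" for x
  proof -
    have "(1 - x) powr \<alpha> * (1 + x) powr \<beta> * poly q x =
          (1 - x) powr \<alpha> * (1 + x) powr \<beta> * poly q' x"
      using q q' x by simp
    moreover have "(1 - x) powr \<alpha> * (1 + x) powr \<beta> \<noteq> 0" using x by simp
    ultimately show ?thesis by simp
  qed
  then have "{-1<..<1} \<subseteq> {x. poly (q - q') x = 0}" by blast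
  moreover have "infinite {-1<..<1::real}" by simp
  ultimately have "infinite {x. poly (q - q') x = 0}" using finite_subset by blast
  then show "q = q'" using poly_roots_finite[of "q - q'"] by auto
qed

lemma jacobi_poly_rodrigues:
  assumes "x \<in> {-1<..<1}"
  shows "(1 - x) powr \<alpha> * (1 + x) powr \<beta> * poly (jacobi_poly \<alpha> \<beta> n) x = rodrigues \<alpha> \<beta> n x"
  using theI'[OF jacobi_poly_ex1[of \<alpha> \<beta> n]] assms unfolding jacobi_poly_def by blast

definition jacobi_measure :: "real \<Rightarrow> real \<Rightarrow> real measure" where
  "jacobi_measure \<alpha> \<beta> =
     density (restrict_space lborel {-1..1}) (\<lambda>x. ennreal ((1 - x) powr \<alpha> * (1 + x) powr \<beta>))"

definition jacobi_normalized :: "real \<Rightarrow> real \<Rightarrow> nat \<Rightarrow> real \<Rightarrow> real" where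
  "jacobi_normalized \<alpha> \<beta> n x =
     poly (jacobi_poly \<alpha> \<beta> n) x /
     sqrt (LINT y|jacobi_measure \<alpha> \<beta>. (poly (jacobi_poly \<alpha> \<beta> n) y)\<^sup>2)"

definition heat_kernel :: "real \<Rightarrow> real \<Rightarrow> real \<Rightarrow> nat \<Rightarrow> nat \<Rightarrow> real" where
  "heat_kernel \<alpha> \<beta> t m n =
     (LINT x|jacobi_measure \<alpha> \<beta>.
        exp (- (1 - x) * t) * jacobi_normalized \<alpha> \<beta> m x * jacobi_normalized \<alpha> \<beta> n x)"

definition heat_op :: "real \<Rightarrow> real \<Rightarrow> real \<Rightarrow> (nat \<Rightarrow> complex) \<Rightarrow> nat \<Rightarrow> complex" where
  "heat_op \<alpha> \<beta> t f n = (\<Sum>m. f m * complex_of_real (heat_kernel \<alpha> \<beta> t m n))"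

definition poisson_op :: "real \<Rightarrow> real \<Rightarrow> real \<Rightarrow> (nat \<Rightarrow> complex) \<Rightarrow> nat \<Rightarrow> complex" where
  "poisson_op \<alpha> \<beta> t f n =
     (1 / sqrt pi) *\<^sub>R
     (LINT u:{0<..}|lborel. (exp (- u) / sqrt u) *\<^sub>R heat_op \<alpha> \<beta> (t\<^sup>2 / (4 * u)) f n)"

text \<open>Sums of divergent series and integrals of non-integrable functions have arbitrary values
  in HOL; this predicate says that the value of \<open>poisson_op\<close> is the intended one.\<close>

definition poisson_defined :: "real \<Rightarrow> real \<Rightarrow> real \<Rightarrow> (nat \<Rightarrow> complex) \<Rightarrow> nat \<Rightarrow> bool" where
  "poisson_defined \<alpha> \<beta> t f n \<longleftrightarrow>
     (\<forall>u>0. summable (\<lambda>m. f m * complex_of_real (heat_kernel \<alpha> \<beta> (t\<^sup>2 / (4 * u)) m n))) \<and>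
     set_integrable lborel {0<..}
       (\<lambda>u. (exp (- u) / sqrt u) *\<^sub>R heat_op \<alpha> \<beta> (t\<^sup>2 / (4 * u)) f n)"

definition poisson_max :: "real \<Rightarrow> real \<Rightarrow> (nat \<Rightarrow> complex) \<Rightarrow> nat \<Rightarrow> ennreal" where
  "poisson_max \<alpha> \<beta> f n = (SUP t\<in>{0<..}. ennreal (cmod (poisson_op \<alpha> \<beta> t f n)))"

definition weight :: "(nat \<Rightarrow> real) \<Rightarrow> bool" where
  "weight w \<longleftrightarrow> (\<forall>n. 0 < w n)"

definition Ap_weight :: "real \<Rightarrow> (nat \<Rightarrow> real) \<Rightarrow> bool" where
  "Ap_weight p w \<longleftrightarrow> weight w \<and>
     bdd_above {1 / real (m - n + 1) powr p * (\<Sum>k=n..m. w k) *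
                  (\<Sum>k=n..m. w k powr (- 1 / (p - 1))) powr (p - 1) | n m. n \<le> m}"

definition A1_weight :: "(nat \<Rightarrow> real) \<Rightarrow> bool" where
  "A1_weight w \<longleftrightarrow> weight w \<and>
     bdd_above {1 / real (m - n + 1) * (\<Sum>k=n..m. w k) *
                  Max ((\<lambda>k. inverse (w k)) ` {n..m}) | n m. n \<le> m}"

text \<open>Real powers of extended nonnegative reals, used for positive exponents only.\<close>

definition ennreal_powr :: "ennreal \<Rightarrow> real \<Rightarrow> ennreal" where
  "ennreal_powr x p = (if x = top then top else ennreal (enn2real x powr p))"

text \<open>The norms take the sequence of moduli, possibly infinite, as argument, so that they
  apply both to \<open>\<lambda>m. ennreal (cmod (f m))\<close> and to a maximal function.\<close>

definition lp_norm :: "real \<Rightarrow> (nat \<Rightarrow> real) \<Rightarrow> (nat \<Rightarrow> ennreal) \<Rightarrow> ennreal" where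
  "lp_norm p w g = ennreal_powr (\<Sum>m. ennreal_powr (g m) p * ennreal (w m)) (1 / p)"

definition weak_l1_norm :: "(nat \<Rightarrow> real) \<Rightarrow> (nat \<Rightarrow> ennreal) \<Rightarrow> ennreal" where
  "weak_l1_norm w g =
     (SUP t\<in>{0::real<..}. ennreal t * (\<Sum>m. if g m > ennreal t then ennreal (w m) else 0))"

definition lp_space :: "real \<Rightarrow> (nat \<Rightarrow> real) \<Rightarrow> (nat \<Rightarrow> complex) set" where
  "lp_space p w = {f. lp_norm p w (\<lambda>m. ennreal (cmod (f m))) < top}"

end

theory Submission
  imports Defs
begin

text \<open>The Poisson operator is an average, with respect to a probability density in \<open>u\<close>, of the heat
operators \<open>W\<^sub>s\<close> with \<open>s = t\<^sup>2 / (4 u)\<close>.  Its maximal function is therefore at most the supremum of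
\<open>\<bar>W\<^sub>s f(n)\<bar>\<close> over \<open>s > 0\<close>, and everything follows from one estimate of the heat kernel: with
\<open>r = max 1 (sqrt t)\<close>,
\<open>\<bar>K\<^sub>t(m,n)\<bar> \<le> C r / (r\<^sup>2 + (m - n)\<^sup>2)\<close> (\<open>heat_kernel_bound\<close>).  The right-hand side decreases in \<open>\<bar>m - n\<bar>\<close>
and has bounded mass, so \<open>W\<^sub>t f(n)\<close> is at most a constant times the Hardy--Littlewood maximal function
of \<open>\<bar>f\<bar>\<close> at \<open>n\<close> (\<open>poisson_sum_le_two_sided_max\<close>), to which the theory of Muckenhoupt weights applies.

The kernel estimate has two ingredients.  The first is a Bernstein type inequality: the functions
\<open>(1 - x)\<^bsup>\<alpha>+1/2\<^esup> (1 + x)\<^bsup>\<beta>+1/2\<^esup> p\<^sub>n(x)\<^sup>2\<close> are bounded uniformly in \<open>n\<close> and \<open>x\<close> (\<open>jacobi_normalized_bound\<close>), so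
\<open>\<bar>p\<^sub>m p\<^sub>n\<bar> d\<mu>\<close> is dominated by a multiple of \<open>dx / sqrt (1 - x\<^sup>2) = d\<theta>\<close>, where \<open>x = cos \<theta>\<close>.  The second is
that \<open>p\<^sub>m p\<^sub>n\<close> is orthogonal to all polynomials of degree less than \<open>\<bar>m - n\<bar>\<close>.  Hence
\<open>K\<^sub>t(m,n)\<close> does not change when such a polynomial is subtracted from \<open>exp (-(1 - x) t)\<close>, and
\<open>\<bar>K\<^sub>t(m,n)\<bar>\<close> is at most a constant times the distance in \<open>L\<^sup>1(d\<theta>)\<close> from \<open>exp (-(1 - cos \<theta>) t)\<close> to the trigonometric
polynomials of degree less than \<open>\<bar>m - n\<bar>\<close>.  By Jackson's theorem in the mean (\<open>jackson_L1\<close>) this is at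
most a constant times \<open>\<bar>m - n\<bar>\<^sup>-\<^sup>2\<close> times the \<open>L\<^sup>1\<close> norm of a second derivative, which is of order \<open>sqrt t\<close>.

For the Bernstein inequality, the Jacobi equation in the variable \<open>\<theta>\<close> is read as a damped oscillator
of frequency \<open>sqrt \<lambda>\<close>.  Its energy times the weight is an adiabatic invariant: after a correction that
removes the oscillation, its logarithmic derivative is of order \<open>\<lambda>\<^bsup>-1/2\<^esup> (1 - x\<^sup>2)\<^bsup>-3/2\<^esup>\<close>, which is
integrable with a uniform bound where \<open>1 - x\<^sup>2\<close> exceeds a multiple of \<open>1/\<lambda>\<close>.  There the
weighted energy is comparable with its mean, and the mean is controlled by the norm of the solution.
Closer to the end points the energy grows at most polynomially, and in the last
stretch of length proportional to \<open>1/\<lambda>\<close> the solution is essentially constant.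

The weighted bounds for the maximal function follow Lerner.  With \<open>\<sigma> = w\<^bsup>-1/(p-1)\<^esup>\<close>, the \<open>A\<^sub>p\<close>
condition gives \<open>(M f)\<^bsup>p-1\<^esup> \<le> A M\<^sub>w ((M\<^sub>\<sigma> (f/\<sigma>))\<^bsup>p-1\<^esup> / w)\<close> up to constants, where \<open>M\<^sub>v\<close> takes averages with respect to
\<open>v\<close>.  On the line \<open>M\<^sub>v\<close> is at most the sum of two one-sided maximal functions, and these are
bounded on \<open>l\<^sup>q(v)\<close>, \<open>q > 1\<close>, for every weight \<open>v\<close> by a rising sun argument.\<close>

section \<open>Maximal functions on the natural numbers\<close>

text \<open>A discrete rising sun lemma, used with \<open>a = N\<close>.  The statement for all \<open>a\<close> is what the induction needs:
if \<open>N \<in> E\<close>, both sides gain \<open>g N\<close>; otherwise no sum of \<open>g\<close> over an interval ending at \<open>N\<close> is positive, and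
the right-hand side stays nonnegative.\<close>

lemma interval_sum_le_sum_on_rising_set:
  fixes g :: "nat \<Rightarrow> real"
  defines "E \<equiv> {n. \<exists>a\<le>n. 0 < (\<Sum>k=a..n. g k)}"
  assumes "a \<le> N"
  shows "(\<Sum>k=a..<N. g k) \<le> (\<Sum>k\<in>{..<N} \<inter> E. g k)"
  using assms(2)
proof (induction N arbitrary: a)
  case 0
  then show ?case by simp
next
  case (Suc N)
  have ivl: "(\<Sum>k=a..<Suc N. g k) = (\<Sum>k=a..N. g k)" for a
    by (simp add: atLeastLessThanSuc_atLeastAtMost)
  have split: "(\<Sum>k=a..<Suc N. g k) = (\<Sum>k=a..<N. g k) + g N" if "a \<le> N" for a
    using that by simp
  show ?case
  proof (cases "N \<in> E")
    case True
    have "{..<Suc N} \<inter> E = insert N ({..<N} \<inter> E)"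
      using True by auto
    then have eq: "(\<Sum>k\<in>{..<Suc N} \<inter> E. g k) = g N + (\<Sum>k\<in>{..<N} \<inter> E. g k)"
      by simp
    have le: "(\<Sum>k=a..<Suc N. g k) \<le> (\<Sum>k\<in>{..<Suc N} \<inter> E. g k)" if "a \<le> N" for a
      using Suc.IH[OF that] split[OF that] eq by simp
    from True obtain a0 where a0: "a0 \<le> N" "0 < (\<Sum>k=a0..N. g k)"
      unfolding E_def by auto
    show ?thesis
      using le[of a] le[OF a0(1)] a0(2) Suc.prems unfolding ivl
      by (cases "a \<le> N") auto
  next
    case False
    then have "{..<Suc N} \<inter> E = {..<N} \<inter> E"
      using less_Suc_eq by auto
    moreover have "0 \<le> (\<Sum>k\<in>{..<N} \<inter> E. g k)"
      using Suc.IH[of N] by simp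
    moreover have "(\<Sum>k=a..<Suc N. g k) \<le> 0"
      using False unfolding ivl E_def by (cases "a \<le> N") (auto simp: not_less)
    ultimately show ?thesis by simp
  qed
qed

text \<open>Doob's inequality.  The weak bound keeps the sum of \<open>f v\<close> restricted to the level set, so integrating it
against \<open>x powr (q - 2)\<close> yields \<open>\<Sum> y\<^sup>q v \<le> q/(q-1) \<Sum> f y\<^bsup>q-1\<^esup> v\<close>.  Young's inequality then moves the powers
of \<open>y\<close> to the left, which is possible because all sums are finite.\<close>

lemma lp_bound_of_weak_bound:
  fixes y f v :: "'a \<Rightarrow> real"
  assumes X: "finite X" and q: "1 < q"
    and y: "\<And>n. n \<in> X \<Longrightarrow> 0 \<le> y n" and f: "\<And>n. n \<in> X \<Longrightarrow> 0 \<le> f n"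
    and v: "\<And>n. n \<in> X \<Longrightarrow> 0 \<le> v n"
    and weak: "\<And>x. 0 < x \<Longrightarrow> x * (\<Sum>n\<in>{n\<in>X. x < y n}. v n) \<le> (\<Sum>n\<in>{n\<in>X. x < y n}. f n * v n)"
  shows "(\<Sum>n\<in>X. y n powr q * v n) \<le> (q / (q - 1)) powr q * (\<Sum>n\<in>X. f n powr q * v n)"
proof -
  define Y where "Y = Max (insert 0 (y ` X))"
  have yY: "y n \<le> Y" if "n \<in> X" for n
    unfolding Y_def using X that by (intro Max_ge) auto
  have Y0: "0 \<le> Y"
    unfolding Y_def using X by (intro Max_ge) auto
  \<comment> \<open>the layer cake formula, from \<open>\<integral>\<^sub>0\<^sup>y x\<^bsup>r-1\<^esup> dx = y\<^sup>r / r\<close>; it is used for \<open>r = q\<close> and \<open>r = q - 1\<close>\<close>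
  have layer: "((\<lambda>x. x powr (r - 1) * (if x < y n then 1 else 0)) has_integral y n powr r / r) {0..Y}"
    if "n \<in> X" "0 < r" for n r
  proof -
    have "((\<lambda>x. x powr (r - 1)) has_integral y n powr r / r) {0..y n}"
      using has_integral_powr_from_0[of "r - 1" "y n"] that y by simp
    then have "((\<lambda>x. if x \<in> {0..y n} then x powr (r - 1) else 0) has_integral y n powr r / r) {0..Y}"
      using yY[OF that(1)] by (subst has_integral_restrict) auto
    then show ?thesis
      by (rule has_integral_spike[of "{y n}", rotated -1]) auto
  qed
  have L: "((\<lambda>x. \<Sum>n\<in>X. x powr (q - 1) * (if x < y n then 1 else 0) * v n) has_integral
      (\<Sum>n\<in>X. y n powr q / q * v n)) {0..Y}"
    using q by (intro has_integral_sum[OF X] has_integral_mult_left layer) auto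
  have R: "((\<lambda>x. \<Sum>n\<in>X. x powr (q - 1 - 1) * (if x < y n then 1 else 0) * (f n * v n)) has_integral
      (\<Sum>n\<in>X. y n powr (q - 1) / (q - 1) * (f n * v n))) {0..Y}"
    using q by (intro has_integral_sum[OF X] has_integral_mult_left layer) auto
  have "(\<Sum>n\<in>X. y n powr q / q * v n) \<le> (\<Sum>n\<in>X. y n powr (q - 1) / (q - 1) * (f n * v n))"
  proof (rule has_integral_le[OF L R])
    fix x assume x: "x \<in> {0..Y}"
    have cut: "(\<Sum>n\<in>X. c * (if x < y n then 1 else 0) * h n) = c * (\<Sum>n\<in>{n\<in>X. x < y n}. h n)"
      for c and h :: "'a \<Rightarrow> real"
      using X unfolding sum_distrib_left by (intro sum.mono_neutral_cong_right) auto
    show "(\<Sum>n\<in>X. x powr (q - 1) * (if x < y n then 1 else 0) * v n)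
        \<le> (\<Sum>n\<in>X. x powr (q - 1 - 1) * (if x < y n then 1 else 0) * (f n * v n))"
    proof (cases "x = 0")
      case False
      then have x0: "0 < x" using x by simp
      have "x powr (q - 1) = x powr (q - 1 - 1) * x"
        using x0 powr_add[of x "q - 1 - 1" 1] by simp
      then show ?thesis
        unfolding cut using mult_left_mono[OF weak[OF x0], of "x powr (q - 1 - 1)"]
        by (simp add: mult.assoc)
    qed simp
  qed
  then have "q * (\<Sum>n\<in>X. y n powr q / q * v n) \<le> q * (\<Sum>n\<in>X. y n powr (q - 1) / (q - 1) * (f n * v n))"
    using q by (intro mult_left_mono) auto
  then have main: "(\<Sum>n\<in>X. y n powr q * v n) \<le> (\<Sum>n\<in>X. (q / (q - 1) * f n) * y n powr (q - 1) * v n)"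
    using q by (simp add: sum_distrib_left mult_ac)
  have "(\<Sum>n\<in>X. (q / (q - 1) * f n) * y n powr (q - 1) * v n)
      \<le> (\<Sum>n\<in>X. ((q / (q - 1) * f n) powr q / q + y n powr q / (q / (q - 1))) * v n)"
  proof (intro sum_mono mult_right_mono v)
    fix n assume n: "n \<in> X"
    show "(q / (q - 1) * f n) * y n powr (q - 1) \<le> (q / (q - 1) * f n) powr q / q + y n powr q / (q / (q - 1))"
    proof -
      have "1 < q / (q - 1)" "1 / q + 1 / (q / (q - 1)) = 1" "(q - 1) * (q / (q - 1)) = q"
        using q by (simp_all add: field_simps)
      then show ?thesis
        using Youngs_inequality[of q "q / (q - 1)" "q / (q - 1) * f n" "y n powr (q - 1)"] q f[OF n]
        by (simp only: powr_powr) simp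
    qed
  qed
  also have "\<dots> = (q / (q - 1)) powr q / q * (\<Sum>n\<in>X. f n powr q * v n)
      + (q - 1) / q * (\<Sum>n\<in>X. y n powr q * v n)"
    unfolding sum_distrib_left sum.distrib[symmetric]
  proof (rule sum.cong[OF refl])
    fix n
    have "(q / (q - 1) * f n) powr q = (q / (q - 1)) powr q * f n powr q"
      by (rule powr_mult)
    moreover have "y n powr q / (q / (q - 1)) = (q - 1) / q * y n powr q"
      by simp
    ultimately show "((q / (q - 1) * f n) powr q / q + y n powr q / (q / (q - 1))) * v n =
        (q / (q - 1)) powr q / q * (f n powr q * v n) + (q - 1) / q * (y n powr q * v n)"
      by (simp only: distrib_right times_divide_eq_left times_divide_eq_right mult.assoc)
  qed
  finally have "(\<Sum>n\<in>X. y n powr q * v n) \<le> (q / (q - 1)) powr q / q * (\<Sum>n\<in>X. f n powr q * v n)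
      + (q - 1) / q * (\<Sum>n\<in>X. y n powr q * v n)"
    using main by linarith
  then have "(1 - (q - 1) / q) * (\<Sum>n\<in>X. y n powr q * v n)
      \<le> (q / (q - 1)) powr q / q * (\<Sum>n\<in>X. f n powr q * v n)"
    unfolding left_diff_distrib by linarith
  moreover have "1 - (q - 1) / q = 1 / q"
    using q by (simp add: diff_divide_distrib)
  ultimately show ?thesis
    using q by (simp add: divide_le_cancel)
qed

definition avg :: "(nat \<Rightarrow> real) \<Rightarrow> (nat \<Rightarrow> real) \<Rightarrow> nat set \<Rightarrow> real" where
  "avg v f I = (\<Sum>k\<in>I. f k * v k) / (\<Sum>k\<in>I. v k)"

definition left_max :: "(nat \<Rightarrow> real) \<Rightarrow> (nat \<Rightarrow> real) \<Rightarrow> nat \<Rightarrow> real" where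
  "left_max v f n = Max ((\<lambda>a. avg v f {a..n}) ` {..n})"

text \<open>The cut-off \<open>N\<close> keeps every quantity finite; the bounds below do not depend on it.\<close>

definition right_max :: "(nat \<Rightarrow> real) \<Rightarrow> nat \<Rightarrow> (nat \<Rightarrow> real) \<Rightarrow> nat \<Rightarrow> real" where
  "right_max v N f n = Max ((\<lambda>b. avg v f {n..b}) ` {n..N})"

lemma less_avg_iff:
  assumes "finite I" "I \<noteq> {}" "\<And>k. k \<in> I \<Longrightarrow> 0 < v k"
  shows "x < avg v f I \<longleftrightarrow> 0 < (\<Sum>k\<in>I. (f k - x) * v k)"
proof -
  have "0 < (\<Sum>k\<in>I. v k)" using assms by (intro sum_pos) auto
  then show ?thesis
    by (simp add: avg_def left_diff_distrib sum_subtractf sum_distrib_left[symmetric] pos_less_divide_eq)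
qed

lemma avg_nonneg:
  assumes "\<And>k. k \<in> I \<Longrightarrow> 0 < v k" "\<And>k. k \<in> I \<Longrightarrow> 0 \<le> f k"
  shows "0 \<le> avg v f I"
  unfolding avg_def using assms by (intro divide_nonneg_nonneg sum_nonneg) (auto simp: less_imp_le)

text \<open>Some average over an interval ending at \<open>n\<close> exceeds \<open>x\<close> exactly when a sum of \<open>(f - x) v\<close> over such an
interval is positive, so the rising sun lemma applies to \<open>(f - x) v\<close>.\<close>

lemma left_max_weak:
  assumes v: "\<And>k. k \<le> N \<Longrightarrow> 0 < v k"
  shows "x * (\<Sum>n\<in>{n\<in>{..N}. x < left_max v f n}. v n) \<le> (\<Sum>n\<in>{n\<in>{..N}. x < left_max v f n}. f n * v n)"
proof -
  define g where "g k = (f k - x) * v k" for k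
  have iff: "x < left_max v f n \<longleftrightarrow> (\<exists>a\<le>n. 0 < (\<Sum>k=a..n. g k))" if "n \<le> N" for n
  proof -
    have "x < left_max v f n \<longleftrightarrow> (\<exists>a\<le>n. x < avg v f {a..n})"
      unfolding left_max_def by (subst Max_gr_iff) auto
    also have "\<dots> \<longleftrightarrow> (\<exists>a\<le>n. 0 < (\<Sum>k=a..n. g k))"
      using v that unfolding g_def by (intro ex_cong1 conj_cong refl less_avg_iff) auto
    finally show ?thesis .
  qed
  have "{n\<in>{..N}. x < left_max v f n} = {..<Suc N} \<inter> {n. \<exists>a\<le>n. 0 < (\<Sum>k=a..n. g k)}"
    using iff by (auto simp only: mem_Collect_eq Int_iff atMost_iff lessThan_iff less_Suc_eq_le)
  then have "0 \<le> (\<Sum>n\<in>{n\<in>{..N}. x < left_max v f n}. g n)"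
    using interval_sum_le_sum_on_rising_set[of "Suc N" "Suc N" g] by simp
  then show ?thesis
    unfolding g_def by (simp add: left_diff_distrib sum_subtractf sum_distrib_left[symmetric])
qed

lemma avg_reflect:
  assumes "n \<le> b" "b \<le> N"
  shows "avg v f {n..b} = avg (\<lambda>k. v (N - k)) (\<lambda>k. f (N - k)) {N - b..N - n}"
proof -
  have "(\<Sum>k=n..b. h k) = (\<Sum>k=N - b..N - n. h (N - k))" for h :: "nat \<Rightarrow> real"
    by (rule sum.reindex_bij_witness[of _ "\<lambda>k. N - k" "\<lambda>k. N - k"]) (use assms in auto)
  from this[of "\<lambda>k. f k * v k"] this[of v] show ?thesis
    unfolding avg_def by simp
qed

lemma right_max_reflect:
  assumes "n \<le> N"
  shows "right_max v N f n = left_max (\<lambda>k. v (N - k)) (\<lambda>k. f (N - k)) (N - n)"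
proof -
  have "(\<lambda>b. avg v f {n..b}) ` {n..N}
      = (\<lambda>a. avg (\<lambda>k. v (N - k)) (\<lambda>k. f (N - k)) {a..N - n}) ` {..N - n}" (is "?L = ?R")
  proof
    show "?L \<subseteq> ?R"
    proof clarify
      fix b assume "b \<in> {n..N}"
      then show "avg v f {n..b} \<in> ?R"
        using avg_reflect[of n b N v f] assms by (intro image_eqI[of _ _ "N - b"]) auto
    qed
    show "?R \<subseteq> ?L"
    proof
      fix z assume "z \<in> ?R"
      then obtain a where a: "a \<le> N - n" "z = avg (\<lambda>k. v (N - k)) (\<lambda>k. f (N - k)) {a..N - n}"
        by auto
      then have "n \<le> N - a" "N - (N - a) = a"
        using assms by auto
      then have "z = avg v f {n..N - a}"
        using avg_reflect[of n "N - a" N v f] a by simp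
      then show "z \<in> ?L"
        using \<open>n \<le> N - a\<close> by auto
    qed
  qed
  then show ?thesis unfolding right_max_def left_max_def by simp
qed

lemma right_max_weak:
  assumes v: "\<And>k. k \<le> N \<Longrightarrow> 0 < v k"
  shows "x * (\<Sum>n\<in>{n\<in>{..N}. x < right_max v N f n}. v n) \<le> (\<Sum>n\<in>{n\<in>{..N}. x < right_max v N f n}. f n * v n)"
proof -
  let ?M = "left_max (\<lambda>k. v (N - k)) (\<lambda>k. f (N - k))"
  have "(\<Sum>n\<in>{n\<in>{..N}. x < right_max v N f n}. h n) = (\<Sum>n\<in>{n\<in>{..N}. x < ?M n}. h (N - n))"
    for h :: "nat \<Rightarrow> real"
    by (rule sum.reindex_bij_witness[of _ "\<lambda>k. N - k" "\<lambda>k. N - k"])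
       (auto simp: right_max_reflect)
  note eq = this
  show ?thesis
    unfolding eq by (rule left_max_weak) (use v in simp)
qed

definition two_sided_max :: "(nat \<Rightarrow> real) \<Rightarrow> nat \<Rightarrow> (nat \<Rightarrow> real) \<Rightarrow> nat \<Rightarrow> real" where
  "two_sided_max v N f n = left_max v f n + right_max v N f n"

lemma left_max_ge: "a \<le> n \<Longrightarrow> avg v f {a..n} \<le> left_max v f n"
  unfolding left_max_def by (intro Max_ge) auto

lemma right_max_ge: "n \<le> b \<Longrightarrow> b \<le> N \<Longrightarrow> avg v f {n..b} \<le> right_max v N f n"
  unfolding right_max_def by (intro Max_ge) auto

lemma left_max_nonneg:
  assumes "\<And>k. k \<le> n \<Longrightarrow> 0 < v k" "\<And>k. k \<le> n \<Longrightarrow> 0 \<le> f k"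
  shows "0 \<le> left_max v f n"
  by (rule order_trans[OF avg_nonneg left_max_ge[of n]]) (use assms in auto)

lemma right_max_nonneg:
  assumes "n \<le> N" "\<And>k. k \<le> N \<Longrightarrow> 0 < v k" "\<And>k. k \<le> N \<Longrightarrow> 0 \<le> f k"
  shows "0 \<le> right_max v N f n"
  by (rule order_trans[OF avg_nonneg right_max_ge[of n n]]) (use assms in auto)

text \<open>An interval around \<open>n\<close> is split at \<open>n\<close>; counting \<open>n\<close> twice does no harm since \<open>f \<ge> 0\<close>.  This replaces a
covering lemma and makes the constants independent of \<open>v\<close>.\<close>

lemma avg_le_two_sided_max:
  assumes "a \<le> n" "n \<le> b" "b \<le> N"
    and v: "\<And>k. k \<le> N \<Longrightarrow> 0 < v k" and f: "\<And>k. k \<le> N \<Longrightarrow> 0 \<le> f k"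
  shows "avg v f {a..b} \<le> two_sided_max v N f n"
proof -
  have pos: "0 < (\<Sum>k=c..d. v k)" if "c \<le> d" "d \<le> N" for c d
    using that v by (intro sum_pos) auto
  have mono: "(\<Sum>k=c..d. v k) \<le> (\<Sum>k=a..b. v k)" if "a \<le> c" "d \<le> b" for c d
    using that v assms(3) by (intro sum_mono2) (auto intro: less_imp_le)
  have fv: "0 \<le> f k * v k" if "k \<le> N" for k
    using f v that by (simp add: less_imp_le)
  have "(\<Sum>k=a..b. f k * v k) \<le> (\<Sum>k=a..n. f k * v k) + (\<Sum>k=n..b. f k * v k)"
  proof -
    have "{a..b} \<subseteq> {a..n} \<union> {n..b}" by auto
    then have "(\<Sum>k=a..b. f k * v k) \<le> (\<Sum>k\<in>{a..n} \<union> {n..b}. f k * v k)"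
      using fv assms by (intro sum_mono2) auto
    also have "\<dots> \<le> (\<Sum>k=a..n. f k * v k) + (\<Sum>k=n..b. f k * v k)"
      using fv assms by (subst sum_Un) (auto intro!: sum_nonneg)
    finally show ?thesis .
  qed
  also have "\<dots> = avg v f {a..n} * (\<Sum>k=a..n. v k) + avg v f {n..b} * (\<Sum>k=n..b. v k)"
    using pos[of a n] pos[of n b] assms by (simp add: avg_def)
  also have "\<dots> \<le> left_max v f n * (\<Sum>k=a..b. v k) + right_max v N f n * (\<Sum>k=a..b. v k)"
    using assms pos[of a n] pos[of n b]
    by (intro add_mono mult_mono left_max_ge right_max_ge mono left_max_nonneg right_max_nonneg) auto
  finally show ?thesis
    using pos[of a b] assms unfolding avg_def two_sided_max_def
    by (subst pos_divide_le_eq) (auto simp: distrib_right)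
qed

lemma two_sided_max_weak:
  assumes v: "\<And>k. k \<le> N \<Longrightarrow> 0 < v k" and f: "\<And>k. k \<le> N \<Longrightarrow> 0 \<le> f k"
  shows "x * (\<Sum>n\<in>{n\<in>{..N}. x < two_sided_max v N f n}. v n) \<le> 4 * (\<Sum>n\<le>N. f n * v n)"
proof (cases "0 < x")
  case True
  let ?L = "{n\<in>{..N}. x / 2 < left_max v f n}" and ?R = "{n\<in>{..N}. x / 2 < right_max v N f n}"
  have v0: "0 \<le> v n" "0 \<le> f n * v n" if "n \<le> N" for n
    using v[OF that] f[OF that] by auto
  have "(\<Sum>n\<in>{n\<in>{..N}. x < two_sided_max v N f n}. v n) \<le> (\<Sum>n\<in>?L \<union> ?R. v n)"
    using v0 by (intro sum_mono2) (auto simp: two_sided_max_def)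
  also have "\<dots> \<le> (\<Sum>n\<in>?L. v n) + (\<Sum>n\<in>?R. v n)"
    using v0 by (subst sum_Un) (auto intro!: sum_nonneg)
  finally have "x * (\<Sum>n\<in>{n\<in>{..N}. x < two_sided_max v N f n}. v n)
      \<le> 2 * (x / 2 * (\<Sum>n\<in>?L. v n)) + 2 * (x / 2 * (\<Sum>n\<in>?R. v n))"
    using True by (simp add: distrib_left[symmetric])
  also have "\<dots> \<le> 2 * (\<Sum>n\<in>?L. f n * v n) + 2 * (\<Sum>n\<in>?R. f n * v n)"
    using left_max_weak[of N v "x / 2" f] right_max_weak[of N v "x / 2" f] v by simp
  also have "\<dots> \<le> 2 * (\<Sum>n\<le>N. f n * v n) + 2 * (\<Sum>n\<le>N. f n * v n)"
    using v0 by (intro add_mono mult_left_mono sum_mono2) auto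
  finally show ?thesis by simp
next
  case False
  have "x * (\<Sum>n\<in>{n\<in>{..N}. x < two_sided_max v N f n}. v n) \<le> 0"
    using False v by (intro mult_nonpos_nonneg sum_nonneg) (auto intro: less_imp_le)
  also have "0 \<le> 4 * (\<Sum>n\<le>N. f n * v n)"
    using v f by (auto intro!: sum_nonneg mult_nonneg_nonneg intro: less_imp_le)
  finally show ?thesis .
qed

lemma powr_add_le:
  fixes x y q :: real
  assumes "0 \<le> x" "0 \<le> y" "0 < q"
  shows "(x + y) powr q \<le> 2 powr q * (x powr q + y powr q)"
proof -
  have "(x + y) powr q \<le> (2 * max x y) powr q"
    using assms by (intro powr_mono2) auto
  also have "\<dots> = 2 powr q * max x y powr q"
    using assms by (simp add: powr_mult)
  also have "\<dots> \<le> 2 powr q * (x powr q + y powr q)"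
    by (auto simp: max_def)
  finally show ?thesis .
qed

lemma two_sided_max_lp:
  assumes q: "1 < q"
    and v: "\<And>k. k \<le> N \<Longrightarrow> 0 < v k" and f: "\<And>k. k \<le> N \<Longrightarrow> 0 \<le> f k"
  shows "(\<Sum>n\<le>N. two_sided_max v N f n powr q * v n)
     \<le> 2 * 2 powr q * (q / (q - 1)) powr q * (\<Sum>n\<le>N. f n powr q * v n)"
proof -
  have L: "(\<Sum>n\<le>N. left_max v f n powr q * v n) \<le> (q / (q - 1)) powr q * (\<Sum>n\<le>N. f n powr q * v n)"
  proof (rule lp_bound_of_weak_bound[OF finite_atMost q])
    show "0 \<le> left_max v f n" if "n \<in> {..N}" for n
      using that v f by (intro left_max_nonneg) auto
    show "x * (\<Sum>n\<in>{n\<in>{..N}. x < left_max v f n}. v n) \<le> (\<Sum>n\<in>{n\<in>{..N}. x < left_max v f n}. f n * v n)" for x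
      by (rule left_max_weak[OF v])
  qed (use v f in \<open>simp_all add: less_imp_le\<close>)
  have R: "(\<Sum>n\<le>N. right_max v N f n powr q * v n) \<le> (q / (q - 1)) powr q * (\<Sum>n\<le>N. f n powr q * v n)"
  proof (rule lp_bound_of_weak_bound[OF finite_atMost q])
    show "0 \<le> right_max v N f n" if "n \<in> {..N}" for n
      using that v f by (intro right_max_nonneg) auto
    show "x * (\<Sum>n\<in>{n\<in>{..N}. x < right_max v N f n}. v n) \<le> (\<Sum>n\<in>{n\<in>{..N}. x < right_max v N f n}. f n * v n)" for x
      by (rule right_max_weak[OF v])
  qed (use v f in \<open>simp_all add: less_imp_le\<close>)
  have "(\<Sum>n\<le>N. two_sided_max v N f n powr q * v n)
      \<le> (\<Sum>n\<le>N. 2 powr q * (left_max v f n powr q + right_max v N f n powr q) * v n)"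
    unfolding two_sided_max_def using q v f
    by (intro sum_mono mult_right_mono powr_add_le left_max_nonneg right_max_nonneg) (auto intro: less_imp_le)
  also have "\<dots> = 2 powr q * ((\<Sum>n\<le>N. left_max v f n powr q * v n) + (\<Sum>n\<le>N. right_max v N f n powr q * v n))"
    by (simp add: sum_distrib_left sum.distrib distrib_left distrib_right mult.assoc)
  also have "\<dots> \<le> 2 powr q * (2 * ((q / (q - 1)) powr q * (\<Sum>n\<le>N. f n powr q * v n)))"
    using L R by (intro mult_left_mono) auto
  finally show ?thesis by (simp add: mult_ac)
qed

section \<open>Muckenhoupt weights\<close>

abbreviation hl_cut :: "nat \<Rightarrow> (nat \<Rightarrow> real) \<Rightarrow> nat \<Rightarrow> real" where
  "hl_cut \<equiv> two_sided_max (\<lambda>_. 1)"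

lemma avg_one: "avg (\<lambda>_. 1) f I = (\<Sum>k\<in>I. f k) / real (card I)"
  by (simp add: avg_def)

lemma two_sided_max_le:
  assumes n: "n \<le> N" and "\<And>a. a \<le> n \<Longrightarrow> avg v f {a..n} \<le> c" "\<And>b. n \<le> b \<Longrightarrow> b \<le> N \<Longrightarrow> avg v f {n..b} \<le> c"
  shows "two_sided_max v N f n \<le> 2 * c"
proof -
  have "left_max v f n \<le> c" "right_max v N f n \<le> c"
    unfolding left_max_def right_max_def using assms by (subst Max_le_iff; auto)+
  then show ?thesis unfolding two_sided_max_def by simp
qed

lemma two_sided_max_nonneg:
  assumes "n \<le> N" "\<And>k. k \<le> N \<Longrightarrow> 0 < v k" "\<And>k. k \<le> N \<Longrightarrow> 0 \<le> f k"
  shows "0 \<le> two_sided_max v N f n"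
  unfolding two_sided_max_def using assms by (intro add_nonneg_nonneg left_max_nonneg right_max_nonneg) auto

text \<open>Lerner's pointwise estimate.  For an interval \<open>Q\<close> and \<open>m = avg \<sigma> (f/\<sigma>) Q\<close>, the plain average of \<open>f\<close> is
\<open>\<sigma>(Q)/\<bar>Q\<bar> \<cdot> m\<close>, and the \<open>A\<^sub>p\<close> condition turns its power \<open>p - 1\<close> into \<open>A \<bar>Q\<bar> m\<^bsup>p-1\<^esup> / w(Q)\<close>.  Since \<open>m\<close> is at most the
maximal function of \<open>f/\<sigma>\<close> at each point of \<open>Q\<close>, the factor \<open>\<bar>Q\<bar> m\<^bsup>p-1\<^esup>\<close> is at most a sum over \<open>Q\<close>, and the
quotient by \<open>w(Q)\<close> is an average with respect to \<open>w\<close>.\<close>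

lemma Ap_avg_le:
  fixes w :: "nat \<Rightarrow> real"
  assumes p: "1 < p" and w: "\<And>k. 0 < w k" and f: "\<And>k. 0 \<le> f k"
    and Ap: "1 / real (b - a + 1) powr p * (\<Sum>k=a..b. w k) *
                  (\<Sum>k=a..b. w k powr (- 1 / (p - 1))) powr (p - 1) \<le> A"
    and ab: "a \<le> b" "b \<le> N"
  defines "\<sigma> \<equiv> \<lambda>k. w k powr (- 1 / (p - 1))"
  shows "avg (\<lambda>_. 1) f {a..b} powr (p - 1)
    \<le> A * avg w (\<lambda>k. two_sided_max \<sigma> N (\<lambda>k. f k / \<sigma> k) k powr (p - 1) / w k) {a..b}"
proof -
  let ?Q = "{a..b}"
  define L where "L = real (card ?Q)"
  have L: "0 < L" "L = real (b - a + 1)" using ab by (auto simp: L_def)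
  have \<sigma>: "0 < \<sigma> k" for k using w[of k] by (simp add: \<sigma>_def)
  define W S where "W = (\<Sum>k\<in>?Q. w k)" and "S = (\<Sum>k\<in>?Q. \<sigma> k)"
  have W: "0 < W" and S: "0 < S"
    unfolding W_def S_def using w \<sigma> ab by (auto intro!: sum_pos)
  define h where "h k = f k / \<sigma> k" for k
  have h: "0 \<le> h k" for k using f[of k] \<sigma>[of k] by (simp add: h_def)
  define M where "M = two_sided_max \<sigma> N h"
  define m where "m = avg \<sigma> h ?Q"
  have m0: "0 \<le> m" unfolding m_def using \<sigma> h by (intro avg_nonneg) auto
  have mM: "m \<le> M k" if "k \<in> ?Q" for k
    unfolding m_def M_def using that ab \<sigma> h by (intro avg_le_two_sided_max) auto
  have "(\<Sum>k\<in>?Q. h k * \<sigma> k) = (\<Sum>k\<in>?Q. f k)"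
    using \<sigma> by (intro sum.cong) (auto simp: h_def less_imp_neq[symmetric])
  then have "avg (\<lambda>_. 1) f ?Q = S / L * m"
    using S by (simp add: avg_def m_def S_def[symmetric] L_def)
  then have "avg (\<lambda>_. 1) f ?Q powr (p - 1) = S powr (p - 1) / L powr (p - 1) * m powr (p - 1)"
    by (simp add: powr_mult powr_divide)
  also have "S powr (p - 1) \<le> A * L powr p / W"
  proof -
    have "1 / L powr p * W * S powr (p - 1) \<le> A"
      using Ap unfolding L(2) W_def S_def \<sigma>_def .
    then show ?thesis using L(1) W by (simp add: field_simps)
  qed
  then have "S powr (p - 1) / L powr (p - 1) * m powr (p - 1)
      \<le> (A * L powr p / W) / L powr (p - 1) * m powr (p - 1)"
    using L by (intro mult_right_mono divide_right_mono) auto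
  also have "\<dots> = A * (L * m powr (p - 1)) / W"
    using L powr_add[of L "p - 1" 1] by simp
  also have "L * m powr (p - 1) = (\<Sum>k\<in>?Q. m powr (p - 1))"
    by (simp add: L_def)
  also have A0: "0 \<le> A"
  proof -
    have "0 \<le> 1 / real (b - a + 1) powr p * (\<Sum>k=a..b. w k) * (\<Sum>k=a..b. w k powr (- 1 / (p - 1))) powr (p - 1)"
      using w by (intro mult_nonneg_nonneg sum_nonneg) (auto intro: less_imp_le)
    then show ?thesis using Ap by linarith
  qed
  have "A * (\<Sum>k\<in>?Q. m powr (p - 1)) / W \<le> A * (\<Sum>k\<in>?Q. (M k powr (p - 1) / w k) * w k) / W"
  proof (intro divide_right_mono mult_left_mono sum_mono A0)
    fix k assume "k \<in> ?Q"
    then show "m powr (p - 1) \<le> M k powr (p - 1) / w k * w k"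
      using mM[of k] m0 p w[of k] by (simp add: powr_mono2)
  qed (use W in auto)
  also have "\<dots> = A * avg w (\<lambda>k. M k powr (p - 1) / w k) ?Q"
    by (simp add: avg_def W_def)
  finally show ?thesis by (simp add: M_def h_def[abs_def])
qed

text \<open>Muckenhoupt's theorem.  The pointwise estimate is followed by the bound for \<open>M\<^sub>w\<close> with the exponent
\<open>p' = p/(p-1)\<close> and by the bound for \<open>M\<^sub>\<sigma>\<close> with the exponent \<open>p\<close>.  The exponents fit together because
\<open>w\<^bsup>1-p'\<^esup> = \<sigma>\<close> and \<open>\<sigma>\<^bsup>1-p\<^esup> = w\<close>.\<close>

lemma Ap_maximal_bound:
  fixes w :: "nat \<Rightarrow> real"
  assumes p: "1 < p" and Ap: "Ap_weight p w"
  obtains C where "0 < C"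
    "\<And>N f. (\<And>k. 0 \<le> f k) \<Longrightarrow>
       (\<Sum>n\<le>N. hl_cut N f n powr p * w n) \<le> C * (\<Sum>n\<le>N. f n powr p * w n)"
proof -
  have w: "0 < w k" for k using Ap by (simp add: Ap_weight_def weight_def)
  from Ap obtain A0 where A0: "\<And>n m. n \<le> m \<Longrightarrow> 1 / real (m - n + 1) powr p * (\<Sum>k=n..m. w k) *
                  (\<Sum>k=n..m. w k powr (- 1 / (p - 1))) powr (p - 1) \<le> A0"
    unfolding Ap_weight_def bdd_above_def by blast
  define A where "A = max A0 1"
  have A: "1 \<le> A" "\<And>n m. n \<le> m \<Longrightarrow> 1 / real (m - n + 1) powr p * (\<Sum>k=n..m. w k) *
                  (\<Sum>k=n..m. w k powr (- 1 / (p - 1))) powr (p - 1) \<le> A"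
    using A0 by (force simp: A_def)+
  define \<sigma> where "\<sigma> k = w k powr (- 1 / (p - 1))" for k
  have \<sigma>: "0 < \<sigma> k" for k using w[of k] by (simp add: \<sigma>_def)
  define p' where "p' = p / (p - 1)"
  have p': "1 < p'" "(p - 1) * p' = p" "1 / (p - 1) * p = p'" using p by (auto simp: p'_def field_simps)
  define c where "c q = 2 * 2 powr q * (q / (q - 1)) powr q" for q :: real
  have c0: "0 < c q" if "1 < q" for q using that by (simp add: c_def)
  define C where "C = 2 powr p * A powr p' * (c p' * c p)"
  have "0 < C" using A p p' c0 by (simp add: C_def)
  moreover have "(\<Sum>n\<le>N. hl_cut N f n powr p * w n) \<le> C * (\<Sum>n\<le>N. f n powr p * w n)"
    if f: "\<And>k. 0 \<le> f k" for N f
  proof -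
    define h where "h k = f k / \<sigma> k" for k
    have h: "0 \<le> h k" for k using f[of k] \<sigma>[of k] by (simp add: h_def)
    define G where "G k = two_sided_max \<sigma> N h k powr (p - 1) / w k" for k
    have G: "0 \<le> G k" for k using w[of k] by (simp add: G_def)
    define M where "M = two_sided_max w N G"
    have M: "0 \<le> M n" if "n \<le> N" for n
      unfolding M_def using that w G by (intro two_sided_max_nonneg) auto
    have avg: "avg (\<lambda>_. 1) f {a..b} \<le> (A * M n) powr (1 / (p - 1))" if "a \<le> n" "n \<le> b" "b \<le> N" for a b n
    proof -
      have "avg (\<lambda>_. 1) f {a..b} powr (p - 1) \<le> A * avg w G {a..b}"
        using Ap_avg_le[of p w f b a A N] p w f A(2)[of a b] that
        unfolding G_def h_def \<sigma>_def by simp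
      also have "avg w G {a..b} \<le> M n"
        unfolding M_def using that w G by (intro avg_le_two_sided_max) auto
      finally have "avg (\<lambda>_. 1) f {a..b} powr (p - 1) \<le> A * M n"
        using A by simp
      then have "(avg (\<lambda>_. 1) f {a..b} powr (p - 1)) powr (1 / (p - 1)) \<le> (A * M n) powr (1 / (p - 1))"
        using p by (intro powr_mono2) auto
      moreover have "0 \<le> avg (\<lambda>_. 1) f {a..b}" using f by (intro avg_nonneg) auto
      ultimately show ?thesis using p by (simp add: powr_powr)
    qed
    have "hl_cut N f n powr p * w n \<le> 2 powr p * A powr p' * (M n powr p' * w n)"
      if n: "n \<le> N" for n
    proof -
      have "hl_cut N f n \<le> 2 * (A * M n) powr (1 / (p - 1))"
        using n avg by (intro two_sided_max_le) auto
      moreover have "0 \<le> hl_cut N f n" using n f by (intro two_sided_max_nonneg) auto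
      ultimately have "hl_cut N f n powr p \<le> (2 * (A * M n) powr (1 / (p - 1))) powr p"
        using p by (intro powr_mono2) auto
      also have "\<dots> = 2 powr p * (A powr p' * M n powr p')"
        using p' by (simp add: powr_mult powr_powr)
      finally have "hl_cut N f n powr p * w n \<le> 2 powr p * (A powr p' * M n powr p') * w n"
        using w[of n] by (intro mult_right_mono) auto
      then show ?thesis by (simp add: mult_ac)
    qed
    then have "(\<Sum>n\<le>N. hl_cut N f n powr p * w n)
        \<le> 2 powr p * A powr p' * (\<Sum>n\<le>N. M n powr p' * w n)"
      unfolding sum_distrib_left by (intro sum_mono) auto
    also have "(\<Sum>n\<le>N. M n powr p' * w n) \<le> c p' * (\<Sum>n\<le>N. G n powr p' * w n)"
      unfolding M_def c_def by (rule two_sided_max_lp) (use p' w G in auto)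
    also have "(\<Sum>n\<le>N. G n powr p' * w n) = (\<Sum>n\<le>N. two_sided_max \<sigma> N h n powr p * \<sigma> n)"
    proof (rule sum.cong[OF refl])
      fix n
      have "w n powr p' = w n * w n powr (1 / (p - 1))"
      proof -
        have "p' = 1 + 1 / (p - 1)" using p by (simp add: p'_def field_simps)
        then show ?thesis using w[of n] by (simp add: powr_add)
      qed
      moreover have "\<sigma> n = 1 / w n powr (1 / (p - 1))"
        using w[of n] by (simp add: \<sigma>_def powr_minus_divide)
      ultimately show "G n powr p' * w n = two_sided_max \<sigma> N h n powr p * \<sigma> n"
        using w[of n] p' by (simp add: G_def powr_divide powr_powr)
    qed
    also have "\<dots> \<le> c p * (\<Sum>n\<le>N. h n powr p * \<sigma> n)"
      unfolding c_def by (rule two_sided_max_lp) (use p \<sigma> h in auto)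
    also have "(\<Sum>n\<le>N. h n powr p * \<sigma> n) = (\<Sum>n\<le>N. f n powr p * w n)"
    proof (rule sum.cong[OF refl])
      fix n
      have "- 1 / (p - 1) * p = - 1 / (p - 1) - 1" using p by (simp add: field_simps)
      then have "\<sigma> n powr p = \<sigma> n / w n"
        using w[of n] unfolding \<sigma>_def by (simp add: powr_powr powr_diff)
      then show "h n powr p * \<sigma> n = f n powr p * w n"
        using w[of n] \<sigma>[of n] by (simp add: h_def powr_divide)
    qed
    finally show ?thesis
      using c0[OF p] c0[OF p'(1)] A(1) by (simp add: C_def mult_ac)
  qed
  ultimately show ?thesis by (rule that)
qed

text \<open>For \<open>A\<^sub>1\<close> weights the plain averages are at most a constant times the averages with respect to \<open>w\<close>, whose
maximal function is of weak type with respect to \<open>w\<close>.\<close>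

lemma A1_maximal_bound:
  fixes w :: "nat \<Rightarrow> real"
  assumes A1: "A1_weight w"
  obtains C where "0 < C"
    "\<And>N f x. (\<And>k. 0 \<le> f k) \<Longrightarrow>
       x * (\<Sum>n\<in>{n\<in>{..N}. x < hl_cut N f n}. w n) \<le> C * (\<Sum>n\<le>N. f n * w n)"
proof -
  have w: "0 < w k" for k using A1 by (simp add: A1_weight_def weight_def)
  from A1 obtain A0 where A0: "\<And>n m. n \<le> m \<Longrightarrow> 1 / real (m - n + 1) * (\<Sum>k=n..m. w k) *
                  Max ((\<lambda>k. inverse (w k)) ` {n..m}) \<le> A0"
    unfolding A1_weight_def bdd_above_def by blast
  define A where "A = max A0 1"
  have A: "1 \<le> A" "\<And>n m. n \<le> m \<Longrightarrow> 1 / real (m - n + 1) * (\<Sum>k=n..m. w k) *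
                  Max ((\<lambda>k. inverse (w k)) ` {n..m}) \<le> A"
    using A0 by (force simp: A_def)+
  have avg: "avg (\<lambda>_. 1) f {a..b} \<le> A * avg w f {a..b}" if "a \<le> b" and f: "\<And>k. 0 \<le> f k" for a b f
  proof -
    define R where "R = Max ((\<lambda>k. inverse (w k)) ` {a..b})"
    have R: "inverse (w k) \<le> R" if "k \<in> {a..b}" for k
      unfolding R_def using that by (intro Max_ge) auto
    have W: "0 < (\<Sum>k=a..b. w k)" using w that by (intro sum_pos) auto
    have L: "real (card {a..b}) = real (b - a + 1)" "0 < real (b - a + 1)"
      using that by (auto simp: of_nat_diff)
    have "(\<Sum>k=a..b. f k) = (\<Sum>k=a..b. inverse (w k) * (f k * w k))"
    proof (rule sum.cong[OF refl])
      fix k show "f k = inverse (w k) * (f k * w k)" using w[of k] by simp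
    qed
    also have "\<dots> \<le> (\<Sum>k=a..b. R * (f k * w k))"
      using R w f by (intro sum_mono mult_right_mono mult_nonneg_nonneg) (auto intro: less_imp_le)
    finally have "(\<Sum>k=a..b. f k) \<le> R * (\<Sum>k=a..b. f k * w k)" by (simp add: sum_distrib_left)
    moreover have "R \<le> A * real (b - a + 1) / (\<Sum>k=a..b. w k)"
    proof -
      have "1 / real (b - a + 1) * (\<Sum>k=a..b. w k) * R \<le> A"
        using A(2)[OF that(1)] unfolding R_def .
      then show ?thesis using W L(2) by (simp only: pos_le_divide_eq) (simp add: divide_le_eq mult_ac)
    qed
    then have "R * (\<Sum>k=a..b. f k * w k) \<le> A * real (b - a + 1) / (\<Sum>k=a..b. w k) * (\<Sum>k=a..b. f k * w k)"
      using f w by (intro mult_right_mono sum_nonneg mult_nonneg_nonneg) (auto intro: less_imp_le)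
    ultimately have "(\<Sum>k=a..b. f k) \<le> A * avg w f {a..b} * real (b - a + 1)"
      by (simp add: avg_def mult_ac)
    then show ?thesis
      unfolding avg_one L using L(2) by (subst pos_divide_le_eq) auto
  qed
  have bound: "x * (\<Sum>n\<in>{n\<in>{..N}. x < hl_cut N f n}. w n) \<le> 4 * (2 * A) * (\<Sum>n\<le>N. f n * w n)"
    if f: "\<And>k. 0 \<le> f k" for N f x
  proof (cases "0 \<le> x")
    case True
    have le: "hl_cut N f n \<le> 2 * A * two_sided_max w N f n" if n: "n \<le> N" for n
      unfolding mult.assoc
    proof (rule two_sided_max_le[OF n])
      fix a assume a: "a \<le> n"
      have "avg w f {a..n} \<le> two_sided_max w N f n"
        using a n w f by (intro avg_le_two_sided_max) auto
      then show "avg (\<lambda>_. 1) f {a..n} \<le> A * two_sided_max w N f n"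
        using order_trans[OF avg[OF a f] mult_left_mono] A(1) by simp
    next
      fix b assume b: "n \<le> b" "b \<le> N"
      have "avg w f {n..b} \<le> two_sided_max w N f n"
        using b n w f by (intro avg_le_two_sided_max) auto
      then show "avg (\<lambda>_. 1) f {n..b} \<le> A * two_sided_max w N f n"
        using order_trans[OF avg[OF b(1) f] mult_left_mono] A(1) by simp
    qed
    have sub: "{n\<in>{..N}. x < hl_cut N f n} \<subseteq> {n\<in>{..N}. x / (2 * A) < two_sided_max w N f n}"
    proof
      fix n assume n: "n \<in> {n\<in>{..N}. x < hl_cut N f n}"
      then have "x < 2 * A * two_sided_max w N f n" using le[of n] by simp
      then show "n \<in> {n\<in>{..N}. x / (2 * A) < two_sided_max w N f n}"
        using A(1) n by (simp add: field_simps)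
    qed
    have "x * (\<Sum>n\<in>{n\<in>{..N}. x < hl_cut N f n}. w n)
        \<le> x * (\<Sum>n\<in>{n\<in>{..N}. x / (2 * A) < two_sided_max w N f n}. w n)"
      using True w by (intro mult_left_mono sum_mono2 sub) (auto intro: less_imp_le)
    also have "\<dots> = 2 * A * (x / (2 * A) * (\<Sum>n\<in>{n\<in>{..N}. x / (2 * A) < two_sided_max w N f n}. w n))"
      using A(1) by simp
    also have "\<dots> \<le> 2 * A * (4 * (\<Sum>n\<le>N. f n * w n))"
      using A(1) w f by (intro mult_left_mono two_sided_max_weak) auto
    finally show ?thesis by (simp add: mult_ac)
  next
    case False
    have "x * (\<Sum>n\<in>{n\<in>{..N}. x < hl_cut N f n}. w n) \<le> 0"
      using False w by (intro mult_nonpos_nonneg sum_nonneg) (auto intro: less_imp_le)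
    also have "0 \<le> 4 * (2 * A) * (\<Sum>n\<le>N. f n * w n)"
      using w f A(1) by (auto intro!: sum_nonneg mult_nonneg_nonneg intro: less_imp_le)
    finally show ?thesis .
  qed
  show ?thesis
    by (rule that[of "4 * (2 * A)"]) (use A(1) bound in auto)
qed

text \<open>Summation by parts: a nonnegative decreasing sequence is a positive combination of indicator functions of
initial segments.\<close>

lemma sum_decreasing_weights_le:
  fixes F k :: "nat \<Rightarrow> real"
  assumes k: "\<And>j. k (Suc j) \<le> k j" "\<And>j. 0 \<le> k j"
    and S: "\<And>j. j \<le> L \<Longrightarrow> (\<Sum>i\<le>j. F i) \<le> real (Suc j) * M"
  shows "(\<Sum>j\<le>L. F j * k j) \<le> M * (\<Sum>j\<le>L. k j)"
proof -
  have abel: "(\<Sum>j\<le>l. G j * k j) = (\<Sum>j<l. (\<Sum>i\<le>j. G i) * (k j - k (Suc j))) + (\<Sum>i\<le>l. G i) * k l"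
    for G :: "nat \<Rightarrow> real" and l
    by (induction l) (simp_all add: algebra_simps)
  have S': "(\<Sum>i\<le>j. F i) \<le> (\<Sum>i\<le>j. M)" if "j \<le> L" for j
    using S[OF that] by simp
  have "(\<Sum>j<L. (\<Sum>i\<le>j. F i) * (k j - k (Suc j))) \<le> (\<Sum>j<L. (\<Sum>i\<le>j. M) * (k j - k (Suc j)))"
    by (rule sum_mono, rule mult_right_mono) (use S' k in auto)
  moreover have "(\<Sum>i\<le>L. F i) * k L \<le> (\<Sum>i\<le>L. M) * k L"
    by (rule mult_right_mono) (use S' k in auto)
  ultimately have "(\<Sum>j\<le>L. F j * k j) \<le> (\<Sum>j\<le>L. M * k j)"
    unfolding abel[of F] abel[of "\<lambda>_. M"] by linarith
  then show ?thesis by (simp add: sum_distrib_left)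
qed

text \<open>The term \<open>j = 0\<close> is at most 1, and the others are at most the increments of \<open>arctan (j / r)\<close>.\<close>

lemma sum_poisson_weights_le:
  fixes r :: real
  assumes r: "1 \<le> r"
  shows "(\<Sum>j\<le>L. r / (r\<^sup>2 + (real j)\<^sup>2)) \<le> 3"
proof -
  have "(\<Sum>j\<le>L. r / (r\<^sup>2 + (real j)\<^sup>2)) \<le> 1 + arctan (real L / r)"
  proof (induction L)
    case 0
    show ?case using r by (simp add: power2_eq_square)
  next
    case (Suc L)
    have "\<exists>z>real L. z < real (Suc L) \<and> arctan (real (Suc L) / r) - arctan (real L / r)
        = (real (Suc L) - real L) * (r / (r\<^sup>2 + z\<^sup>2))"
    proof (rule MVT2)
      fix z
      have "0 < r\<^sup>2 + z\<^sup>2" using r by (simp add: sum_power2_gt_zero_iff)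
      then have "inverse (1 + (z / r)\<^sup>2) * (1 / r) = r / (r\<^sup>2 + z\<^sup>2)"
        using r by (simp add: field_simps power2_eq_square)
      moreover have "((\<lambda>x. arctan (x / r)) has_real_derivative inverse (1 + (z / r)\<^sup>2) * (1 / r)) (at z)"
        using r by (auto intro!: derivative_eq_intros simp: divide_inverse)
      ultimately show "((\<lambda>x. arctan (x / r)) has_real_derivative r / (r\<^sup>2 + z\<^sup>2)) (at z)"
        by simp
    qed simp
    then obtain z where z: "real L < z" "z < real (Suc L)"
      "arctan (real (Suc L) / r) - arctan (real L / r) = r / (r\<^sup>2 + z\<^sup>2)"
      by auto
    have "r / (r\<^sup>2 + (real (Suc L))\<^sup>2) \<le> r / (r\<^sup>2 + z\<^sup>2)"
      using z r by (intro divide_left_mono add_mono power_mono mult_pos_pos add_pos_nonneg) auto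
    then show ?case using Suc z by simp
  qed
  also have "\<dots> \<le> 1 + pi / 2"
    using arctan_ubound[of "real L / r"] by simp
  also have "\<dots> \<le> 3" using pi_less_4 by simp
  finally show ?thesis .
qed

text \<open>The sums over \<open>m \<ge> n\<close> and \<open>m \<le> n\<close> have decreasing weights, and their partial sums without weights are
averages over intervals that begin or end at \<open>n\<close>.\<close>

lemma poisson_sum_le_two_sided_max:
  assumes r: "1 \<le> r" and n: "n \<le> N" and F: "\<And>k. 0 \<le> F k"
  shows "(\<Sum>m\<le>N. F m * (r / (r\<^sup>2 + (real m - real n)\<^sup>2))) \<le> 3 * hl_cut N F n"
proof -
  define k where "k j = r / (r\<^sup>2 + (real j)\<^sup>2)" for j
  have k0: "0 \<le> k j" for j using r by (simp add: k_def)
  have k1: "k (Suc j) \<le> k j" for j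
    unfolding k_def using r
    by (intro divide_left_mono add_mono power_mono mult_pos_pos add_pos_nonneg) auto
  have ksum: "(\<Sum>j\<le>L. k j) \<le> 3" for L
    unfolding k_def by (rule sum_poisson_weights_le[OF r])
  have R: "(\<Sum>m=n..N. F m * (r / (r\<^sup>2 + (real m - real n)\<^sup>2))) \<le> 3 * right_max (\<lambda>_. 1) N F n"
  proof -
    have "(\<Sum>m=n..N. F m * (r / (r\<^sup>2 + (real m - real n)\<^sup>2))) = (\<Sum>j\<le>N - n. F (n + j) * k j)"
      by (rule sum.reindex_bij_witness[of _ "\<lambda>j. n + j" "\<lambda>m. m - n"]) (use n in \<open>auto simp: k_def of_nat_diff\<close>)
    also have "\<dots> \<le> right_max (\<lambda>_. 1) N F n * (\<Sum>j\<le>N - n. k j)"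
    proof (rule sum_decreasing_weights_le[of k, OF k1 k0])
      fix j assume j: "j \<le> N - n"
      have "(\<Sum>i\<le>j. F (n + i)) = (\<Sum>m=n..n + j. F m)"
        by (rule sum.reindex_bij_witness[of _ "\<lambda>m. m - n" "\<lambda>j. n + j"]) auto
      also have "\<dots> = real (Suc j) * avg (\<lambda>_. 1) F {n..n + j}"
        by (simp add: avg_one)
      also have "\<dots> \<le> real (Suc j) * right_max (\<lambda>_. 1) N F n"
        using j n by (intro mult_left_mono right_max_ge) auto
      finally show "(\<Sum>i\<le>j. F (n + i)) \<le> real (Suc j) * right_max (\<lambda>_. 1) N F n" .
    qed
    also have "\<dots> \<le> right_max (\<lambda>_. 1) N F n * 3"
      using F n by (intro mult_left_mono ksum right_max_nonneg) auto
    finally show ?thesis by simp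
  qed
  have L: "(\<Sum>m=0..n. F m * (r / (r\<^sup>2 + (real m - real n)\<^sup>2))) \<le> 3 * left_max (\<lambda>_. 1) F n"
  proof -
    have "(\<Sum>m=0..n. F m * (r / (r\<^sup>2 + (real m - real n)\<^sup>2))) = (\<Sum>j\<le>n. F (n - j) * k j)"
      by (rule sum.reindex_bij_witness[of _ "\<lambda>j. n - j" "\<lambda>m. n - m"])
         (auto simp: k_def of_nat_diff power2_commute)
    also have "\<dots> \<le> left_max (\<lambda>_. 1) F n * (\<Sum>j\<le>n. k j)"
    proof (rule sum_decreasing_weights_le[of k, OF k1 k0])
      fix j assume j: "j \<le> n"
      have "(\<Sum>i\<le>j. F (n - i)) = (\<Sum>m=n - j..n. F m)"
        by (rule sum.reindex_bij_witness[of _ "\<lambda>m. n - m" "\<lambda>j. n - j"]) (use j in auto)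
      also have "\<dots> = real (Suc j) * avg (\<lambda>_. 1) F {n - j..n}"
        using j by (simp add: avg_one)
      also have "\<dots> \<le> real (Suc j) * left_max (\<lambda>_. 1) F n"
        using j n by (intro mult_left_mono left_max_ge) auto
      finally show "(\<Sum>i\<le>j. F (n - i)) \<le> real (Suc j) * left_max (\<lambda>_. 1) F n" .
    qed
    also have "\<dots> \<le> left_max (\<lambda>_. 1) F n * 3"
      using F n by (intro mult_left_mono ksum left_max_nonneg) auto
    finally show ?thesis by simp
  qed
  have "{..N} = {0..n} \<union> {n..N}" using n by auto
  then have "(\<Sum>m\<le>N. F m * (r / (r\<^sup>2 + (real m - real n)\<^sup>2)))
      \<le> (\<Sum>m=0..n. F m * (r / (r\<^sup>2 + (real m - real n)\<^sup>2))) + (\<Sum>m=n..N. F m * (r / (r\<^sup>2 + (real m - real n)\<^sup>2)))"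
    using F r by (simp only:) (subst sum_Un; auto intro!: sum_nonneg)
  then show ?thesis using L R unfolding two_sided_max_def by simp
qed

section \<open>Approximation by trigonometric polynomials in the mean\<close>

lemmas integral_cmult = Henstock_Kurzweil_Integration.integral_mult_right

text \<open>Minkowski's inequality for integrals, in \<open>L\<^sup>1\<close>.\<close>

lemma integral_abs_integral_le:
  fixes \<psi> :: "real \<Rightarrow> real \<Rightarrow> real"
  assumes cont: "continuous_on UNIV (\<lambda>(x, y). \<psi> x y)"
    and B: "\<And>y. y \<in> {c..d} \<Longrightarrow> integral {a..b} (\<lambda>x. \<bar>\<psi> x y\<bar>) \<le> B y" "B integrable_on {c..d}"
  shows "integral {a..b} (\<lambda>x. \<bar>integral {c..d} (\<psi> x)\<bar>) \<le> integral {c..d} B"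
proof -
  have cont': "continuous_on S (\<lambda>(x, y). \<psi> x y)" for S
    using continuous_on_subset[OF cont] by simp
  have cx: "continuous_on S (\<psi> x)" for x S
  proof -
    have "continuous_on S ((\<lambda>(x, y). \<psi> x y) \<circ> Pair x)"
      by (intro continuous_on_compose continuous_intros cont')
    then show ?thesis by (simp add: o_def)
  qed
  have cy: "continuous_on S (\<lambda>x. \<psi> x y)" for y S
  proof -
    have "continuous_on S ((\<lambda>(x, y). \<psi> x y) \<circ> (\<lambda>x. (x, y)))"
      by (intro continuous_on_compose continuous_intros cont')
    then show ?thesis by (simp add: o_def)
  qed
  have cabs: "continuous_on S (\<lambda>(x, y). \<bar>\<psi> x y\<bar>)" for S
    using continuous_on_rabs[OF cont'[of S]] by (simp add: case_prod_unfold)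
  have cabs': "continuous_on S (\<lambda>(x, y). \<bar>\<psi> y x\<bar>)" for S
  proof -
    have "continuous_on S ((\<lambda>(x, y). \<bar>\<psi> x y\<bar>) \<circ> prod.swap)"
      by (intro continuous_on_compose continuous_intros cabs continuous_on_swap)
    then show ?thesis by (simp add: o_def case_prod_unfold)
  qed
  have c1: "continuous_on {a..b} (\<lambda>x. integral {c..d} (\<psi> x))"
    using integral_continuous_on_param[of "{a..b}" c d \<psi>] cont' by simp
  have c2: "continuous_on {a..b} (\<lambda>x. integral {c..d} (\<lambda>y. \<bar>\<psi> x y\<bar>))"
    using integral_continuous_on_param[of "{a..b}" c d "\<lambda>x y. \<bar>\<psi> x y\<bar>"] cabs by simp
  have c3: "continuous_on {c..d} (\<lambda>y. integral {a..b} (\<lambda>x. \<bar>\<psi> x y\<bar>))"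
    using integral_continuous_on_param[of "{c..d}" a b "\<lambda>y x. \<bar>\<psi> x y\<bar>"] cabs' by simp
  have "integral {a..b} (\<lambda>x. \<bar>integral {c..d} (\<psi> x)\<bar>) \<le> integral {a..b} (\<lambda>x. integral {c..d} (\<lambda>y. \<bar>\<psi> x y\<bar>))"
  proof (rule integral_le)
    show "(\<lambda>x. \<bar>integral {c..d} (\<psi> x)\<bar>) integrable_on {a..b}"
      by (intro integrable_continuous_real continuous_intros c1)
    show "(\<lambda>x. integral {c..d} (\<lambda>y. \<bar>\<psi> x y\<bar>)) integrable_on {a..b}"
      by (intro integrable_continuous_real c2)
    fix x
    show "\<bar>integral {c..d} (\<psi> x)\<bar> \<le> integral {c..d} (\<lambda>y. \<bar>\<psi> x y\<bar>)"
      using Henstock_Kurzweil_Integration.integral_norm_bound_integral[of "\<psi> x" "{c..d}" "\<lambda>y. \<bar>\<psi> x y\<bar>"] cx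
      by (simp add: integrable_continuous_real continuous_on_rabs)
  qed
  also have "\<dots> = integral {c..d} (\<lambda>y. integral {a..b} (\<lambda>x. \<bar>\<psi> x y\<bar>))"
    using integral_swap_continuous[of a c b d "\<lambda>x y. \<bar>\<psi> x y\<bar>"] cabs by simp
  also have "\<dots> \<le> integral {c..d} B"
    by (intro integral_le B integrable_continuous_real c3)
  finally show ?thesis .
qed

text \<open>The integral of \<open>\<phi>\<close> over \<open>{u - pi..u + pi}\<close> has the derivative \<open>\<phi> (u + pi) - \<phi> (u - pi) = 0\<close> in \<open>u\<close>.\<close>

lemma integral_periodic_shift:
  fixes \<phi> :: "real \<Rightarrow> real"
  assumes cont: "continuous_on UNIV \<phi>" and per: "\<And>x. \<phi> (x + 2 * pi) = \<phi> x"
  shows "integral {-pi..pi} (\<lambda>x. \<phi> (x + v)) = integral {-pi..pi} \<phi>"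
proof -
  define R where "R = \<bar>v\<bar> + 2 * pi"
  define F where "F x = integral {-R..x} \<phi>" for x
  have c: "continuous_on S \<phi>" for S using continuous_on_subset[OF cont] by simp
  have F: "(F has_real_derivative \<phi> x) (at x)" if "x \<in> {-R<..<R}" for x
  proof -
    have "(F has_real_derivative \<phi> x) (at x within {-R..R})"
      unfolding F_def using that by (intro integral_has_real_derivative c) auto
    then show ?thesis
      using at_within_Icc_at[of "-R" x R] that by auto
  qed
  have ii: "integral {u - pi..u + pi} \<phi> = F (u + pi) - F (u - pi)" if "\<bar>u\<bar> \<le> \<bar>v\<bar>" for u
  proof -
    have "(\<phi> has_integral F (u + pi) - F (u - pi)) {u - pi..u + pi}"
    proof (rule fundamental_theorem_of_calculus)
      fix x assume "x \<in> {u - pi..u + pi}"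
      then have "x \<in> {-R<..<R}"
        using that pi_gt_zero unfolding R_def greaterThanLessThan_iff atLeastAtMost_iff by linarith
      from F[OF this] show "(F has_vector_derivative \<phi> x) (at x within {u - pi..u + pi})"
        by (simp add: has_real_derivative_iff_has_vector_derivative has_vector_derivative_at_within)
    qed simp
    then show ?thesis by (rule integral_unique)
  qed
  have "\<exists>c. \<forall>u\<in>{-\<bar>v\<bar>..\<bar>v\<bar>}. F (u + pi) - F (u - pi) = c"
  proof (rule has_field_derivative_zero_constant)
    fix u assume u: "u \<in> {-\<bar>v\<bar>..\<bar>v\<bar>}"
    then have mem: "u + pi \<in> {-R<..<R}" "u - pi \<in> {-R<..<R}"
      using pi_gt_zero unfolding R_def greaterThanLessThan_iff atLeastAtMost_iff by linarith+
    have "((\<lambda>u. F (u + pi) - F (u - pi)) has_real_derivative \<phi> (u + pi) * 1 - \<phi> (u - pi) * 1) (at u)"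
      by (intro DERIV_diff DERIV_chain2[where f = F] F mem) (auto intro!: derivative_eq_intros)
    moreover have "\<phi> (u + pi) = \<phi> (u - pi)" using per[of "u - pi"] by (simp add: add.commute)
    ultimately have "((\<lambda>u. F (u + pi) - F (u - pi)) has_real_derivative 0) (at u)" by simp
    then show "((\<lambda>u. F (u + pi) - F (u - pi)) has_real_derivative 0) (at u within {-\<bar>v\<bar>..\<bar>v\<bar>})"
      by (rule has_field_derivative_at_within)
  qed simp
  then obtain c where c: "\<And>u. u \<in> {-\<bar>v\<bar>..\<bar>v\<bar>} \<Longrightarrow> F (u + pi) - F (u - pi) = c"
    by blast
  have "F (v + pi) - F (v - pi) = F (0 + pi) - F (0 - pi)"
    using c[of v] c[of 0] by (auto simp: abs_ge_self abs_ge_minus_self minus_le_iff)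
  then have "integral {v - pi..v + pi} \<phi> = integral {0 - pi..0 + pi} \<phi>"
    using ii[of v] ii[of 0] by simp
  moreover have "integral {-pi..pi} (\<lambda>x. \<phi> (x + v)) = integral {v - pi..v + pi} \<phi>"
    using integral_shift_Icc_real[of "-pi" pi \<phi> v] by (simp add: o_def add.commute)
  ultimately show ?thesis by simp
qed

lemma integral_odd_eq_0:
  fixes f :: "real \<Rightarrow> real"
  assumes "\<And>x. f (- x) = - f x"
  shows "integral {-a..a} f = 0"
  using Henstock_Kurzweil_Integration.integral_reflect_real[of a "-a" f] assms by simp

lemma integral_cos_int:
  "integral {-pi..pi} (\<lambda>s. cos (of_int z * s)) = (if z = 0 then 2 * pi else 0)"
proof (cases "z = 0")
  case False
  have "((\<lambda>s. cos (of_int z * s)) has_integral (sin (of_int z * pi) / of_int z - sin (of_int z * (- pi)) / of_int z)) {-pi..pi}"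
  proof (rule fundamental_theorem_of_calculus)
    fix x
    have "((\<lambda>s. sin (of_int z * s) / of_int z) has_real_derivative cos (of_int z * x)) (at x within {-pi..pi})"
      using False by (auto intro!: derivative_eq_intros)
    then show "((\<lambda>s. sin (of_int z * s) / of_int z) has_vector_derivative cos (of_int z * x)) (at x within {-pi..pi})"
      by (simp add: has_real_derivative_iff_has_vector_derivative)
  qed simp
  then show ?thesis
    using False sin_npi_int[of z] by (simp add: integral_unique mult.commute)
qed simp

text \<open>The constant comes from \<open>sin x \<ge> x / 2\<close> on \<open>{0..pi/2}\<close>, applied to \<open>x = \<bar>s\<bar>/2\<close>: up to \<open>pi/3\<close> the difference of the two
sides increases, and beyond that \<open>sin x \<ge> sqrt 3 / 2 > pi / 4\<close>.\<close>

lemma one_minus_cos_ge: 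
  fixes s :: real
  assumes "\<bar>s\<bar> \<le> pi"
  shows "s\<^sup>2 / 8 \<le> 1 - cos s"
proof -
  have "x / 2 \<le> sin x" if x: "0 \<le> x" "x \<le> pi / 2" for x :: real
  proof (cases "x \<le> pi / 3")
    case True
    have "sin 0 - 0 / 2 \<le> sin x - x / 2"
    proof (rule DERIV_nonneg_imp_nondecreasing[OF x(1)])
      fix y assume y: "0 \<le> y" "y \<le> x"
      have "cos (pi / 3) \<le> cos y"
        using y True pi_gt_zero by (intro cos_monotone_0_pi_le) auto
      then show "\<exists>z. ((\<lambda>x. sin x - x / 2) has_real_derivative z) (at y) \<and> 0 \<le> z"
        by (intro exI[of _ "cos y - 1 / 2"]) (auto intro!: derivative_eq_intros simp: cos_60)
    qed
    then show ?thesis by simp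
  next
    case False
    have "sin (pi / 3) \<le> sin x"
      using False x by (intro sin_monotone_2pi_le) auto
    moreover have "(8 / 5)\<^sup>2 \<le> (3 :: real)" by (simp add: power2_eq_square)
    then have "8 / 5 \<le> sqrt 3" by (rule real_le_rsqrt)
    moreover have "pi \<le> 16 / 5" using pi_approx by (simp add: abs_le_iff)
    ultimately show ?thesis using x by (simp add: sin_60)
  qed
  from this[of "\<bar>s\<bar> / 2"] have "\<bar>s\<bar> / 4 \<le> sin (\<bar>s\<bar> / 2)" using assms by simp
  then have "(\<bar>s\<bar> / 4)\<^sup>2 \<le> (sin (\<bar>s\<bar> / 2))\<^sup>2" by (intro power_mono) auto
  moreover have "cos \<bar>s\<bar> = 1 - 2 * (sin (\<bar>s\<bar> / 2))\<^sup>2"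
    using cos_double_sin[of "\<bar>s\<bar> / 2"] by simp
  ultimately show ?thesis by (simp add: power_divide)
qed

text \<open>An eigenvector of the adjacency matrix of a path with \<open>d\<close> vertices, for the largest eigenvalue
\<open>2 cos (pi / (d + 1))\<close>.  Among the nonnegative trigonometric polynomials of degree less than \<open>d\<close> and given
mass, the kernel built from it has the largest first Fourier coefficient.\<close>

definition fejer_coeff :: "nat \<Rightarrow> nat \<Rightarrow> real" where
  "fejer_coeff d i = sin (real i * (pi / real (d + 1)))"

definition fejer_korovkin :: "nat \<Rightarrow> real \<Rightarrow> real" where
  "fejer_korovkin d s = (\<Sum>i=1..d. \<Sum>k=1..d. fejer_coeff d i * fejer_coeff d k * cos (of_int (int i - int k) * s))"

lemma fejer_korovkin_eq_squares:
  "fejer_korovkin d s = (\<Sum>i=1..d. fejer_coeff d i * cos (real i * s))\<^sup>2 + (\<Sum>i=1..d. fejer_coeff d i * sin (real i * s))\<^sup>2"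
  unfolding fejer_korovkin_def power2_eq_square sum_product sum.distrib[symmetric]
proof (intro sum.cong refl)
  fix i k
  have "of_int (int i - int k) * s = real i * s - real k * s" by (simp add: left_diff_distrib)
  then show "fejer_coeff d i * fejer_coeff d k * cos (of_int (int i - int k) * s)
     = fejer_coeff d i * cos (real i * s) * (fejer_coeff d k * cos (real k * s))
       + fejer_coeff d i * sin (real i * s) * (fejer_coeff d k * sin (real k * s))"
    by (simp only: cos_diff) (simp add: algebra_simps)
qed

lemma fejer_korovkin_nonneg: "0 \<le> fejer_korovkin d s"
  unfolding fejer_korovkin_eq_squares by simp

lemma fejer_korovkin_even: "fejer_korovkin d (- s) = fejer_korovkin d s"
  unfolding fejer_korovkin_eq_squares by (simp add: sum_negf)

lemma continuous_on_fejer_korovkin [continuous_intros]: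
  fixes g :: "'a :: t2_space \<Rightarrow> real"
  shows "continuous_on S g \<Longrightarrow> continuous_on S (\<lambda>x. fejer_korovkin d (g x))"
  unfolding fejer_korovkin_def by (intro continuous_on_sum continuous_on_mult continuous_on_cos continuous_on_const)

definition fejer_mass :: "nat \<Rightarrow> real" where
  "fejer_mass d = 2 * pi * (\<Sum>i=1..d. (fejer_coeff d i)\<^sup>2)"

lemma fejer_mass_pos: "1 \<le> d \<Longrightarrow> 0 < fejer_mass d"
proof -
  assume d: "1 \<le> d"
  have "0 < fejer_coeff d 1"
    unfolding fejer_coeff_def using d by (intro sin_gt_zero) (auto simp: field_simps)
  then have "0 < (\<Sum>i=1..d. (fejer_coeff d i)\<^sup>2)"
    using d by (intro sum_pos2[of _ 1]) auto
  then show ?thesis by (simp add: fejer_mass_def)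
qed

lemma integral_double_sum:
  fixes f :: "nat \<Rightarrow> nat \<Rightarrow> real \<Rightarrow> real"
  assumes "\<And>i k. continuous_on {a..b} (f i k)"
  shows "integral {a..b} (\<lambda>s. \<Sum>i=1..d. \<Sum>k=1..d. f i k s) = (\<Sum>i=1..d. \<Sum>k=1..d. integral {a..b} (f i k))"
proof -
  have "continuous_on {a..b} (\<lambda>s. \<Sum>k=1..d. f i k s)" for i
    by (intro continuous_on_sum assms)
  then have "integral {a..b} (\<lambda>s. \<Sum>i=1..d. \<Sum>k=1..d. f i k s) = (\<Sum>i=1..d. integral {a..b} (\<lambda>s. \<Sum>k=1..d. f i k s))"
    by (intro Henstock_Kurzweil_Integration.integral_sum integrable_continuous_real) auto
  also have "\<dots> = (\<Sum>i=1..d. \<Sum>k=1..d. integral {a..b} (f i k))"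
    by (intro sum.cong refl Henstock_Kurzweil_Integration.integral_sum integrable_continuous_real assms) auto
  finally show ?thesis .
qed

lemma integral_fejer_korovkin: "integral {-pi..pi} (fejer_korovkin d) = fejer_mass d"
proof -
  have "integral {-pi..pi} (fejer_korovkin d) =
     (\<Sum>i=1..d. \<Sum>k=1..d. integral {-pi..pi} (\<lambda>s. fejer_coeff d i * fejer_coeff d k * cos (of_int (int i - int k) * s)))"
    unfolding fejer_korovkin_def[abs_def] by (rule integral_double_sum) (intro continuous_intros)
  also have "\<dots> = (\<Sum>i=1..d. \<Sum>k=1..d. if i = k then 2 * pi * (fejer_coeff d i)\<^sup>2 else 0)"
  proof (intro sum.cong refl)
    fix i k
    show "integral {-pi..pi} (\<lambda>s. fejer_coeff d i * fejer_coeff d k * cos (of_int (int i - int k) * s))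
      = (if i = k then 2 * pi * (fejer_coeff d i)\<^sup>2 else 0)"
      unfolding integral_cmult integral_cos_int by (simp add: power2_eq_square)
  qed
  also have "\<dots> = fejer_mass d"
    by (simp add: fejer_mass_def sum_distrib_left)
  finally show ?thesis .
qed

text \<open>Only the products of neighbouring coefficients survive the integration.  They combine by
\<open>b (i + 1) + b (i - 1) = 2 cos h \<cdot> b i\<close> with \<open>h = pi / (d + 1)\<close>; there are no boundary terms because
\<open>b 0 = b (d + 1) = 0\<close>.\<close>

lemma integral_fejer_korovkin_cos:
  "integral {-pi..pi} (\<lambda>s. fejer_korovkin d s * cos s) = cos (pi / real (d + 1)) * fejer_mass d"
proof -
  let ?b = "fejer_coeff d"
  have b0: "?b 0 = 0" "?b (d + 1) = 0" by (simp_all add: fejer_coeff_def)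
  have *: "?b i * ?b k * cos (of_int (int i - int k) * s) * cos s
      = ?b i * ?b k / 2 * (cos (of_int (int i - int k + 1) * s) + cos (of_int (int i - int k - 1) * s))" for i k s
  proof -
    have "of_int (int i - int k + 1) * s = of_int (int i - int k) * s + s"
         "of_int (int i - int k - 1) * s = of_int (int i - int k) * s - s"
      by (simp_all add: algebra_simps)
    then show ?thesis by (simp only: cos_add cos_diff) (simp add: field_simps)
  qed
  have "integral {-pi..pi} (\<lambda>s. fejer_korovkin d s * cos s) =
     (\<Sum>i=1..d. \<Sum>k=1..d. integral {-pi..pi} (\<lambda>s. ?b i * ?b k / 2 * (cos (of_int (int i - int k + 1) * s) + cos (of_int (int i - int k - 1) * s))))"
    unfolding fejer_korovkin_def sum_distrib_right * by (rule integral_double_sum) (intro continuous_intros)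
  also have "\<dots> = (\<Sum>i=1..d. \<Sum>k=1..d. pi * ((if k = i + 1 then ?b i * ?b k else 0) + (if k = i - 1 then ?b i * ?b k else 0)))"
  proof (intro sum.cong refl)
    fix i k assume ik: "i \<in> {1..d}" "k \<in> {1..d}"
    have "integral {-pi..pi} (\<lambda>s. ?b i * ?b k / 2 * (cos (of_int (int i - int k + 1) * s) + cos (of_int (int i - int k - 1) * s)))
      = ?b i * ?b k / 2 * (integral {-pi..pi} (\<lambda>s. cos (of_int (int i - int k + 1) * s))
           + integral {-pi..pi} (\<lambda>s. cos (of_int (int i - int k - 1) * s)))"
      unfolding integral_cmult
      by (subst Henstock_Kurzweil_Integration.integral_add) (auto intro!: integrable_continuous_real continuous_intros)
    also have "\<dots> = pi * ((if k = i + 1 then ?b i * ?b k else 0) + (if k = i - 1 then ?b i * ?b k else 0))"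
    proof -
      have "int i - int k + 1 = 0 \<longleftrightarrow> k = i + 1" "int i - int k - 1 = 0 \<longleftrightarrow> k = i - 1"
        using ik by auto
      then show ?thesis unfolding integral_cos_int by auto
    qed
    finally show "integral {-pi..pi} (\<lambda>s. ?b i * ?b k / 2 * (cos (of_int (int i - int k + 1) * s) + cos (of_int (int i - int k - 1) * s)))
      = pi * ((if k = i + 1 then ?b i * ?b k else 0) + (if k = i - 1 then ?b i * ?b k else 0))" .
  qed
  also have "\<dots> = (\<Sum>i=1..d. pi * (?b i * (?b (i + 1) + ?b (i - 1))))"
  proof (rule sum.cong[OF refl])
    fix i assume i: "i \<in> {1..d}"
    have "(\<Sum>k=1..d. if k = i + 1 then ?b i * ?b k else 0) = ?b i * ?b (i + 1)"
    proof (cases "i = d")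
      case True
      then show ?thesis using b0 by (auto intro!: sum.neutral)
    next
      case False
      then show ?thesis using i by (subst sum.delta) auto
    qed
    moreover have "(\<Sum>k=1..d. if k = i - 1 then ?b i * ?b k else 0) = ?b i * ?b (i - 1)"
    proof (cases "i = 1")
      case True
      then show ?thesis using b0 by (auto intro!: sum.neutral)
    next
      case False
      then show ?thesis using i by (subst sum.delta) auto
    qed
    ultimately show "(\<Sum>k=1..d. pi * ((if k = i + 1 then ?b i * ?b k else 0) + (if k = i - 1 then ?b i * ?b k else 0)))
        = pi * (?b i * (?b (i + 1) + ?b (i - 1)))"
      unfolding sum_distrib_left[symmetric] sum.distrib by (simp add: distrib_left)
  qed
  also have "\<dots> = (\<Sum>i=1..d. cos (pi / real (d + 1)) * (2 * pi * (?b i)\<^sup>2))"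
  proof (rule sum.cong[OF refl])
    fix i assume i: "i \<in> {1..d}"
    let ?h = "pi / real (d + 1)"
    have "?b (i + 1) = sin (real i * ?h + ?h)" "?b (i - 1) = sin (real i * ?h - ?h)"
      using i unfolding fejer_coeff_def by (simp_all add: of_nat_diff algebra_simps add_divide_distrib diff_divide_distrib)
    then have "?b (i + 1) + ?b (i - 1) = 2 * cos ?h * ?b i"
      unfolding fejer_coeff_def by (simp add: sin_add sin_diff)
    then show "pi * (?b i * (?b (i + 1) + ?b (i - 1))) = cos ?h * (2 * pi * (?b i)\<^sup>2)"
      by (simp add: power2_eq_square)
  qed
  also have "\<dots> = cos (pi / real (d + 1)) * fejer_mass d"
    by (simp add: fejer_mass_def sum_distrib_left)
  finally show ?thesis .
qed

text \<open>On \<open>{-pi..pi}\<close> the function \<open>s\<^sup>2\<close> is at most \<open>8 (1 - cos s)\<close>, and the mean of \<open>1 - cos s\<close> with respect to the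
kernel is \<open>1 - cos (pi / (d + 1))\<close>.\<close>

lemma fejer_korovkin_second_moment:
  assumes d: "1 \<le> d"
  shows "integral {-pi..pi} (\<lambda>s. fejer_korovkin d s * s\<^sup>2) \<le> 4 * pi\<^sup>2 / (real d)\<^sup>2 * fejer_mass d"
proof -
  let ?h = "pi / real (d + 1)"
  have "integral {-pi..pi} (\<lambda>s. fejer_korovkin d s * s\<^sup>2) \<le> integral {-pi..pi} (\<lambda>s. 8 * (fejer_korovkin d s - fejer_korovkin d s * cos s))"
  proof (intro integral_le integrable_continuous_real continuous_intros)
    fix s assume "s \<in> {-pi..pi}"
    then have "s\<^sup>2 \<le> 8 * (1 - cos s)" using one_minus_cos_ge[of s] by (simp add: abs_le_iff)
    from mult_left_mono[OF this fejer_korovkin_nonneg[of d s]]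
    show "fejer_korovkin d s * s\<^sup>2 \<le> 8 * (fejer_korovkin d s - fejer_korovkin d s * cos s)"
      by (simp add: algebra_simps)
  qed
  also have "\<dots> = 8 * (fejer_mass d - cos ?h * fejer_mass d)"
    unfolding integral_cmult
    by (subst Henstock_Kurzweil_Integration.integral_diff)
       (auto intro!: integrable_continuous_real continuous_intros simp: integral_fejer_korovkin integral_fejer_korovkin_cos)
  also have "\<dots> = 8 * (1 - cos ?h) * fejer_mass d" by (simp add: algebra_simps)
  also have "\<dots> \<le> 8 * (?h\<^sup>2 / 2) * fejer_mass d"
  proof -
    have "1 - cos x \<le> x\<^sup>2 / 2" for x :: real
    proof -
      have "cos x = 1 - 2 * (sin (x / 2))\<^sup>2" using cos_double_sin[of "x / 2"] by simp
      moreover have "(sin (x / 2))\<^sup>2 \<le> (x / 2)\<^sup>2"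
        using abs_sin_x_le_abs_x[of "x / 2"] by (simp only: abs_le_square_iff)
      ultimately show ?thesis by (simp add: power_divide)
    qed
    from this[of ?h] have "1 - cos ?h \<le> ?h\<^sup>2 / 2" .
    then show ?thesis using fejer_mass_pos[OF d] by (intro mult_right_mono mult_left_mono) auto
  qed
  also have "\<dots> \<le> 4 * pi\<^sup>2 / (real d)\<^sup>2 * fejer_mass d"
  proof -
    have "?h \<le> pi / real d" using d by (intro divide_left_mono) auto
    then have "?h\<^sup>2 \<le> (pi / real d)\<^sup>2" by (intro power_mono) auto
    then show ?thesis using fejer_mass_pos[OF d] by (intro mult_right_mono) (auto simp: power_divide)
  qed
  finally show ?thesis .
qed

text \<open>Chebyshev polynomials.\<close>

lemma cos_multiple_poly: "\<exists>q :: real poly. degree q \<le> n \<and> (\<forall>x. cos (real n * x) = poly q (cos x))"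
proof (induction n rule: less_induct)
  case (less n)
  consider "n = 0" | "n = 1" | m where "n = m + 2"
    by (metis One_nat_def add_2_eq_Suc' not0_implies_Suc)
  then show ?case
  proof cases
    case 1
    then show ?thesis by (intro exI[of _ 1]) simp
  next
    case 2
    then show ?thesis by (intro exI[of _ "[:0, 1:]"]) simp
  next
    case (3 m)
    obtain q1 where q1: "degree q1 \<le> m + 1" "\<And>x. cos (real (m + 1) * x) = poly q1 (cos x)"
      using less[of "m + 1"] 3 by auto
    obtain q0 where q0: "degree q0 \<le> m" "\<And>x. cos (real m * x) = poly q0 (cos x)"
      using less[of m] 3 by auto
    let ?q = "[:0, 2:] * q1 - q0"
    have "degree ?q \<le> n"
    proof (rule degree_diff_le)
      show "degree ([:0, 2:] * q1) \<le> n"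
        using degree_mult_le[of "[:0, 2:]" q1] q1(1) 3 by simp
    qed (use q0 3 in simp)
    moreover have "cos (real n * x) = poly ?q (cos x)" for x
    proof -
      have "real n * x = real (m + 1) * x + x" "real m * x = real (m + 1) * x - x"
        using 3 by (simp_all add: algebra_simps)
      then have "cos (real n * x) + cos (real m * x) = 2 * cos x * cos (real (m + 1) * x)"
        by (simp only: cos_add cos_diff) simp
      then show ?thesis using q1 q0 by simp
    qed
    ultimately show ?thesis by blast
  qed
qed

text \<open>By periodicity the kernel may be translated instead of \<open>g\<close>, and its translates are trigonometric
polynomials in \<open>x\<close>.  Their sine terms are multiplied by integrals of odd functions, so that only a
polynomial in \<open>cos x\<close> remains.\<close>

lemma fejer_korovkin_convolution_poly:
  fixes g :: "real \<Rightarrow> real"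
  assumes cont: "continuous_on UNIV g" and per: "\<And>x. g (x + 2 * pi) = g x" and even: "\<And>x. g (- x) = g x"
    and d: "1 \<le> d"
  shows "\<exists>q. degree q < d \<and> (\<forall>x. integral {-pi..pi} (\<lambda>s. fejer_korovkin d s * g (x + s)) = poly q (cos x))"
proof -
  have c: "continuous_on S g" for S using continuous_on_subset[OF cont] by simp
  obtain T :: "nat \<Rightarrow> real poly" where T: "\<And>n. degree (T n) \<le> n" "\<And>n x. cos (real n * x) = poly (T n) (cos x)"
    using cos_multiple_poly by metis
  have cT: "cos (of_int z * x) = poly (T (nat \<bar>z\<bar>)) (cos x)" for z x
    using T(2)[of "nat \<bar>z\<bar>" x] by (cases "0 \<le> z") auto
  let ?b = "fejer_coeff d"
  define I where "I i k = integral {-pi..pi} (\<lambda>s. cos (of_int (int i - int k) * s) * g s)" for i k :: nat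
  define q where "q = (\<Sum>i=1..d. \<Sum>k=1..d. smult (?b i * ?b k * I i k) (T (nat \<bar>int i - int k\<bar>)))"
  have "degree q \<le> d - 1"
    unfolding q_def
  proof (intro degree_sum_le finite_atLeastAtMost order_trans[OF degree_smult_le] order_trans[OF T(1)])
    fix i k assume "i \<in> {1..d}" "k \<in> {1..d}"
    then show "nat \<bar>int i - int k\<bar> \<le> d - 1" by auto
  qed
  moreover have "integral {-pi..pi} (\<lambda>s. fejer_korovkin d s * g (x + s)) = poly q (cos x)" for x
  proof -
    have perJ: "fejer_korovkin d (s + 2 * pi) = fejer_korovkin d s" for s
    proof -
      have "cos (of_int z * (s + 2 * pi)) = cos (of_int z * s)" for z
        using cos_int_2pin[of z] sin_int_2pin[of z]
        by (simp add: distrib_left cos_add mult_ac)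
      then show ?thesis unfolding fejer_korovkin_def by (simp only:)
    qed
    have "integral {-pi..pi} (\<lambda>s. fejer_korovkin d s * g (x + s))
        = integral {-pi..pi} (\<lambda>s. (\<lambda>s. fejer_korovkin d (s - x) * g s) (s + x))"
      by (simp add: add.commute)
    also have "\<dots> = integral {-pi..pi} (\<lambda>s. fejer_korovkin d (s - x) * g s)"
    proof (rule integral_periodic_shift)
      show "fejer_korovkin d (s + 2 * pi - x) * g (s + 2 * pi) = fejer_korovkin d (s - x) * g s" for s
        using perJ[of "s - x"] per[of s] by (simp add: algebra_simps)
    qed (intro continuous_intros c)
    also have "\<dots> = integral {-pi..pi} (\<lambda>s. \<Sum>i=1..d. \<Sum>k=1..d. ?b i * ?b k * (cos (of_int (int i - int k) * (s - x)) * g s))"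
      by (simp add: fejer_korovkin_def sum_distrib_right mult.assoc)
    also have "\<dots> = (\<Sum>i=1..d. \<Sum>k=1..d. integral {-pi..pi} (\<lambda>s. ?b i * ?b k * (cos (of_int (int i - int k) * (s - x)) * g s)))"
      by (rule integral_double_sum) (intro continuous_intros c)
    also have "\<dots> = (\<Sum>i=1..d. \<Sum>k=1..d. ?b i * ?b k * I i k * poly (T (nat \<bar>int i - int k\<bar>)) (cos x))"
    proof (intro sum.cong refl)
      fix i k
      let ?z = "of_int (int i - int k) :: real"
      have "integral {-pi..pi} (\<lambda>s. cos (?z * (s - x)) * g s)
          = integral {-pi..pi} (\<lambda>s. cos (?z * x) * (cos (?z * s) * g s) + sin (?z * x) * (sin (?z * s) * g s))"
        by (simp only: right_diff_distrib cos_diff) (simp add: algebra_simps)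
      also have "\<dots> = cos (?z * x) * I i k + sin (?z * x) * integral {-pi..pi} (\<lambda>s. sin (?z * s) * g s)"
        unfolding I_def integral_cmult[symmetric]
        by (intro Henstock_Kurzweil_Integration.integral_add integrable_continuous_real continuous_intros c)
      also have "integral {-pi..pi} (\<lambda>s. sin (?z * s) * g s) = 0"
        by (rule integral_odd_eq_0) (simp add: even)
      finally show "integral {-pi..pi} (\<lambda>s. ?b i * ?b k * (cos (?z * (s - x)) * g s))
          = ?b i * ?b k * I i k * poly (T (nat \<bar>int i - int k\<bar>)) (cos x)"
        unfolding integral_cmult cT by simp
    qed
    also have "\<dots> = poly q (cos x)"
      by (simp add: q_def poly_sum)
    finally show ?thesis .
  qed
  ultimately show ?thesis using d by (intro exI[of _ q]) auto
qed

text \<open>Jackson's theorem in the mean.  The convolution of \<open>g\<close> with the normalized kernel differs from \<open>g\<close> by the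
mean of the first order Taylor remainder, the linear term having mean zero because the kernel is even.  The
remainder for the step \<open>s\<close> has \<open>L\<^sup>1\<close> norm at most \<open>s\<^sup>2\<close> times that of \<open>g''\<close>, and the second moment of the kernel
is of order \<open>d\<^sup>-\<^sup>2\<close>.\<close>

lemma jackson_L1:
  fixes g g' g'' :: "real \<Rightarrow> real"
  assumes g: "\<And>x. (g has_real_derivative g' x) (at x)" and g': "\<And>x. (g' has_real_derivative g'' x) (at x)"
    and cont: "continuous_on UNIV g''" and per: "\<And>x. g (x + 2 * pi) = g x" "\<And>x. g'' (x + 2 * pi) = g'' x"
    and even: "\<And>x. g (- x) = g x" and d: "1 \<le> d"
  shows "\<exists>q. degree q < d \<and> integral {-pi..pi} (\<lambda>x. \<bar>g x - poly q (cos x)\<bar>)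
     \<le> 4 * pi\<^sup>2 / (real d)\<^sup>2 * integral {-pi..pi} (\<lambda>x. \<bar>g'' x\<bar>)"
proof -
  let ?J = "fejer_korovkin d"
  define A where "A = fejer_mass d"
  have A: "0 < A" unfolding A_def by (rule fejer_mass_pos[OF d])
  have cg: "continuous_on UNIV g" "continuous_on UNIV g'"
    using g g' by (auto intro!: DERIV_continuous_on simp: has_field_derivative_at_within)
  have [continuous_intros]: "continuous_on S h \<Longrightarrow> continuous_on S (\<lambda>x. g (h x))"
    "continuous_on S h \<Longrightarrow> continuous_on S (\<lambda>x. g' (h x))"
    "continuous_on S h \<Longrightarrow> continuous_on S (\<lambda>x. g'' (h x))" for S and h :: "'a :: topological_space \<Rightarrow> real"
    using continuous_on_compose2[OF cg(1)] continuous_on_compose2[OF cg(2)] continuous_on_compose2[OF cont] by auto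
  define V where "V = integral {-pi..pi} (\<lambda>x. \<bar>g'' x\<bar>)"
  obtain q0 where q0: "degree q0 < d" "\<And>x. integral {-pi..pi} (\<lambda>s. ?J s * g (x + s)) = poly q0 (cos x)"
    using fejer_korovkin_convolution_poly[OF cg(1) per(1) even d] by blast
  define q where "q = smult (1 / A) q0"
  \<comment> \<open>the Taylor remainder, written below with an integral over the fixed interval \<open>{0..1}\<close>\<close>
  define R where "R s x = g (x + s) - g x - s * g' x" for s x
  have taylor: "R s x = integral {0..1} (\<lambda>\<tau>. (1 - \<tau>) * s\<^sup>2 * g'' (x + s * \<tau>))" for s x
  proof -
    have "((\<lambda>\<tau>. (1 - \<tau>) * s\<^sup>2 * g'' (x + s * \<tau>)) has_integral
       ((1 - 1) * s * g' (x + s * 1) + g (x + s * 1)) - ((1 - 0) * s * g' (x + s * 0) + g (x + s * 0))) {0..1}"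
    proof (rule fundamental_theorem_of_calculus)
      fix \<tau> :: real
      have "((\<lambda>\<tau>. (1 - \<tau>) * s * g' (x + s * \<tau>) + g (x + s * \<tau>)) has_real_derivative
          (1 - \<tau>) * s * (g'' (x + s * \<tau>) * s) + (- s) * g' (x + s * \<tau>) + g' (x + s * \<tau>) * s) (at \<tau> within {0..1})"
        by (rule has_field_derivative_at_within)
           (auto intro!: derivative_eq_intros DERIV_chain2[where f = g] DERIV_chain2[where f = g'] g g')
      then show "((\<lambda>\<tau>. (1 - \<tau>) * s * g' (x + s * \<tau>) + g (x + s * \<tau>)) has_vector_derivative
          (1 - \<tau>) * s\<^sup>2 * g'' (x + s * \<tau>)) (at \<tau> within {0..1})"
        by (simp add: has_real_derivative_iff_has_vector_derivative power2_eq_square algebra_simps)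
    qed simp
    then show ?thesis by (simp add: integral_unique R_def)
  qed
  have R: "integral {-pi..pi} (\<lambda>x. \<bar>R s x\<bar>) \<le> s\<^sup>2 * V" for s
  proof -
    have "integral {-pi..pi} (\<lambda>x. \<bar>integral {0..1} (\<lambda>\<tau>. (1 - \<tau>) * s\<^sup>2 * g'' (x + s * \<tau>))\<bar>) \<le> integral {0..1} (\<lambda>_::real. s\<^sup>2 * V)"
    proof (rule integral_abs_integral_le[where \<psi> = "\<lambda>x \<tau>. (1 - \<tau>) * s\<^sup>2 * g'' (x + s * \<tau>)"])
      show "continuous_on UNIV (\<lambda>(x, \<tau>). (1 - \<tau>) * s\<^sup>2 * g'' (x + s * \<tau>))"
        unfolding case_prod_unfold by (intro continuous_intros)
      fix \<tau> :: real assume \<tau>: "\<tau> \<in> {0..1}"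
      have "integral {-pi..pi} (\<lambda>x. \<bar>(1 - \<tau>) * s\<^sup>2 * g'' (x + s * \<tau>)\<bar>)
          = (1 - \<tau>) * s\<^sup>2 * integral {-pi..pi} (\<lambda>x. \<bar>g'' (x + s * \<tau>)\<bar>)"
        using \<tau> unfolding integral_cmult[symmetric]
        by (simp add: abs_mult)
      also have "integral {-pi..pi} (\<lambda>x. \<bar>g'' (x + s * \<tau>)\<bar>) = V"
        unfolding V_def
        by (rule integral_periodic_shift[of "\<lambda>x. \<bar>g'' x\<bar>"]) (auto intro!: continuous_intros cont simp: per)
      also have "(1 - \<tau>) * s\<^sup>2 * V \<le> 1 * s\<^sup>2 * V"
        using \<tau> unfolding V_def
        by (intro mult_right_mono Henstock_Kurzweil_Integration.integral_nonneg integrable_continuous_real continuous_intros) auto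
      finally show "integral {-pi..pi} (\<lambda>x. \<bar>(1 - \<tau>) * s\<^sup>2 * g'' (x + s * \<tau>)\<bar>) \<le> s\<^sup>2 * V"
        by simp
    qed (intro integrable_continuous_real continuous_intros)
    then show ?thesis by (simp add: taylor)
  qed
  have err: "g x - poly q (cos x) = - integral {-pi..pi} (\<lambda>s. 1 / A * (?J s * R s x))" for x
  proof -
    have "integral {-pi..pi} (\<lambda>s. ?J s * R s x)
        = integral {-pi..pi} (\<lambda>s. ?J s * g (x + s) - ?J s * g x - g' x * (?J s * s))"
      by (simp add: R_def algebra_simps)
    also have "\<dots> = integral {-pi..pi} (\<lambda>s. ?J s * g (x + s)) - integral {-pi..pi} (\<lambda>s. ?J s * g x)
        - integral {-pi..pi} (\<lambda>s. g' x * (?J s * s))"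
      by (subst Henstock_Kurzweil_Integration.integral_diff, (intro integrable_continuous_real continuous_intros)+)+ simp
    also have "integral {-pi..pi} (\<lambda>s. ?J s * g x) = A * g x"
      by (simp add: A_def integral_fejer_korovkin)
    also have "integral {-pi..pi} (\<lambda>s. g' x * (?J s * s)) = 0"
      by (rule integral_odd_eq_0) (simp add: fejer_korovkin_even)
    finally have "integral {-pi..pi} (\<lambda>s. ?J s * R s x) = A * poly q (cos x) - A * g x"
      using A q0(2) by (simp add: q_def)
    then show ?thesis
      using A unfolding integral_cmult by (simp add: field_simps)
  qed
  have "integral {-pi..pi} (\<lambda>x. \<bar>integral {-pi..pi} (\<lambda>s. 1 / A * (?J s * R s x))\<bar>)
      \<le> integral {-pi..pi} (\<lambda>s. V / A * (?J s * s\<^sup>2))"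
  proof (rule integral_abs_integral_le[where \<psi> = "\<lambda>x s. 1 / A * (?J s * R s x)"])
    show "continuous_on UNIV (\<lambda>(x, s). 1 / A * (?J s * R s x))"
      unfolding case_prod_unfold R_def using A by (intro continuous_intros) auto
    show "(\<lambda>s. V / A * (?J s * s\<^sup>2)) integrable_on {-pi..pi}"
      using A by (intro integrable_continuous_real continuous_intros) auto
    fix s
    have "integral {-pi..pi} (\<lambda>x. \<bar>1 / A * (?J s * R s x)\<bar>) = 1 / A * ?J s * integral {-pi..pi} (\<lambda>x. \<bar>R s x\<bar>)"
      using A fejer_korovkin_nonneg[of d s] unfolding integral_cmult[symmetric]
      by (simp add: abs_mult)
    also have "\<dots> \<le> 1 / A * ?J s * (s\<^sup>2 * V)"
      using A fejer_korovkin_nonneg[of d s] by (intro mult_left_mono R) auto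
    finally show "integral {-pi..pi} (\<lambda>x. \<bar>1 / A * (?J s * R s x)\<bar>) \<le> V / A * (?J s * s\<^sup>2)"
      by (simp add: mult_ac)
  qed
  also have "\<dots> = V / A * integral {-pi..pi} (\<lambda>s. ?J s * s\<^sup>2)"
    by (rule integral_cmult)
  also have "\<dots> \<le> V / A * (4 * pi\<^sup>2 / (real d)\<^sup>2 * A)"
  proof (rule mult_left_mono)
    show "0 \<le> V / A"
      using A unfolding V_def
      by (intro divide_nonneg_nonneg Henstock_Kurzweil_Integration.integral_nonneg integrable_continuous_real continuous_intros) auto
  qed (unfold A_def, rule fejer_korovkin_second_moment[OF d])
  also have "\<dots> = 4 * pi\<^sup>2 / (real d)\<^sup>2 * V" using A by simp
  finally have "integral {-pi..pi} (\<lambda>x. \<bar>g x - poly q (cos x)\<bar>) \<le> 4 * pi\<^sup>2 / (real d)\<^sup>2 * V"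
    unfolding err by simp
  moreover have "degree q < d" using q0 unfolding q_def by (simp add: le_less_trans[OF degree_smult_le])
  ultimately show ?thesis unfolding V_def by blast
qed

text \<open>Comparison with a Cauchy density, by \<open>1 - cos x \<ge> x\<^sup>2 / 8\<close>.\<close>

lemma integral_heat_profile_le:
  assumes t: "0 \<le> t"
  shows "integral {-pi..pi} (\<lambda>x. t / (1 + t * (1 - cos x))) \<le> 3 * pi * sqrt t"
proof -
  define c where "c = sqrt (t / 8)"
  have c: "0 \<le> c" "t = 8 * c\<^sup>2" using t by (simp_all add: c_def)
  have pos: "0 < 1 + (c * x)\<^sup>2" for x :: real by (simp add: add_pos_nonneg)
  have I: "((\<lambda>x. t / (1 + (c * x)\<^sup>2)) has_integral (8 * c * arctan (c * pi) - 8 * c * arctan (c * (- pi)))) {-pi..pi}"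
  proof (rule fundamental_theorem_of_calculus)
    fix x
    have "((\<lambda>x. 8 * c * arctan (c * x)) has_real_derivative 8 * c * (inverse (1 + (c * x)\<^sup>2) * c)) (at x within {-pi..pi})"
      by (auto intro!: derivative_eq_intros)
    then show "((\<lambda>x. 8 * c * arctan (c * x)) has_vector_derivative t / (1 + (c * x)\<^sup>2)) (at x within {-pi..pi})"
      by (simp add: has_real_derivative_iff_has_vector_derivative c(2) power2_eq_square field_simps)
  qed simp
  have "integral {-pi..pi} (\<lambda>x. t / (1 + t * (1 - cos x))) \<le> integral {-pi..pi} (\<lambda>x. t / (1 + (c * x)\<^sup>2))"
  proof (rule integral_le)
    show "(\<lambda>x. t / (1 + t * (1 - cos x))) integrable_on {-pi..pi}"
    proof (intro integrable_continuous_real continuous_intros ballI)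
      fix x :: real
      have "0 \<le> t * (1 - cos x)" using t by simp
      then show "1 + t * (1 - cos x) \<noteq> 0" by linarith
    qed
    show "(\<lambda>x. t / (1 + (c * x)\<^sup>2)) integrable_on {-pi..pi}" using I by blast
    fix x assume "x \<in> {-pi..pi}"
    then have "x\<^sup>2 / 8 \<le> 1 - cos x" by (intro one_minus_cos_ge) (auto simp: abs_le_iff)
    from mult_left_mono[OF this t] have "(c * x)\<^sup>2 \<le> t * (1 - cos x)"
      by (simp add: c(2) power_mult_distrib)
    then show "t / (1 + t * (1 - cos x)) \<le> t / (1 + (c * x)\<^sup>2)"
      using t pos[of x] by (intro divide_left_mono mult_pos_pos) auto
  qed
  also have "\<dots> = 16 * c * arctan (c * pi)"
    using I by (simp add: integral_unique arctan_minus)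
  also have "\<dots> \<le> 16 * c * (pi / 2)"
    using c arctan_ubound[of "c * pi"] by (intro mult_left_mono) auto
  also have "16 * c * (pi / 2) = 8 * c * pi" by simp
  also have "8 * c \<le> 3 * sqrt t"
  proof (rule power2_le_imp_le)
    show "(8 * c)\<^sup>2 \<le> (3 * sqrt t)\<^sup>2" using t c by (simp add: power_mult_distrib)
  qed (use t in simp)
  then have "8 * c * pi \<le> 3 * sqrt t * pi" by (intro mult_right_mono) auto
  finally show ?thesis by (simp add: mult_ac)
qed

lemma exp_minus_le_inverse:
  fixes z :: real
  assumes z: "0 \<le> z"
  shows "exp (- z) \<le> 1 / (1 + z)" and "(1 + 2 * z) * exp (- z) \<le> 4 / (1 + z)"
proof -
  have 1: "1 + z \<le> exp z" by (rule exp_ge_add_one_self_aux[OF z])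
  have 2: "1 + z + z\<^sup>2 / 2 \<le> exp z" by (rule exp_lower_Taylor_quadratic[OF z])
  have e: "exp (- z) = 1 / exp z" by (simp add: exp_minus divide_inverse)
  show "exp (- z) \<le> 1 / (1 + z)"
    unfolding e using 1 z by (intro divide_left_mono) auto
  have "(1 + 2 * z) * (1 + z) \<le> 4 * (1 + z + z\<^sup>2 / 2)"
    using z by (simp add: algebra_simps power2_eq_square)
  also have "\<dots> \<le> 4 * exp z" using 2 by simp
  finally show "(1 + 2 * z) * exp (- z) \<le> 4 / (1 + z)"
    unfolding e using z by (simp add: field_simps)
qed

lemma heat_L1_le:
  assumes t: "0 < t"
  shows "integral {-pi..pi} (\<lambda>x. exp (- (1 - cos x) * t)) \<le> 3 * pi / sqrt t"
proof -
  have pos: "0 < 1 + t * (1 - cos x)" for x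
    using t by (intro add_pos_nonneg mult_nonneg_nonneg) auto
  have "integral {-pi..pi} (\<lambda>x. exp (- (1 - cos x) * t)) \<le> integral {-pi..pi} (\<lambda>x. 1 / t * (t / (1 + t * (1 - cos x))))"
  proof (intro integral_le integrable_continuous_real continuous_intros ballI)
    fix x :: real
    show "1 + t * (1 - cos x) \<noteq> 0" using pos[of x] by simp
    show "exp (- (1 - cos x) * t) \<le> 1 / t * (t / (1 + t * (1 - cos x)))"
      using exp_minus_le_inverse(1)[of "t * (1 - cos x)"] t
      by (simp add: mult.commute[of _ t] right_diff_distrib)
  qed
  also have "\<dots> = 1 / t * integral {-pi..pi} (\<lambda>x. t / (1 + t * (1 - cos x)))"
    by (rule integral_cmult)
  also have "\<dots> \<le> 1 / t * (3 * pi * sqrt t)"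
    using t by (intro mult_left_mono integral_heat_profile_le) auto
  also have "\<dots> = 3 * pi / sqrt t"
    using t real_sqrt_mult_self[of t] by (simp add: field_simps)
  finally show ?thesis .
qed

text \<open>The second derivative of \<open>exp (- (1 - cos x) * t)\<close> is at most \<open>t (1 + 2 z) exp (- z)\<close> with
\<open>z = t (1 - cos x)\<close>, since \<open>(sin x)\<^sup>2 \<le> 2 (1 - cos x)\<close>; its integral is of order \<open>sqrt t\<close>.\<close>

lemma heat_poly_approx:
  assumes t: "0 \<le> t" and d: "1 \<le> d"
  shows "\<exists>q. degree q < d \<and> integral {-pi..pi} (\<lambda>x. \<bar>exp (- (1 - cos x) * t) - poly q (cos x)\<bar>)
     \<le> 48 * pi ^ 3 * (sqrt t / (real d)\<^sup>2)"
proof -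
  define g where "g x = exp (- (1 - cos x) * t)" for x
  define g' where "g' x = - (t * sin x) * g x" for x
  define g'' where "g'' x = (t\<^sup>2 * (sin x)\<^sup>2 - t * cos x) * g x" for x
  have D: "(g has_real_derivative g' x) (at x)" for x
    unfolding g_def g'_def by (auto intro!: derivative_eq_intros)
  have D': "(g' has_real_derivative g'' x) (at x)" for x
    unfolding g'_def g''_def by (auto intro!: derivative_eq_intros D simp: g'_def power2_eq_square algebra_simps)
  have cont: "continuous_on UNIV g''"
    unfolding g''_def g_def by (intro continuous_intros)
  have V: "integral {-pi..pi} (\<lambda>x. \<bar>g'' x\<bar>) \<le> 12 * pi * sqrt t"
  proof -
    have pos: "0 < 1 + t * (1 - cos x)" for x
      using t by (intro add_pos_nonneg mult_nonneg_nonneg) auto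
    have "integral {-pi..pi} (\<lambda>x. \<bar>g'' x\<bar>) \<le> integral {-pi..pi} (\<lambda>x. 4 * (t / (1 + t * (1 - cos x))))"
    proof (intro integral_le integrable_continuous_real continuous_intros ballI)
      show "continuous_on {-pi..pi} g''" using cont by (rule continuous_on_subset) simp
      fix x :: real
      define z where "z = t * (1 - cos x)"
      have z: "0 \<le> z" using t by (simp add: z_def)
      show "1 + t * (1 - cos x) \<noteq> 0" using pos[of x] by simp
      have "(sin x)\<^sup>2 = (1 - cos x) * (1 + cos x)"
        by (simp add: sin_squared_eq power2_eq_square algebra_simps)
      also have "\<dots> \<le> (1 - cos x) * 2" by (intro mult_left_mono) auto
      finally have "t\<^sup>2 * (sin x)\<^sup>2 \<le> t\<^sup>2 * ((1 - cos x) * 2)" by (intro mult_left_mono) auto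
      then have 1: "t\<^sup>2 * (sin x)\<^sup>2 \<le> t * (2 * z)" by (simp add: z_def power2_eq_square mult_ac)
      have 2: "\<bar>t * cos x\<bar> \<le> t" using t by (simp add: abs_mult mult_left_le)
      have "\<bar>t\<^sup>2 * (sin x)\<^sup>2 - t * cos x\<bar> \<le> t\<^sup>2 * (sin x)\<^sup>2 + \<bar>t * cos x\<bar>"
        by (rule order_trans[OF abs_triangle_ineq4]) simp
      also have "\<dots> \<le> t * (1 + 2 * z)" using 1 2 by (simp add: algebra_simps)
      finally have "\<bar>g'' x\<bar> \<le> t * (1 + 2 * z) * g x"
        unfolding g''_def abs_mult by (intro mult_mono) (auto simp: g_def z t)
      also have "g x = exp (- z)"
        unfolding g_def z_def by (simp add: algebra_simps)
      also have "t * (1 + 2 * z) * exp (- z) = t * ((1 + 2 * z) * exp (- z))" by (rule mult.assoc)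
      also have "\<dots> \<le> t * (4 / (1 + z))"
        by (intro mult_left_mono exp_minus_le_inverse z t)
      finally show "\<bar>g'' x\<bar> \<le> 4 * (t / (1 + t * (1 - cos x)))" by (simp add: z_def mult.commute)
    qed
    also have "\<dots> = 4 * integral {-pi..pi} (\<lambda>x. t / (1 + t * (1 - cos x)))"
      by (rule integral_cmult)
    also have "\<dots> \<le> 4 * (3 * pi * sqrt t)"
      using t by (intro mult_left_mono integral_heat_profile_le) auto
    finally show ?thesis by simp
  qed
  have "\<exists>q. degree q < d \<and> integral {-pi..pi} (\<lambda>x. \<bar>g x - poly q (cos x)\<bar>)
     \<le> 4 * pi\<^sup>2 / (real d)\<^sup>2 * integral {-pi..pi} (\<lambda>x. \<bar>g'' x\<bar>)"
    using d by (intro jackson_L1[OF D D' cont]) (auto simp: g_def g''_def)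
  then obtain q where q: "degree q < d" "integral {-pi..pi} (\<lambda>x. \<bar>g x - poly q (cos x)\<bar>)
     \<le> 4 * pi\<^sup>2 / (real d)\<^sup>2 * integral {-pi..pi} (\<lambda>x. \<bar>g'' x\<bar>)"
    by blast
  note q(2)
  also have "4 * pi\<^sup>2 / (real d)\<^sup>2 * integral {-pi..pi} (\<lambda>x. \<bar>g'' x\<bar>) \<le> 4 * pi\<^sup>2 / (real d)\<^sup>2 * (12 * pi * sqrt t)"
    by (intro mult_left_mono V) auto
  also have "\<dots> = 48 * pi ^ 3 * (sqrt t / (real d)\<^sup>2)"
    by (simp add: power3_eq_cube power2_eq_square)
  finally show ?thesis using q(1) unfolding g_def by blast
qed

section \<open>A uniform bound for solutions of the Jacobi equation\<close>

lemma nondecreasing_of_deriv_nonneg: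
  fixes f :: "real \<Rightarrow> real"
  assumes "a \<le> b" "continuous_on {a..b} f"
    and der: "\<And>x. a < x \<Longrightarrow> x < b \<Longrightarrow> (f has_real_derivative f' x) (at x)" "\<And>x. a < x \<Longrightarrow> x < b \<Longrightarrow> 0 \<le> f' x"
  shows "f a \<le> f b"
proof (cases "a = b")
  case False
  then have "a < b" using assms by simp
  then obtain l z where z: "a < z" "z < b" "(f has_real_derivative l) (at z)" "f b - f a = (b - a) * l"
    using MVT[of a b f] assms(2) der(1) real_differentiable_def by metis
  then have "l = f' z" using DERIV_unique der(1) by blast
  then have "0 \<le> (b - a) * l" using der(2) z \<open>a < b\<close> by auto
  then show ?thesis using z(4) by simp
qed simp

definition jacobi_weight :: "real \<Rightarrow> real \<Rightarrow> real \<Rightarrow> real" where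
  "jacobi_weight a b x = (1 - x) powr a * (1 + x) powr b"

lemma jacobi_weight_nonneg: "0 \<le> jacobi_weight a b x"
  by (simp add: jacobi_weight_def)

lemma jacobi_weight_pos: "x \<in> {-1<..<1} \<Longrightarrow> 0 < jacobi_weight a b x"
  by (simp add: jacobi_weight_def)

lemma jacobi_weight_deriv:
  assumes x: "x \<in> {-1<..<1}"
  shows "(jacobi_weight a b has_real_derivative
     - jacobi_weight a b x * (a * (1 + x) - b * (1 - x)) / (1 - x\<^sup>2)) (at x)"
proof -
  have 1: "((\<lambda>x. (1 - x) powr a) has_real_derivative - a * (1 - x) powr a / (1 - x)) (at x)"
    using x by (auto intro!: derivative_eq_intros simp: powr_diff field_simps)
  have 2: "((\<lambda>x. (1 + x) powr b) has_real_derivative b * (1 + x) powr b / (1 + x)) (at x)"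
    using x by (auto intro!: derivative_eq_intros simp: powr_diff field_simps)
  have eq: "1 - x\<^sup>2 = (1 - x) * (1 + x)" by (simp add: power2_eq_square algebra_simps)
  have nz: "1 - x \<noteq> 0" "1 + x \<noteq> 0" using x by auto
  show ?thesis
    unfolding jacobi_weight_def[abs_def]
    by (rule DERIV_cong[OF DERIV_mult[OF 1 2]]) (use nz in \<open>simp add: eq field_simps\<close>)
qed

text \<open>With \<open>a = \<alpha> + 1/2\<close> and \<open>b = \<beta> + 1/2\<close> this is the differential equation of the Jacobi polynomials; in the
variable \<open>\<theta>\<close> with \<open>x = cos \<theta>\<close> it is the damped oscillator
\<open>d\<^sup>2y/d\<theta>\<^sup>2 + (w\<^sub>\<theta>/w) dy/d\<theta> + lam \<cdot> y = 0\<close>, where \<open>w = (1 - x)\<^sup>a (1 + x)\<^sup>b\<close>.  The exponents are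
shifted by \<open>1/2\<close> from those of the Jacobi measure, whose density is called \<open>\<omega>\<close>.\<close>

locale jacobi_equation =
  fixes a b lam :: real and y y1 y2 :: "real \<Rightarrow> real"
  assumes a: "0 \<le> a" and b: "0 \<le> b" and lam: "0 < lam"
    and y: "\<And>x. (y has_real_derivative y1 x) (at x)"
    and y1: "\<And>x. (y1 has_real_derivative y2 x) (at x)"
    and ode: "\<And>x. x \<in> {-1<..<1} \<Longrightarrow>
       (1 - x\<^sup>2) * y2 x = (a * (1 + x) - b * (1 - x) + x) * y1 x - lam * y x"
begin

abbreviation w :: "real \<Rightarrow> real" where "w \<equiv> jacobi_weight a b"

abbreviation \<omega> :: "real \<Rightarrow> real" where "\<omega> \<equiv> jacobi_weight (a - 1/2) (b - 1/2)"

text \<open>The logarithmic derivative of \<open>w\<close> is \<open>- drift x / (1 - x\<^sup>2)\<close>.\<close>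

definition drift :: "real \<Rightarrow> real" where
  "drift x = a * (1 + x) - b * (1 - x)"

text \<open>The energy of the oscillator, as \<open>dy/d\<theta> = - sqrt (1 - x\<^sup>2) y1\<close>.\<close>

definition energy :: "real \<Rightarrow> real" where
  "energy x = lam * (y x)\<^sup>2 + (1 - x\<^sup>2) * (y1 x)\<^sup>2"

text \<open>The derivative \<open>w \<cdot> drift \<cdot> ((1 - x\<^sup>2) y1\<^sup>2 - lam y\<^sup>2) / (1 - x\<^sup>2)\<close> of \<open>w \<cdot> energy\<close> oscillates around zero but is not
small.  The additional term cancels it up to a multiple of \<open>y y1\<close>.\<close>

definition corrected_energy :: "real \<Rightarrow> real" where
  "corrected_energy x = w x * (energy x - drift x * y x * y1 x)"

lemma one_minus_sq: 
  assumes "x \<in> {-1<..<1}" shows "0 < 1 - x\<^sup>2" "1 - x\<^sup>2 \<le> (1::real)"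
proof -
  have "1 - x\<^sup>2 = (1 - x) * (1 + x)" by (simp add: power2_eq_square algebra_simps)
  then show "0 < 1 - x\<^sup>2" using assms by simp
qed simp

lemma drift_bound: "x \<in> {-1<..<1} \<Longrightarrow> \<bar>drift x\<bar> \<le> 2 * (a + b)"
proof -
  assume x: "x \<in> {-1<..<1}"
  have "0 \<le> a * (1 + x)" "a * (1 + x) \<le> a * 2" "0 \<le> b * (1 - x)" "b * (1 - x) \<le> b * 2"
    using x a b by (auto intro!: mult_left_mono)
  moreover have "\<bar>A - B\<bar> \<le> 2 * (a + b)" if "0 \<le> A" "A \<le> a * 2" "0 \<le> B" "B \<le> b * 2" for A B
    using that a b by (simp add: abs_le_iff)
  ultimately show "\<bar>drift x\<bar> \<le> 2 * (a + b)" unfolding drift_def by blast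
qed

lemma energy_nonneg: "x \<in> {-1<..<1} \<Longrightarrow> 0 \<le> energy x"
  unfolding energy_def using lam one_minus_sq(1)[of x] by (intro add_nonneg_nonneg mult_nonneg_nonneg) auto

lemma sq_le_energy: "x \<in> {-1<..<1} \<Longrightarrow> (y x)\<^sup>2 \<le> energy x / lam"
proof -
  assume x: "x \<in> {-1<..<1}"
  have "0 \<le> (1 - x\<^sup>2) * (y1 x)\<^sup>2" using one_minus_sq(1)[OF x] by simp
  then have "(y x)\<^sup>2 * lam \<le> energy x" unfolding energy_def by (simp only: mult.commute le_add_same_cancel1)
  then show ?thesis using lam by (simp only: pos_le_divide_eq)
qed

lemma slope_le_energy: "x \<in> {-1<..<1} \<Longrightarrow> (y1 x)\<^sup>2 \<le> energy x / (1 - x\<^sup>2)"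
proof -
  assume x: "x \<in> {-1<..<1}"
  have "0 \<le> lam * (y x)\<^sup>2" using lam by simp
  then have "(y1 x)\<^sup>2 * (1 - x\<^sup>2) \<le> energy x" unfolding energy_def by (simp only: mult.commute le_add_same_cancel2)
  then show ?thesis using one_minus_sq(1)[OF x] by (simp only: pos_le_divide_eq)
qed

lemma product_le_energy:
  assumes x: "x \<in> {-1<..<1}"
  shows "\<bar>y x * y1 x\<bar> \<le> energy x / (2 * sqrt (lam * (1 - x\<^sup>2)))"
proof -
  define p q where "p = sqrt lam * \<bar>y x\<bar>" and "q = sqrt (1 - x\<^sup>2) * \<bar>y1 x\<bar>"
  have s: "0 < sqrt (lam * (1 - x\<^sup>2))" using lam one_minus_sq[OF x] by simp
  have "p\<^sup>2 + q\<^sup>2 = energy x"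
    using lam one_minus_sq[OF x] by (simp add: p_def q_def energy_def power_mult_distrib)
  moreover have "2 * p * q \<le> p\<^sup>2 + q\<^sup>2" by (rule sum_squares_bound)
  moreover have "p * q = sqrt (lam * (1 - x\<^sup>2)) * \<bar>y x * y1 x\<bar>"
    by (simp add: p_def q_def abs_mult real_sqrt_mult)
  ultimately show ?thesis using s by (simp add: pos_le_divide_eq mult_ac)
qed

lemma energy_deriv:
  assumes x: "x \<in> {-1<..<1}"
  shows "(energy has_real_derivative 2 * drift x * (y1 x)\<^sup>2) (at x)"
proof -
  have "(energy has_real_derivative
      lam * (2 * y x * y1 x) + (- (2 * x) * (y1 x)\<^sup>2 + (1 - x\<^sup>2) * (2 * y1 x * y2 x))) (at x)"
    unfolding energy_def[abs_def] by (auto intro!: derivative_eq_intros y y1)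
  moreover have "lam * (2 * y x * y1 x) + (- (2 * x) * (y1 x)\<^sup>2 + (1 - x\<^sup>2) * (2 * y1 x * y2 x))
     = lam * (2 * y x * y1 x) - 2 * x * (y1 x)\<^sup>2 + 2 * y1 x * ((1 - x\<^sup>2) * y2 x)"
    by (simp add: algebra_simps)
  moreover have "\<dots> = 2 * drift x * (y1 x)\<^sup>2"
    unfolding ode[OF x] drift_def by (simp add: algebra_simps power2_eq_square)
  ultimately show ?thesis by simp
qed

text \<open>The squares of \<open>y\<close> and \<open>y1\<close> have cancelled; by \<open>product_le_energy\<close> the remaining product is, at a fixed \<open>x\<close>, smaller
than the energy by a factor of order \<open>1 / sqrt lam\<close>.\<close>

lemma corrected_energy_deriv:
  assumes x: "x \<in> {-1<..<1}"
  shows "(corrected_energy has_real_derivative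
     - w x * (y x * y1 x) * (a + b + drift x * x / (1 - x\<^sup>2))) (at x)"
proof -
  let ?s = "1 - x\<^sup>2"
  have s: "?s \<noteq> 0" using one_minus_sq[OF x] by simp
  have D: "(drift has_real_derivative a + b) (at x)"
    unfolding drift_def[abs_def] by (auto intro!: derivative_eq_intros)
  have W: "(w has_real_derivative - w x * drift x / ?s) (at x)"
    unfolding drift_def by (rule jacobi_weight_deriv[OF x])
  have E: "((\<lambda>x. energy x - drift x * y x * y1 x) has_real_derivative
     2 * drift x * (y1 x)\<^sup>2 - (((a + b) * y x + y1 x * drift x) * y1 x + y2 x * (drift x * y x))) (at x)"
    by (intro DERIV_diff energy_deriv[OF x] DERIV_mult D y y1)
  have y2: "y2 x = ((drift x + x) * y1 x - lam * y x) / ?s"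
    using ode[OF x] s by (simp add: drift_def field_simps)
  have "- w x * drift x / ?s * (energy x - drift x * y x * y1 x) +
     (2 * drift x * (y1 x)\<^sup>2 - (((a + b) * y x + y1 x * drift x) * y1 x + y2 x * (drift x * y x))) * w x
     = - w x * (y x * y1 x) * (a + b + drift x * x / ?s)"
  proof -
    have "energy x = ?s * (lam * (y x)\<^sup>2 / ?s + (y1 x)\<^sup>2)"
      using s by (simp add: energy_def field_simps)
    then have "drift x / ?s * energy x = drift x * (lam * (y x)\<^sup>2 / ?s + (y1 x)\<^sup>2)"
      using s by simp
    moreover have "- w x * drift x / ?s * (energy x - drift x * y x * y1 x)
      = - w x * (drift x / ?s * energy x - drift x / ?s * (drift x * y x * y1 x))"
      by (simp add: right_diff_distrib)
    ultimately have "- w x * drift x / ?s * (energy x - drift x * y x * y1 x)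
      = - w x * (drift x * (lam * (y x)\<^sup>2 / ?s + (y1 x)\<^sup>2) - drift x / ?s * (drift x * y x * y1 x))"
      by simp
    then show ?thesis
      unfolding y2 by (simp add: power2_eq_square algebra_simps add_divide_distrib diff_divide_distrib)
  qed
  then show ?thesis
    unfolding corrected_energy_def[abs_def] by (intro DERIV_cong[OF DERIV_mult[OF W E]]) simp
qed

lemma flux_weight:
  assumes u: "u \<in> {-1<..<1}"
  shows "jacobi_weight (a + 1/2) (b + 1/2) u = (1 - u\<^sup>2) * \<omega> u"
proof -
  have "v powr (c + 1/2) = v * v powr (c - 1/2)" if "0 < v" for v c :: real
    using that powr_add[of v "c - 1/2" 1] by (simp add: add.commute mult.commute)
  then have "(1 - u) powr (a + 1/2) = (1 - u) * (1 - u) powr (a - 1/2)"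
    "(1 + u) powr (b + 1/2) = (1 + u) * (1 + u) powr (b - 1/2)"
    using u by auto
  moreover have "1 - u\<^sup>2 = (1 - u) * (1 + u)" by (simp add: power2_eq_square algebra_simps)
  ultimately show ?thesis by (simp add: jacobi_weight_def)
qed

lemma flux_deriv:
  assumes u: "u \<in> {-1<..<1}"
  shows "((\<lambda>x. jacobi_weight (a + 1/2) (b + 1/2) x * y1 x) has_real_derivative - lam * \<omega> u * y u) (at u)"
proof -
  let ?W = "jacobi_weight (a + 1/2) (b + 1/2)"
  note W = flux_weight[OF u]
  have s: "1 - u\<^sup>2 \<noteq> 0" using one_minus_sq[OF u] by simp
  have "((\<lambda>x. ?W x * y1 x) has_real_derivative - ?W u * ((a + 1/2) * (1 + u) - (b + 1/2) * (1 - u)) / (1 - u\<^sup>2) * y1 u + y2 u * ?W u) (at u)"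
    by (intro DERIV_mult jacobi_weight_deriv[OF u] y1)
  moreover have "- ?W u * ((a + 1/2) * (1 + u) - (b + 1/2) * (1 - u)) / (1 - u\<^sup>2) * y1 u + y2 u * ?W u
      = \<omega> u * ((1 - u\<^sup>2) * y2 u - ((a + 1/2) * (1 + u) - (b + 1/2) * (1 - u)) * y1 u)"
  proof -
    have "- (X * P) * D / X * V + Z * (X * P) = P * (X * Z - D * V)" if "X \<noteq> 0" for X P D V Z :: real
      using that by (simp add: algebra_simps)
    from this[OF s] show ?thesis unfolding W by blast
  qed
  moreover have "\<dots> = - lam * \<omega> u * y u"
  proof -
    have "(a + 1/2) * (1 + u) - (b + 1/2) * (1 - u) = a * (1 + u) - b * (1 - u) + u"
      by (simp add: field_simps)
    then show ?thesis unfolding ode[OF u] by (simp only:) (simp add: algebra_simps)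
  qed
  ultimately show ?thesis by simp
qed

text \<open>The flux \<open>(1 - x\<^sup>2) \<omega> y1\<close> vanishes at 1 and has the derivative \<open>- lam \<omega> y\<close>, whose absolute value is at most a
multiple of that of the derivative of \<open>(1 - x) powr (a + 1/2)\<close>.\<close>

lemma slope_bound:
  assumes x0: "0 \<le> x0" and Y: "\<And>x. x0 \<le> x \<Longrightarrow> x \<le> 1 \<Longrightarrow> \<bar>y x\<bar> \<le> Y" and x: "x0 \<le> x" "x < 1"
  shows "\<bar>y1 x\<bar> \<le> 2 powr (b + 1) * lam * Y"
proof -
  define z where "z x = jacobi_weight (a + 1/2) (b + 1/2) x * y1 x" for x
  define K where "K = lam * Y * 2 powr b / (a + 1/2)"
  define h where "h x = (1 - x) powr (a + 1/2)" for x :: real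
  define h' where "h' x = - ((a + 1/2) * (1 - x) powr (a - 1/2))" for x :: real
  have Y0: "0 \<le> Y" using Y[of x] x x0 by force
  have cont: "continuous_on {x..1} z" "continuous_on {x..1} h"
  proof -
    have "continuous_on {x..1} y1" by (rule DERIV_continuous_on[of _ _ y2]) (rule has_field_derivative_at_within[OF y1])
    moreover have "continuous_on {x..1} (\<lambda>x. (1 - x) powr (a + 1/2))" "continuous_on {x..1} (\<lambda>x. (1 + x) powr (b + 1/2))"
      by (rule continuous_on_powr'; use a b x x0 in \<open>auto intro!: continuous_intros\<close>)+
    ultimately show "continuous_on {x..1} z" "continuous_on {x..1} h"
      unfolding z_def jacobi_weight_def h_def by (auto intro!: continuous_intros)
  qed
  have dz: "(z has_real_derivative - lam * \<omega> u * y u) (at u)" if u: "x < u" "u < 1" for u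
    unfolding z_def[abs_def] by (rule flux_deriv) (use u x x0 in auto)
  have dh: "(h has_real_derivative h' u) (at u)" if u: "x < u" "u < 1" for u
    unfolding h_def h'_def using u by (auto intro!: derivative_eq_intros)
  have rhs: "\<bar>lam * \<omega> u * y u\<bar> \<le> - K * h' u" if u: "x < u" "u < 1" for u
  proof -
    have "(1 + u) powr (b - 1/2) \<le> 2 powr b"
    proof (cases "1/2 \<le> b")
      case True
      have "(1 + u) powr (b - 1/2) \<le> 2 powr (b - 1/2)" using u True x x0 by (intro powr_mono2) auto
      also have "\<dots> \<le> 2 powr b" by (intro powr_mono) auto
      finally show ?thesis .
    next
      case False
      have "(1 + u) powr (b - 1/2) \<le> (1 + u) powr 0" using u False x x0 by (intro powr_mono) auto
      also have "\<dots> \<le> 2 powr b" using b u x x0 by (simp add: ge_one_powr_ge_zero)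
      finally show ?thesis .
    qed
    then have "\<omega> u \<le> (1 - u) powr (a - 1/2) * 2 powr b"
      unfolding jacobi_weight_def by (intro mult_left_mono) auto
    then have "lam * \<omega> u * \<bar>y u\<bar> \<le> lam * ((1 - u) powr (a - 1/2) * 2 powr b) * Y"
      using lam Y[of u] u x x0 by (intro mult_mono mult_left_mono mult_nonneg_nonneg jacobi_weight_nonneg) auto
    also have "\<dots> = - K * h' u" using a by (simp add: K_def h'_def)
    finally show ?thesis using lam jacobi_weight_nonneg[of _ _ u] by (simp add: abs_mult)
  qed
  have "z x - K * h x \<le> z 1 - K * h 1"
  proof (rule nondecreasing_of_deriv_nonneg[where f = "\<lambda>u. z u - K * h u" and f' = "\<lambda>u. - lam * \<omega> u * y u - K * h' u"])
    show "((\<lambda>u. z u - K * h u) has_real_derivative - lam * \<omega> u * y u - K * h' u) (at u)" if "x < u" "u < 1" for u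
      by (intro DERIV_diff DERIV_cmult dz dh that)
    show "0 \<le> - lam * \<omega> u * y u - K * h' u" if "x < u" "u < 1" for u
      using rhs[OF that] unfolding abs_le_iff by simp
  qed (use x in \<open>auto intro!: continuous_intros cont\<close>)
  moreover have "- z x - K * h x \<le> - z 1 - K * h 1"
  proof (rule nondecreasing_of_deriv_nonneg[where f = "\<lambda>u. - z u - K * h u" and f' = "\<lambda>u. - (- lam * \<omega> u * y u) - K * h' u"])
    show "((\<lambda>u. - z u - K * h u) has_real_derivative - (- lam * \<omega> u * y u) - K * h' u) (at u)" if "x < u" "u < 1" for u
      by (intro DERIV_diff DERIV_minus DERIV_cmult dz dh that)
    show "0 \<le> - (- lam * \<omega> u * y u) - K * h' u" if "x < u" "u < 1" for u
      using rhs[OF that] unfolding abs_le_iff by simp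
  qed (use x in \<open>auto intro!: continuous_intros cont\<close>)
  moreover have "z 1 = 0" "h 1 = 0" by (simp_all add: z_def h_def jacobi_weight_def)
  ultimately have zh: "\<bar>z x\<bar> \<le> K * h x" by (simp add: abs_le_iff)
  have hx: "0 < h x" unfolding h_def using x by simp
  have "\<bar>y1 x\<bar> * (1 + x) powr (b + 1/2) \<le> K"
  proof -
    have "\<bar>z x\<bar> = \<bar>y1 x\<bar> * (1 + x) powr (b + 1/2) * h x"
      by (simp add: z_def h_def jacobi_weight_def abs_mult)
    then show ?thesis using zh hx by simp
  qed
  moreover have "1 \<le> (1 + x) powr (b + 1/2)" using x x0 b by (intro ge_one_powr_ge_zero) auto
  then have "\<bar>y1 x\<bar> * 1 \<le> \<bar>y1 x\<bar> * (1 + x) powr (b + 1/2)" by (intro mult_left_mono) auto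
  moreover have "K \<le> lam * Y * 2 powr b / (1/2)"
    unfolding K_def using a lam Y0 by (intro divide_left_mono) auto
  then have "K \<le> 2 powr (b + 1) * lam * Y" by (simp add: powr_add mult_ac)
  ultimately show ?thesis by linarith
qed

text \<open>By the slope bound, \<open>y\<close> varies on \<open>{1 - e/lam..1}\<close> by at most half its maximum there; this is the purpose of
the bound on \<open>e\<close>.\<close>

lemma max_near_one:
  assumes e: "0 < e" "e \<le> lam" "e \<le> 2 powr (- b - 2)" and x: "1 - e / lam \<le> x" "x \<le> 1"
  shows "\<bar>y x\<bar> \<le> 2 * \<bar>y (1 - e / lam)\<bar>"
proof -
  define x0 where "x0 = 1 - e / lam"
  have x0: "0 \<le> x0" "x0 < 1" using e lam by (auto simp: x0_def)
  have cy: "continuous_on S y" for S by (rule DERIV_continuous_on[of _ _ y1]) (rule has_field_derivative_at_within[OF y])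
  obtain m where m: "m \<in> {x0..1}" "\<And>u. u \<in> {x0..1} \<Longrightarrow> \<bar>y u\<bar> \<le> \<bar>y m\<bar>"
    using continuous_attains_sup[of "{x0..1}" "\<lambda>u. \<bar>y u\<bar>"] x0 continuous_on_rabs[OF cy] by auto
  have "\<bar>y m - y x0\<bar> \<le> \<bar>y m\<bar> / 2"
  proof (cases "x0 = m")
    case False
    then have lt: "x0 < m" using m(1) by auto
    have "\<exists>z>x0. z < m \<and> y m - y x0 = (m - x0) * y1 z"
      using lt y by (intro MVT2) auto
    then obtain z where z: "x0 < z" "z < m" "y m - y x0 = (m - x0) * y1 z" by blast
    have s: "\<bar>y1 z\<bar> \<le> 2 powr (b + 1) * lam * \<bar>y m\<bar>"
      using slope_bound[OF x0(1), of "\<bar>y m\<bar>" z] m z by auto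
    have "\<bar>y m - y x0\<bar> = (m - x0) * \<bar>y1 z\<bar>" using z lt by (simp add: abs_mult)
    also have "\<dots> \<le> (e / lam) * (2 powr (b + 1) * lam * \<bar>y m\<bar>)"
      using m(1) s lt e lam by (intro mult_mono) (auto simp: x0_def)
    also have "\<dots> = e * 2 powr (b + 1) * \<bar>y m\<bar>" using lam by simp
    also have "\<dots> \<le> 2 powr (- b - 2) * 2 powr (b + 1) * \<bar>y m\<bar>"
      using e by (intro mult_right_mono) auto
    also have "2 powr (- b - 2) * 2 powr (b + 1) = (1/2 :: real)"
      by (simp add: powr_add[symmetric] powr_minus_divide)
    finally show ?thesis by simp
  qed simp
  then have "\<bar>y m\<bar> \<le> 2 * \<bar>y x0\<bar>" by linarith
  moreover have "\<bar>y x\<bar> \<le> \<bar>y m\<bar>" using m(2)[of x] x by (auto simp: x0_def)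
  ultimately show ?thesis by (simp add: x0_def)
qed

text \<open>The derivative \<open>2 drift y1\<^sup>2\<close> of the energy is at most \<open>4 (a + b) energy / (1 - x)\<close>.\<close>

lemma energy_growth:
  assumes x: "0 \<le> x" "x \<le> x'" "x' < 1"
  shows "energy x' \<le> ((1 - x) / (1 - x')) powr (4 * (a + b)) * energy x"
proof -
  define c where "c = 4 * (a + b)"
  define F where "F x = - (energy x * (1 - x) powr c)" for x
  have ud: "(F has_real_derivative - (2 * drift u * (y1 u)\<^sup>2 * (1 - u) powr c + (- c * (1 - u) powr (c - 1)) * energy u)) (at u)"
    if u: "u \<in> {0..<1}" for u
    unfolding F_def
  proof (intro DERIV_minus DERIV_mult energy_deriv)
    show "((\<lambda>x. (1 - x) powr c) has_real_derivative - c * (1 - u) powr (c - 1)) (at u)"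
      using u by (auto intro!: derivative_eq_intros)
  qed (use u in auto)
  have "F x \<le> F x'"
  proof (rule DERIV_nonneg_imp_nondecreasing[OF x(2)])
    fix u assume u: "x \<le> u" "u \<le> x'"
    then have u': "u \<in> {0..<1}" "u \<in> {-1<..<1}" using x by auto
    have "2 * drift u * (y1 u)\<^sup>2 \<le> 2 * \<bar>drift u\<bar> * (energy u / (1 - u\<^sup>2))"
    proof -
      have "drift u * (y1 u)\<^sup>2 \<le> \<bar>drift u\<bar> * (y1 u)\<^sup>2" by (intro mult_right_mono) auto
      also have "\<dots> \<le> \<bar>drift u\<bar> * (energy u / (1 - u\<^sup>2))"
        by (intro mult_left_mono slope_le_energy u') auto
      finally show ?thesis by simp
    qed
    also have "\<dots> \<le> c * (energy u / (1 - u))"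
    proof -
      have "u\<^sup>2 \<le> u" using u' by (simp add: power2_eq_square mult_left_le)
      then have "energy u / (1 - u\<^sup>2) \<le> energy u / (1 - u)"
        using u' energy_nonneg[OF u'(2)] one_minus_sq[OF u'(2)] by (intro divide_left_mono mult_pos_pos) auto
      moreover have "2 * \<bar>drift u\<bar> \<le> c" using drift_bound[OF u'(2)] by (simp add: c_def)
      ultimately show ?thesis
        using energy_nonneg[OF u'(2)] one_minus_sq[OF u'(2)] by (intro mult_mono) (auto simp: c_def a b)
    qed
    finally have "2 * drift u * (y1 u)\<^sup>2 * (1 - u) powr c \<le> c * (energy u / (1 - u)) * (1 - u) powr c"
      by (intro mult_right_mono) auto
    also have "\<dots> = c * (1 - u) powr (c - 1) * energy u"
      using u' by (simp add: powr_diff)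
    finally show "\<exists>z. (F has_real_derivative z) (at u) \<and> 0 \<le> z"
      using ud[OF u'(1)] by (intro exI conjI) auto
  qed
  then have "energy x' * (1 - x') powr c \<le> energy x * (1 - x) powr c" by (simp add: F_def)
  then show ?thesis
    using x unfolding c_def[symmetric] by (simp add: powr_divide field_simps)
qed

text \<open>Where \<open>1 - x\<^sup>2 \<ge> k\<^sup>2/lam\<close>, the correction is at most half of the weighted energy, and the derivative of the
corrected energy is small relative to it.\<close>

lemma corrected_energy_estimates:
  assumes k: "0 < k" "2 * (a + b) \<le> k" and x: "x \<in> {-1<..<1}" "k\<^sup>2 / lam \<le> 1 - x\<^sup>2"
  shows "w x * energy x \<le> 2 * corrected_energy x" "2 * corrected_energy x \<le> 3 * (w x * energy x)"
    and "\<bar>w x * (y x * y1 x) * (a + b + drift x * x / (1 - x\<^sup>2))\<bar>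
      \<le> 3 * (a + b) / sqrt lam * (1 / sqrt (1 - x\<^sup>2) ^ 3) * corrected_energy x"
proof -
  let ?s = "1 - x\<^sup>2"
  define P where "P = y x * y1 x"
  have s: "0 < ?s" "?s \<le> 1" using one_minus_sq[OF x(1)] by auto
  have "k\<^sup>2 \<le> lam * ?s" using x(2) lam by (simp add: field_simps)
  then have r: "k \<le> sqrt (lam * ?s)" by (rule real_le_rsqrt)
  with k(1) have r0: "0 < sqrt (lam * ?s)" by (rule less_le_trans)
  have E: "0 \<le> energy x" by (rule energy_nonneg[OF x(1)])
  have w: "0 \<le> w x" by (rule jacobi_weight_nonneg)
  have P: "\<bar>P\<bar> \<le> energy x / (2 * sqrt (lam * ?s))"
    unfolding P_def by (rule product_le_energy[OF x(1)])
  have "\<bar>drift x\<bar> * \<bar>P\<bar> \<le> k * (energy x / (2 * sqrt (lam * ?s)))"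
    using drift_bound[OF x(1)] k by (intro mult_mono P) auto
  also have "\<dots> \<le> sqrt (lam * ?s) * (energy x / (2 * sqrt (lam * ?s)))"
    using r r0 E by (intro mult_right_mono) auto
  also have "\<dots> = energy x / 2"
  proof -
    have "R * (e / (2 * R)) = e / 2" if "0 < R" for R e :: real using that by simp
    from this[OF r0] show ?thesis .
  qed
  finally have dP: "\<bar>drift x * P\<bar> \<le> energy x / 2" by (simp add: abs_mult)
  define V where "V = energy x - drift x * P"
  have W: "corrected_energy x = w x * V" by (simp add: corrected_energy_def P_def V_def mult.assoc)
  have "energy x \<le> 2 * V" "2 * V \<le> 3 * energy x"
    using dP unfolding V_def by (auto simp: abs_le_iff)
  from mult_left_mono[OF this(1) w] mult_left_mono[OF this(2) w]
  show 1: "w x * energy x \<le> 2 * corrected_energy x" and "2 * corrected_energy x \<le> 3 * (w x * energy x)"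
    unfolding W by (simp_all add: mult_ac)
  have "\<bar>a + b + drift x * x / ?s\<bar> \<le> 3 * (a + b) / ?s"
  proof -
    have "\<bar>(a + b) * ?s + drift x * x\<bar> \<le> (a + b) * ?s + \<bar>drift x\<bar> * \<bar>x\<bar>"
      using a b s by (intro order_trans[OF abs_triangle_ineq]) (simp add: abs_mult)
    also have "\<dots> \<le> (a + b) * 1 + (2 * (a + b)) * 1"
      using a b s x drift_bound[OF x(1)] by (intro add_mono mult_mono) auto
    finally have "\<bar>(a + b) * ?s + drift x * x\<bar> / ?s \<le> 3 * (a + b) / ?s"
      using s by (intro divide_right_mono) auto
    moreover have "a + b + drift x * x / ?s = ((a + b) * ?s + drift x * x) / ?s"
    proof -
      have "c + e / S = (c * S + e) / S" if "0 < S" for c e S :: real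
        using that by (simp add: field_simps)
      from this[OF s(1)] show ?thesis .
    qed
    ultimately show ?thesis using s(1) by (simp only: abs_divide abs_of_pos)
  qed
  then have "\<bar>w x * P * (a + b + drift x * x / ?s)\<bar> \<le> w x * (energy x / (2 * sqrt (lam * ?s))) * (3 * (a + b) / ?s)"
    unfolding abs_mult using w P a b s E r0 by (intro mult_mono) (auto intro!: mult_nonneg_nonneg divide_nonneg_nonneg)
  also have "\<dots> = 3 * (a + b) / sqrt lam * (1 / (sqrt ?s * ?s)) * (w x * energy x / 2)"
    by (simp add: real_sqrt_mult mult_ac)
  also have "sqrt ?s * ?s = sqrt ?s ^ 3"
    using s by (simp add: power3_eq_cube)
  also have "3 * (a + b) / sqrt lam * (1 / sqrt ?s ^ 3) * (w x * energy x / 2) \<le> 3 * (a + b) / sqrt lam * (1 / sqrt ?s ^ 3) * corrected_energy x"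
    using 1 a b lam s by (intro mult_left_mono) auto
  finally show "\<bar>w x * (y x * y1 x) * (a + b + drift x * x / ?s)\<bar>
      \<le> 3 * (a + b) / sqrt lam * (1 / sqrt ?s ^ 3) * corrected_energy x" by (simp add: P_def)
qed

lemma arc_deriv:
  fixes x :: real
  assumes x: "x \<in> {-1<..<1}"
  shows "((\<lambda>x. x / sqrt (1 - x\<^sup>2)) has_real_derivative 1 / sqrt (1 - x\<^sup>2) ^ 3) (at x)"
proof -
  define r where "r = sqrt (1 - x\<^sup>2)"
  have s: "0 < 1 - x\<^sup>2" using one_minus_sq[OF x] by simp
  then have r: "0 < r" "r\<^sup>2 = 1 - x\<^sup>2" by (simp_all add: r_def)
  have "((\<lambda>x. sqrt (1 - x\<^sup>2)) has_real_derivative - x / r) (at x)"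
  proof -
    have "((\<lambda>x. 1 - x\<^sup>2) has_real_derivative - (2 * x)) (at x)"
      by (auto intro!: derivative_eq_intros)
    from DERIV_chain2[OF DERIV_real_sqrt[OF s] this] show ?thesis
      by (rule DERIV_cong) (use r(1) in \<open>simp add: r_def[symmetric] field_simps\<close>)
  qed
  from DERIV_divide[OF DERIV_ident this] r(1)
  have "((\<lambda>x. x / sqrt (1 - x\<^sup>2)) has_real_derivative (1 * r - x * (- x / r)) / (r * r)) (at x)"
    by (simp add: r_def)
  moreover have "(1 * r - x * (- x / r)) / (r * r) = (r\<^sup>2 + x\<^sup>2) / r ^ 3"
    using r(1) by (simp add: field_simps power2_eq_square power3_eq_cube)
  ultimately show ?thesis using r(2) by (simp add: r_def)
qed

text \<open>The logarithmic derivative of the corrected energy is at most that of \<open>exp \<phi>\<close> in absolute value, and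
\<open>\<bar>\<phi>\<bar> \<le> 3/2\<close> in the region because \<open>2 (a + b) \<le> k\<close>.\<close>

lemma corrected_energy_comparable:
  assumes k: "0 < k" "2 * (a + b) \<le> k"
    and x: "x \<in> {-1<..<1}" "k\<^sup>2 / lam \<le> 1 - x\<^sup>2" and x': "x' \<in> {-1<..<1}" "k\<^sup>2 / lam \<le> 1 - x'\<^sup>2"
  shows "corrected_energy x \<le> exp 3 * corrected_energy x'"
proof -
  define c where "c = 3 * (a + b) / sqrt lam"
  have c: "0 \<le> c" using a b lam by (simp add: c_def)
  define \<phi> where "\<phi> x = c * (x / sqrt (1 - x\<^sup>2))" for x
  have D: "((\<lambda>x. corrected_energy x * exp (e * \<phi> x)) has_real_derivative
      (- w x * (y x * y1 x) * (a + b + drift x * x / (1 - x\<^sup>2)) + e * (c * (1 / sqrt (1 - x\<^sup>2) ^ 3) * corrected_energy x)) * exp (e * \<phi> x)) (at x)"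
    if "x \<in> {-1<..<1}" for x e
    unfolding \<phi>_def
    by (rule DERIV_cong[OF DERIV_mult[OF corrected_energy_deriv[OF that] DERIV_chain2[OF DERIV_exp DERIV_cmult[OF DERIV_cmult[OF arc_deriv[OF that]]]]]])
       (simp add: algebra_simps)
  have ivl: "u \<in> {-1<..<1} \<and> k\<^sup>2 / lam \<le> 1 - u\<^sup>2"
    if "x1 \<in> {-1<..<1}" "k\<^sup>2 / lam \<le> 1 - x1\<^sup>2" "x2 \<in> {-1<..<1}" "k\<^sup>2 / lam \<le> 1 - x2\<^sup>2" "x1 \<le> u" "u \<le> x2" for x1 x2 u
  proof -
    have "\<bar>u\<bar> \<le> \<bar>x1\<bar> \<or> \<bar>u\<bar> \<le> \<bar>x2\<bar>" using that by auto
    then have "u\<^sup>2 \<le> x1\<^sup>2 \<or> u\<^sup>2 \<le> x2\<^sup>2" by (simp add: abs_le_square_iff)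
    then show ?thesis using that by auto
  qed
  have up: "corrected_energy x1 * exp (\<phi> x1) \<le> corrected_energy x2 * exp (\<phi> x2)" and down: "corrected_energy x2 * exp (- \<phi> x2) \<le> corrected_energy x1 * exp (- \<phi> x1)"
    if h: "x1 \<in> {-1<..<1}" "k\<^sup>2 / lam \<le> 1 - x1\<^sup>2" "x2 \<in> {-1<..<1}" "k\<^sup>2 / lam \<le> 1 - x2\<^sup>2" "x1 \<le> x2" for x1 x2
  proof -
    have "corrected_energy x1 * exp (1 * \<phi> x1) \<le> corrected_energy x2 * exp (1 * \<phi> x2)"
    proof (rule DERIV_nonneg_imp_nondecreasing[OF h(5)])
      fix u assume "x1 \<le> u" "u \<le> x2"
      from ivl[OF h(1-4) this] have u: "u \<in> {-1<..<1}" "k\<^sup>2 / lam \<le> 1 - u\<^sup>2" by auto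
      show "\<exists>z. ((\<lambda>x. corrected_energy x * exp (1 * \<phi> x)) has_real_derivative z) (at u) \<and> 0 \<le> z"
      proof (intro exI conjI)
        show "0 \<le> (- w u * (y u * y1 u) * (a + b + drift u * u / (1 - u\<^sup>2)) + 1 * (c * (1 / sqrt (1 - u\<^sup>2) ^ 3) * corrected_energy u)) * exp (1 * \<phi> u)"
          using corrected_energy_estimates(3)[OF k u] unfolding c_def abs_le_iff by (intro mult_nonneg_nonneg) auto
      qed (rule D[OF u(1)])
    qed
    then show "corrected_energy x1 * exp (\<phi> x1) \<le> corrected_energy x2 * exp (\<phi> x2)" by simp
    have "corrected_energy x1 * exp (- 1 * \<phi> x1) \<ge> corrected_energy x2 * exp (- 1 * \<phi> x2)"
    proof (rule DERIV_nonpos_imp_nonincreasing[OF h(5)])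
      fix u assume "x1 \<le> u" "u \<le> x2"
      from ivl[OF h(1-4) this] have u: "u \<in> {-1<..<1}" "k\<^sup>2 / lam \<le> 1 - u\<^sup>2" by auto
      show "\<exists>z. ((\<lambda>x. corrected_energy x * exp (- 1 * \<phi> x)) has_real_derivative z) (at u) \<and> z \<le> 0"
      proof (intro exI conjI)
        show "(- w u * (y u * y1 u) * (a + b + drift u * u / (1 - u\<^sup>2)) + - 1 * (c * (1 / sqrt (1 - u\<^sup>2) ^ 3) * corrected_energy u)) * exp (- 1 * \<phi> u) \<le> 0"
          using corrected_energy_estimates(3)[OF k u] unfolding c_def abs_le_iff by (intro mult_nonpos_nonneg) auto
      qed (rule D[OF u(1)])
    qed
    then show "corrected_energy x2 * exp (- \<phi> x2) \<le> corrected_energy x1 * exp (- \<phi> x1)" by simp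
  qed
  have \<phi>: "\<bar>\<phi> u\<bar> \<le> 3 / 2" if u: "u \<in> {-1<..<1}" "k\<^sup>2 / lam \<le> 1 - u\<^sup>2" for u
  proof -
    have s: "0 < 1 - u\<^sup>2" using one_minus_sq[OF u(1)] by simp
    have "k\<^sup>2 \<le> lam * (1 - u\<^sup>2)" using u(2) lam by (simp add: field_simps)
    then have "k \<le> sqrt lam * sqrt (1 - u\<^sup>2)" unfolding real_sqrt_mult[symmetric] by (rule real_le_rsqrt)
    then have "2 * (a + b) \<le> sqrt lam * sqrt (1 - u\<^sup>2)" using k by linarith
    then have "c / sqrt (1 - u\<^sup>2) \<le> 3 / 2" unfolding c_def using lam s by (simp add: field_simps)
    moreover have "\<bar>\<phi> u\<bar> = c / sqrt (1 - u\<^sup>2) * \<bar>u\<bar>" using c s by (simp add: \<phi>_def abs_mult)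
    moreover have "c / sqrt (1 - u\<^sup>2) * \<bar>u\<bar> \<le> c / sqrt (1 - u\<^sup>2) * 1"
      using u c s by (intro mult_left_mono) auto
    ultimately show ?thesis by linarith
  qed
  have W0: "0 \<le> corrected_energy u" if u: "u \<in> {-1<..<1}" "k\<^sup>2 / lam \<le> 1 - u\<^sup>2" for u
  proof -
    have "0 \<le> w u * energy u" by (intro mult_nonneg_nonneg jacobi_weight_nonneg energy_nonneg u)
    then show ?thesis using corrected_energy_estimates(1)[OF k u] by simp
  qed
  have fin: "corrected_energy x \<le> exp 3 * corrected_energy x'" if "corrected_energy x * exp p \<le> corrected_energy x' * exp q" "q - p \<le> 3" for p q
  proof -
    have "corrected_energy x \<le> corrected_energy x' * exp q / exp p" using that(1) by (simp add: pos_le_divide_eq)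
    also have "\<dots> = corrected_energy x' * exp (q - p)" by (simp add: exp_diff)
    also have "\<dots> \<le> corrected_energy x' * exp 3" using W0[OF x'] that(2) by (intro mult_left_mono) auto
    finally show ?thesis by (simp add: mult.commute)
  qed
  show ?thesis
  proof (cases "x \<le> x'")
    case True
    show ?thesis by (rule fin[OF up[OF x x' True]]) (use \<phi>[OF x] \<phi>[OF x'] in \<open>simp add: abs_le_iff\<close>)
  next
    case False
    then show ?thesis using \<phi>[OF x] \<phi>[OF x'] by (intro fin[OF down[OF x' x]]) (auto simp: abs_le_iff)
  qed
qed

lemma continuous_solution: "continuous_on S y" "continuous_on S y1"
  by (rule DERIV_continuous_on, rule has_field_derivative_at_within, rule y y1)+

text \<open>The equation for the flux is multiplied by \<open>y\<close> and integrated by parts.\<close>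

lemma dirichlet_identity:
  assumes N: "((\<lambda>x. \<omega> x * (y x)\<^sup>2) has_integral N) {-1..1}"
  shows "((\<lambda>x. \<omega> x * ((1 - x\<^sup>2) * (y1 x)\<^sup>2)) has_integral lam * N) {-1..1}"
proof -
  let ?W = "jacobi_weight (a + 1/2) (b + 1/2)"
  define F where "F x = ?W x * y1 x * y x" for x
  have "((\<lambda>x. \<omega> x * ((1 - x\<^sup>2) * (y1 x)\<^sup>2) - lam * (\<omega> x * (y x)\<^sup>2)) has_integral (F 1 - F (- 1))) {-1..1}"
  proof (rule fundamental_theorem_of_calculus_interior)
    have "continuous_on {-1..1} (\<lambda>x::real. (1 - x) powr (a + 1/2))" "continuous_on {-1..1} (\<lambda>x::real. (1 + x) powr (b + 1/2))"
      by (rule continuous_on_powr'; use a b in \<open>auto intro!: continuous_intros\<close>)+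
    then show "continuous_on {-1..1} F"
      unfolding F_def jacobi_weight_def by (intro continuous_on_mult continuous_solution)
    fix u :: real assume u: "u \<in> {-1<..<1}"
    have "(F has_real_derivative - lam * \<omega> u * y u * y u + y1 u * (?W u * y1 u)) (at u)"
      unfolding F_def by (intro DERIV_mult flux_deriv[OF u] y)
    moreover have "- lam * \<omega> u * y u * y u + y1 u * (?W u * y1 u) = \<omega> u * ((1 - u\<^sup>2) * (y1 u)\<^sup>2) - lam * (\<omega> u * (y u)\<^sup>2)"
      unfolding flux_weight[OF u] by (simp add: power2_eq_square mult_ac)
    ultimately show "(F has_vector_derivative \<omega> u * ((1 - u\<^sup>2) * (y1 u)\<^sup>2) - lam * (\<omega> u * (y u)\<^sup>2)) (at u)"
      by (simp add: has_real_derivative_iff_has_vector_derivative)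
  qed simp
  moreover have "F 1 = 0" "F (- 1) = 0" by (simp_all add: F_def jacobi_weight_def)
  ultimately have "((\<lambda>x. \<omega> x * ((1 - x\<^sup>2) * (y1 x)\<^sup>2) - lam * (\<omega> x * (y x)\<^sup>2)) has_integral 0) {-1..1}" by simp
  from has_integral_add[OF this has_integral_mult_right[OF N, of lam]] show ?thesis by simp
qed

lemma weight_le: "x \<in> {-1<..<1} \<Longrightarrow> w x \<le> \<omega> x"
proof -
  assume x: "x \<in> {-1<..<1}"
  have "(1 - x) powr a = (1 - x) powr (a - 1/2) * (1 - x) powr (1/2)"
    "(1 + x) powr b = (1 + x) powr (b - 1/2) * (1 + x) powr (1/2)"
    by (simp_all add: powr_add[symmetric])
  then have "w x = \<omega> x * ((1 - x) * (1 + x)) powr (1/2)"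
    by (simp add: jacobi_weight_def powr_mult mult_ac)
  also have "(1 - x) * (1 + x) = 1 - x\<^sup>2" by (simp add: power2_eq_square algebra_simps)
  also have "(1 - x\<^sup>2) powr (1/2) \<le> 1 powr (1/2)"
    using one_minus_sq[OF x] by (intro powr_mono2) auto
  then have "\<omega> x * (1 - x\<^sup>2) powr (1/2) \<le> \<omega> x * 1"
    by (intro mult_left_mono jacobi_weight_nonneg) simp
  finally show ?thesis by simp
qed

text \<open>The weighted energy at \<open>x\<close> is at most \<open>3 exp 3\<close> times that at each point of \<open>{-1/2..1/2}\<close>, hence at most
\<open>3 exp 3\<close> times its integral over this interval of length 1.  That integral is at most the total
energy \<open>2 lam N\<close>.\<close>

lemma middle_bound:
  assumes N: "((\<lambda>x. \<omega> x * (y x)\<^sup>2) has_integral N) {-1..1}"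
    and k: "0 < k" "2 * (a + b) \<le> k" "k\<^sup>2 / lam \<le> 3/4"
    and x: "x \<in> {-1<..<1}" "k\<^sup>2 / lam \<le> 1 - x\<^sup>2"
  shows "w x * energy x \<le> 6 * exp 3 * lam * N"
proof -
  define g where "g x = lam * (\<omega> x * (y x)\<^sup>2) + \<omega> x * ((1 - x\<^sup>2) * (y1 x)\<^sup>2)" for x
  have gi: "(g has_integral lam * N + lam * N) {-1..1}"
    unfolding g_def by (intro has_integral_add has_integral_mult_right N dirichlet_identity)
  have g_eq: "g u = \<omega> u * energy u" for u by (simp add: g_def energy_def algebra_simps)
  have g0: "0 \<le> g u" if "u \<in> {-1..1}" for u
  proof -
    have "0 \<le> 1 - u\<^sup>2" using that by (simp add: abs_square_le_1 abs_le_iff)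
    then show ?thesis unfolding g_def using lam
      by (intro add_nonneg_nonneg mult_nonneg_nonneg jacobi_weight_nonneg) auto
  qed
  have gi1: "g integrable_on {-1..1}"
    using gi by (rule has_integral_integrable)
  then have gi': "g integrable_on {-1/2..1/2}"
    by (rule integrable_on_subinterval) simp
  have le: "w x * energy x / (3 * exp 3) \<le> g u" if u: "u \<in> {-1/2..1/2}" for u
  proof -
    have u1: "u \<in> {-1<..<1}" using u by auto
    have "u\<^sup>2 \<le> (1/2)\<^sup>2" using u by (subst abs_le_square_iff[symmetric]) (auto simp: abs_le_iff)
    also have "(1/2)\<^sup>2 = (1/4 :: real)" by (simp add: power2_eq_square)
    finally have u2: "k\<^sup>2 / lam \<le> 1 - u\<^sup>2" using k(3) by linarith
    have "w x * energy x \<le> 2 * corrected_energy x" by (rule corrected_energy_estimates(1)[OF k(1,2) x])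
    also have "\<dots> \<le> 2 * (exp 3 * corrected_energy u)" using corrected_energy_comparable[OF k(1,2) x u1 u2] by simp
    also have "\<dots> = exp 3 * (2 * corrected_energy u)" by simp
    also have "\<dots> \<le> exp 3 * (3 * (w u * energy u))"
      using corrected_energy_estimates(2)[OF k(1,2) u1 u2] by (intro mult_left_mono) auto
    also have "w u * energy u \<le> g u"
      unfolding g_eq by (intro mult_right_mono weight_le energy_nonneg u1)
    finally have "w x * energy x \<le> g u * (3 * exp 3)" by (simp add: mult_ac)
    then show ?thesis by (subst pos_divide_le_eq) auto
  qed
  have "w x * energy x / (3 * exp 3) = integral {-1/2..1/2} (\<lambda>_::real. w x * energy x / (3 * exp 3))"
    by simp
  also have "\<dots> \<le> integral {-1/2..1/2} g"
    by (rule integral_le) (use gi' le in \<open>auto intro!: integrable_continuous_real continuous_intros\<close>)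
  also have "\<dots> \<le> integral {-1..1} g"
    by (rule integral_subset_le[OF _ gi' gi1]) (use g0 in auto)
  also have "\<dots> = 2 * lam * N" using gi by (simp add: integral_unique)
  finally show ?thesis by (subst (asm) pos_divide_le_eq) (auto simp: mult_ac)
qed

text \<open>There are three zones.  Up to \<open>xc\<close>, where \<open>1 - xc\<^sup>2 = k\<^sup>2/lam\<close>, the energy bound applies directly.  Between \<open>xc\<close>
and \<open>xe = 1 - e/lam\<close> the energy grows at most by the constant \<open>D\<close>.  Beyond \<open>xe\<close> the solution is at most
twice its value at \<open>xe\<close>.  The factor \<open>(1 - x) powr a\<close> of the weight decreases, so that \<open>w\<close> at \<open>x\<close> is at most
\<open>2 powr b\<close> times \<open>w\<close> at \<open>xc\<close> in the last two zones.\<close>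

lemma bernstein_right:
  assumes N: "((\<lambda>x. \<omega> x * (y x)\<^sup>2) has_integral N) {-1..1}"
    and k: "1 \<le> k" "2 * (a + b) \<le> k" "k\<^sup>2 / lam \<le> 3/4"
    and x: "0 \<le> x" "x < 1"
  shows "w x * (y x)\<^sup>2 \<le> 2 powr b * (4 * (k\<^sup>2 / 2 powr (- b - 2)) powr (4 * (a + b))) * (6 * exp 3 * N)"
proof -
  define e where "e = 2 powr (- b - 2)"
  have e: "0 < e" "e \<le> 1/4"
  proof -
    have "e \<le> 2 powr (- 2)" unfolding e_def using b by (intro powr_mono) auto
    then show "e \<le> 1/4" by (simp add: powr_minus_divide)
  qed (simp add: e_def)
  \<comment> \<open>a bound for the growth of the energy as \<open>1 - x\<close> decreases from at most \<open>k\<^sup>2/lam\<close> to \<open>e/lam\<close>\<close>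
  define D where "D = (k\<^sup>2 / e) powr (4 * (a + b))"
  have k1: "1 \<le> k\<^sup>2" using k(1) by (simp add: one_le_power)
  have ke: "1 \<le> k\<^sup>2 / e" using k1 e by (simp add: pos_le_divide_eq)
  have D: "1 \<le> D" unfolding D_def using ke a b by (intro ge_one_powr_ge_zero) auto
  define xc where "xc = sqrt (1 - k\<^sup>2 / lam)"
  have kl: "0 < k\<^sup>2 / lam" using k1 lam by (intro divide_pos_pos) auto
  have "(1/2)\<^sup>2 \<le> 1 - k\<^sup>2 / lam" using k(3) by (simp add: power2_eq_square)
  then have xc1: "1/2 \<le> xc" unfolding xc_def by (rule real_le_rsqrt)
  have "xc\<^sup>2 = 1 - k\<^sup>2 / lam" unfolding xc_def using k(3) by (intro real_sqrt_pow2) linarith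
  then have xc2: "1 - xc\<^sup>2 = k\<^sup>2 / lam" by linarith
  have xc3: "xc < 1" unfolding xc_def using kl by (simp add: real_sqrt_lt_1_iff)
  have xc: "xc \<in> {-1<..<1}" using xc1 xc3 by simp
  have fac: "(1 - xc) * (1 + xc) = k\<^sup>2 / lam" unfolding xc2[symmetric] by (simp add: power2_eq_square algebra_simps)
  have "(1 - xc) * 1 \<le> (1 - xc) * (1 + xc)" using xc1 xc3 by (intro mult_left_mono) auto
  then have gap1: "1 - xc \<le> k\<^sup>2 / lam" unfolding fac by simp
  have "(1 - xc) * (1 + xc) \<le> (1 - xc) * 2" using xc1 xc3 by (intro mult_left_mono) auto
  then have gap2: "k\<^sup>2 / lam \<le> 2 * (1 - xc)" unfolding fac by simp
  have l0: "1 / lam \<le> k\<^sup>2 / lam" using k1 lam by (intro divide_right_mono) auto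
  then have l1: "1 / lam \<le> 3/4" using k(3) by linarith
  have elam: "e \<le> lam" using l1 e lam by (simp add: field_simps)
  define xe where "xe = 1 - e / lam"
  have "e / lam \<le> (1/4) / lam" using e lam by (intro divide_right_mono) auto
  then have e4: "e / lam \<le> 1 / lam / 4" by simp
  have "0 < e / lam" using e lam by simp
  have gap3: "xc \<le> 1 - E" if "0 < E" "K \<le> 2 * (1 - xc)" "L \<le> K" "E \<le> L / 4" for E K L
    using that by argo
  have xe: "xc \<le> xe" "xe < 1"
    unfolding xe_def using gap3[OF \<open>0 < e / lam\<close> gap2 l0 e4] \<open>0 < e / lam\<close> by auto
  have mid: "w z * energy z \<le> 6 * exp 3 * lam * N" if "z \<in> {-1<..<1}" "k\<^sup>2 / lam \<le> 1 - z\<^sup>2" for z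
    using k that by (intro middle_bound[OF N, of k]) auto
  have N0: "0 \<le> N"
    by (rule has_integral_nonneg[OF N]) (simp add: jacobi_weight_nonneg)
  have goal': "w x * (y x)\<^sup>2 \<le> 2 powr b * (4 * D) * (6 * exp 3 * N)"
  proof (cases "x \<le> xc")
    case True
    have x': "x \<in> {-1<..<1}" using x by simp
    have "x\<^sup>2 \<le> xc\<^sup>2" using True x by (intro power_mono) auto
    then have m: "w x * energy x \<le> 6 * exp 3 * lam * N" using xc2 by (intro mid x') auto
    have "w x * (y x)\<^sup>2 \<le> w x * (energy x / lam)" by (intro mult_left_mono sq_le_energy x' jacobi_weight_nonneg)
    also have "\<dots> = w x * energy x / lam" by simp
    also have "\<dots> \<le> 6 * exp 3 * lam * N / lam" using m lam by (intro divide_right_mono) auto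
    also have "\<dots> = 1 * (6 * exp 3 * N)" using lam by simp
    also have "\<dots> \<le> 2 powr b * (4 * D) * (6 * exp 3 * N)"
    proof (rule mult_right_mono)
      have "1 * 1 \<le> 2 powr b * (4 * D)" using D b by (intro mult_mono) (auto simp: ge_one_powr_ge_zero)
      then show "1 \<le> 2 powr b * (4 * D)" by simp
    qed (use N0 in simp)
    finally show ?thesis .
  next
    case False
    then have xx: "xc \<le> x" by simp
    have E: "(y z)\<^sup>2 \<le> D * energy xc / lam" if z: "xc \<le> z" "z \<le> xe" for z
    proof -
      have z1: "z < 1" "z \<in> {-1<..<1}" using z xe xc1 by auto
      have r: "(1 - xc) / (1 - z) \<le> k\<^sup>2 / e"
      proof -
        have "(1 - xc) / (1 - z) \<le> (k\<^sup>2 / lam) / (e / lam)"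
          using gap1 z xe e lam by (intro frac_le) (auto simp: xe_def)
        then show ?thesis using lam by simp
      qed
      have "energy z \<le> ((1 - xc) / (1 - z)) powr (4 * (a + b)) * energy xc"
        using xc1 z z1 by (intro energy_growth) auto
      also have "\<dots> \<le> D * energy xc"
        unfolding D_def using r a b xc3 z1 by (intro mult_right_mono powr_mono2 energy_nonneg[OF xc]) auto
      finally have "energy z / lam \<le> D * energy xc / lam" using lam by (intro divide_right_mono) auto
      then show ?thesis using sq_le_energy[OF z1(2)] by linarith
    qed
    have Ex0: "0 \<le> D * energy xc / lam" using D lam energy_nonneg[OF xc] by simp
    have y2: "(y x)\<^sup>2 \<le> 4 * (D * energy xc / lam)"
    proof (cases "x \<le> xe")
      case True
      then show ?thesis using E[OF xx True] Ex0 by linarith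
    next
      case False
      have "\<bar>y x\<bar> \<le> 2 * \<bar>y xe\<bar>"
        unfolding xe_def using e elam False x by (intro max_near_one) (auto simp: e_def xe_def)
      then have "\<bar>y x\<bar>\<^sup>2 \<le> (2 * \<bar>y xe\<bar>)\<^sup>2" by (intro power_mono) auto
      then have "(y x)\<^sup>2 \<le> 4 * (y xe)\<^sup>2" by (simp add: power_mult_distrib)
      then show ?thesis using E[OF xe(1)] by simp
    qed
    have w: "w x \<le> 2 powr b * w xc"
    proof -
      have "w x \<le> (1 - xc) powr a * 2 powr b"
        unfolding jacobi_weight_def using xx x a b xc1 by (intro mult_mono powr_mono2) auto
      also have "\<dots> \<le> (1 - xc) powr a * (2 powr b * (1 + xc) powr b)"
        using xc1 b by (intro mult_left_mono) (auto simp: ge_one_powr_ge_zero)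
      finally show ?thesis by (simp add: jacobi_weight_def mult_ac)
    qed
    have "w x * (y x)\<^sup>2 \<le> 2 powr b * w xc * (4 * (D * energy xc / lam))"
      using w y2 by (intro mult_mono mult_nonneg_nonneg jacobi_weight_nonneg) auto
    also have "\<dots> = 2 powr b * (4 * D) * (w xc * energy xc / lam)" by simp
    also have "\<dots> \<le> 2 powr b * (4 * D) * (6 * exp 3 * lam * N / lam)"
      using mid[OF xc] xc2 lam D by (intro mult_left_mono divide_right_mono) auto
    also have "6 * exp 3 * lam * N / lam = 6 * exp 3 * N" using lam by simp
    finally show ?thesis .
  qed
  then show ?thesis unfolding D_def e_def .
qed

lemma reflected: "jacobi_equation b a lam (\<lambda>x. y (- x)) (\<lambda>x. - y1 (- x)) (\<lambda>x. y2 (- x))"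
proof
  fix x :: real
  have m: "(uminus has_real_derivative - 1) (at x)" by (auto intro!: derivative_eq_intros)
  show "((\<lambda>x. y (- x)) has_real_derivative - y1 (- x)) (at x)"
    using DERIV_chain2[OF y m] by simp
  show "((\<lambda>x. - y1 (- x)) has_real_derivative y2 (- x)) (at x)"
    using DERIV_minus[OF DERIV_chain2[OF y1 m]] by simp
  assume "x \<in> {-1<..<1}"
  then have "(1 - (- x)\<^sup>2) * y2 (- x) = (a * (1 + - x) - b * (1 - - x) + - x) * y1 (- x) - lam * y (- x)"
    by (intro ode) auto
  then show "(1 - x\<^sup>2) * y2 (- x) = (b * (1 + x) - a * (1 - x) + x) * - y1 (- x) - lam * y (- x)"
    by (simp add: algebra_simps)
qed (use a b lam in auto)

end

lemma jacobi_weight_minus: "jacobi_weight b a (- x) = jacobi_weight a b x"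
  by (simp add: jacobi_weight_def)

text \<open>The reflection \<open>x \<mapsto> -x\<close> exchanges \<open>a\<close> and \<open>b\<close> and reduces the left half of the interval to the right half.\<close>

lemma bernstein_bound:
  assumes "0 \<le> a" "0 \<le> b"
  obtains B \<Lambda> where "0 < \<Lambda>" "0 \<le> B"
    "\<And>lam y y1 y2 N x. jacobi_equation a b lam y y1 y2 \<Longrightarrow> \<Lambda> \<le> lam \<Longrightarrow>
      ((\<lambda>x. jacobi_weight (a - 1/2) (b - 1/2) x * (y x)\<^sup>2) has_integral N) {-1..1} \<Longrightarrow>
      x \<in> {-1<..<1} \<Longrightarrow> jacobi_weight a b x * (y x)\<^sup>2 \<le> B * N"
proof -
  \<comment> \<open>any \<open>k \<ge> 1\<close> with \<open>k \<ge> 2 (a + b)\<close> would do\<close>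
  define k where "k = 2 * (a + b) + 1"
  have k: "1 \<le> k" "2 * (a + b) \<le> k" "2 * (b + a) \<le> k" using assms by (auto simp: k_def)
  define D where "D b = 2 powr b * (4 * (k\<^sup>2 / 2 powr (- b - 2)) powr (4 * (a + b))) * (6 * exp 3)" for b
  define D' where "D' = 2 powr a * (4 * (k\<^sup>2 / 2 powr (- a - 2)) powr (4 * (b + a))) * (6 * exp 3)"
  have D0: "0 \<le> D b" "0 \<le> D'" by (simp_all add: D_def D'_def)
  show ?thesis
  proof (rule that[of "4/3 * k\<^sup>2" "D b + D'"])
    show "0 < 4/3 * k\<^sup>2" "0 \<le> D b + D'" using k D0 by auto
    fix lam y y1 y2 N and x :: real
    assume J: "jacobi_equation a b lam y y1 y2" and l: "4/3 * k\<^sup>2 \<le> lam"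
      and N: "((\<lambda>x. jacobi_weight (a - 1/2) (b - 1/2) x * (y x)\<^sup>2) has_integral N) {-1..1}"
      and x: "x \<in> {-1<..<1}"
    interpret J: jacobi_equation a b lam y y1 y2 by (rule J)
    interpret R: jacobi_equation b a lam "\<lambda>x. y (- x)" "\<lambda>x. - y1 (- x)" "\<lambda>x. y2 (- x)" by (rule J.reflected)
    have kl: "k\<^sup>2 / lam \<le> 3/4" using l J.lam by (simp add: field_simps)
    have N0: "0 \<le> N"
      by (rule has_integral_nonneg[OF N]) (simp add: jacobi_weight_nonneg)
    show "jacobi_weight a b x * (y x)\<^sup>2 \<le> (D b + D') * N"
    proof (cases "0 \<le> x")
      case True
      have "jacobi_weight a b x * (y x)\<^sup>2 \<le> D b * N"
        using J.bernstein_right[OF N k(1,2) kl True] x by (simp add: D_def mult_ac)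
      also have "\<dots> \<le> (D b + D') * N" using D0 N0 by (intro mult_right_mono) auto
      finally show ?thesis .
    next
      case False
      have N': "((\<lambda>x. jacobi_weight (b - 1/2) (a - 1/2) x * (y (- x))\<^sup>2) has_integral N) {-1..1}"
      proof (rule Henstock_Kurzweil_Integration.has_integral_reflect_real[THEN iffD1])
        show "((\<lambda>x. jacobi_weight (b - 1/2) (a - 1/2) (- x) * (y (- (- x)))\<^sup>2) has_integral N) {- 1..- (- 1)}"
          unfolding jacobi_weight_minus minus_minus by (rule N)
      qed
      have "jacobi_weight a b x * (y x)\<^sup>2 \<le> D' * N"
        using R.bernstein_right[OF N' k(1,3) kl, of "- x"] x False
        by (simp add: D'_def mult_ac jacobi_weight_minus)
      also have "\<dots> \<le> (D b + D') * N" using D0 N0 by (intro mult_right_mono) auto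
      finally show ?thesis .
    qed
  qed
qed

section \<open>Jacobi polynomials\<close>

text \<open>The derivatives of the function in the Rodrigues formula, where \<open>p = \<alpha> + n\<close> and \<open>q = \<beta> + n\<close>.\<close>

definition rodrigues_deriv :: "real \<Rightarrow> real \<Rightarrow> nat \<Rightarrow> real \<Rightarrow> real" where
  "rodrigues_deriv p q k = (deriv ^^ k) (\<lambda>y. (1 - y) powr p * (1 + y) powr q)"

lemma rodrigues_deriv_form:
  "\<exists>r. \<forall>x\<in>{-1<..<1}. rodrigues_deriv p q k x = jacobi_weight (p - real k) (q - real k) x * poly r x"
  using deriv_iter_powr_mult[of k p q] unfolding rodrigues_deriv_def jacobi_weight_def .

lemma rodrigues_deriv_deriv:
  assumes x: "x \<in> {-1<..<1}"
  shows "(rodrigues_deriv p q k has_real_derivative rodrigues_deriv p q (Suc k) x) (at x)"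
proof -
  obtain r where r: "\<And>x. x \<in> {-1<..<1} \<Longrightarrow> rodrigues_deriv p q k x = jacobi_weight (p - real k) (q - real k) x * poly r x"
    using rodrigues_deriv_form[of p q k] by blast
  obtain D where "((\<lambda>x. jacobi_weight (p - real k) (q - real k) x * poly r x) has_real_derivative D) (at x)"
    using DERIV_mult[OF jacobi_weight_deriv[OF x] poly_DERIV] by blast
  then have "(rodrigues_deriv p q k has_real_derivative D) (at x)"
    by (rule has_field_derivative_transform_within_open[of _ _ _ "{-1<..<1}"]) (use x r in auto)
  moreover from this have "D = rodrigues_deriv p q (Suc k) x"
    by (simp add: rodrigues_deriv_def DERIV_imp_deriv)
  ultimately show ?thesis by simp
qed

lemma deriv_eq_0_if_vanishes:
  fixes f :: "real \<Rightarrow> real"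
  assumes "x \<in> {-1<..<1}" "\<And>x. x \<in> {-1<..<1} \<Longrightarrow> f x = 0" "(f has_real_derivative D) (at x)"
  shows "D = 0"
proof -
  have "((\<lambda>_. 0) has_real_derivative D) (at x)"
    by (rule has_field_derivative_transform_within_open[OF assms(3), of "{-1<..<1}"]) (use assms in auto)
  then show ?thesis using DERIV_const DERIV_unique by blast
qed

text \<open>The function itself satisfies \<open>(1 - x\<^sup>2) u' + (p (1 + x) - q (1 - x)) u = 0\<close>.  One differentiation gives the case
\<open>k = 0\<close>, and each further differentiation preserves the shape of the equation.\<close>

lemma rodrigues_deriv_ode:
  assumes "x \<in> {-1<..<1}"
  shows "(1 - x\<^sup>2) * rodrigues_deriv p q (Suc (Suc k)) x
     + ((p - q) + (p + q - 2 - 2 * real k) * x) * rodrigues_deriv p q (Suc k) x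
     + (real k + 1) * (p + q - real k) * rodrigues_deriv p q k x = 0"
  using assms
proof (induction k arbitrary: x)
  case 0
  let ?u = "rodrigues_deriv p q"
  have u0: "?u 0 = jacobi_weight p q" by (simp add: rodrigues_deriv_def jacobi_weight_def[abs_def])
  have first: "(1 - x\<^sup>2) * ?u (Suc 0) x + (p * (1 + x) - q * (1 - x)) * ?u 0 x = 0" if x: "x \<in> {-1<..<1}" for x
  proof -
    have "?u (Suc 0) x = - jacobi_weight p q x * (p * (1 + x) - q * (1 - x)) / (1 - x\<^sup>2)"
      using DERIV_unique[OF rodrigues_deriv_deriv[OF x, of p q 0]] jacobi_weight_deriv[OF x, of p q] unfolding u0 by blast
    moreover have "1 - x\<^sup>2 \<noteq> 0" using x by (simp add: power2_eq_1_iff)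
    ultimately show ?thesis by (simp add: u0)
  qed
  have "((\<lambda>x. (1 - x\<^sup>2) * ?u (Suc 0) x + (p * (1 + x) - q * (1 - x)) * ?u 0 x) has_real_derivative
     (- (2 * x) * ?u (Suc 0) x + ?u (Suc (Suc 0)) x * (1 - x\<^sup>2))
      + ((p + q) * ?u 0 x + ?u (Suc 0) x * (p * (1 + x) - q * (1 - x)))) (at x)"
    by (intro DERIV_add DERIV_mult rodrigues_deriv_deriv 0) (auto intro!: derivative_eq_intros)
  from deriv_eq_0_if_vanishes[OF 0 first this] show ?case by (simp add: algebra_simps)
next
  case (Suc k)
  let ?u = "rodrigues_deriv p q"
  let ?A = "p - q" and ?B = "p + q - 2 - 2 * real k" and ?C = "(real k + 1) * (p + q - real k)"
  have "((\<lambda>x. (1 - x\<^sup>2) * ?u (Suc (Suc k)) x + (?A + ?B * x) * ?u (Suc k) x + ?C * ?u k x) has_real_derivative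
     (- (2 * x) * ?u (Suc (Suc k)) x + ?u (Suc (Suc (Suc k))) x * (1 - x\<^sup>2))
      + (?B * ?u (Suc k) x + ?u (Suc (Suc k)) x * (?A + ?B * x)) + ?C * ?u (Suc k) x) (at x)"
    by (intro DERIV_add DERIV_mult DERIV_cmult rodrigues_deriv_deriv Suc.prems) (auto intro!: derivative_eq_intros)
  from deriv_eq_0_if_vanishes[OF Suc.prems Suc.IH this] show ?case by (simp add: algebra_simps)
qed

lemma jacobi_poly_eq_rodrigues_deriv:
  assumes "x \<in> {-1<..<1}"
  shows "jacobi_weight \<alpha> \<beta> x * poly (jacobi_poly \<alpha> \<beta> n) x =
    (-1) ^ n / (2 ^ n * fact n) * rodrigues_deriv (\<alpha> + real n) (\<beta> + real n) n x"
  using jacobi_poly_rodrigues[OF assms, of \<alpha> \<beta> n] by (simp add: rodrigues_def rodrigues_deriv_def jacobi_weight_def)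

text \<open>Let \<open>v = W P\<close> be the multiple of the \<open>n\<close>-th Rodrigues derivative.  Then \<open>(1 - x\<^sup>2) v' = W g\<close> with
\<open>g = (1 - x\<^sup>2) P' + e P\<close>, and inserting this into the equation for \<open>v\<close> leaves
\<open>g' = - (n + 1) (\<alpha> + \<beta> + n) P\<close>, which is the equation for \<open>P\<close>.\<close>

lemma jacobi_poly_ode:
  assumes x: "x \<in> {-1<..<1}"
  shows "(1 - x\<^sup>2) * poly (pderiv (pderiv (jacobi_poly \<alpha> \<beta> n))) x
    = (\<alpha> - \<beta> + (\<alpha> + \<beta> + 2) * x) * poly (pderiv (jacobi_poly \<alpha> \<beta> n)) x
      - real n * (real n + \<alpha> + \<beta> + 1) * poly (jacobi_poly \<alpha> \<beta> n) x"
proof -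
  let ?P = "poly (jacobi_poly \<alpha> \<beta> n)" and ?P' = "poly (pderiv (jacobi_poly \<alpha> \<beta> n))"
    and ?P'' = "poly (pderiv (pderiv (jacobi_poly \<alpha> \<beta> n)))"
  let ?W = "jacobi_weight \<alpha> \<beta>"
  define c :: real where "c = (-1) ^ n / (2 ^ n * fact n)"
  define v where "v k x = c * rodrigues_deriv (\<alpha> + real n) (\<beta> + real n) (n + k) x" for k x
  define e where "e x = \<beta> * (1 - x) - \<alpha> * (1 + x)" for x
  define g where "g x = (1 - x\<^sup>2) * ?P' x + e x * ?P x" for x
  have v: "(v k has_real_derivative v (Suc k) x) (at x)" if "x \<in> {-1<..<1}" for k x
    unfolding v_def using DERIV_cmult[OF rodrigues_deriv_deriv[OF that]] by simp
  have v0: "v 0 x = ?W x * ?P x" if "x \<in> {-1<..<1}" for x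
    using jacobi_poly_eq_rodrigues_deriv[OF that] by (simp add: v_def c_def)
  have s: "1 - x\<^sup>2 \<noteq> 0" if "x \<in> {-1<..<1}" for x :: real using that by (simp add: power2_eq_1_iff)
  have W: "(?W has_real_derivative ?W x * e x / (1 - x\<^sup>2)) (at x)" if "x \<in> {-1<..<1}" for x
    using jacobi_weight_deriv[OF that, of \<alpha> \<beta>] by (simp add: e_def minus_mult_right)
  have v1: "(1 - x\<^sup>2) * v 1 x - ?W x * g x = 0" if x: "x \<in> {-1<..<1}" for x
  proof -
    have "((\<lambda>x. v 0 x - ?W x * ?P x) has_real_derivative v 1 x - (?W x * e x / (1 - x\<^sup>2) * ?P x + ?P' x * ?W x)) (at x)"
      using v[OF x, of 0] by (intro DERIV_diff DERIV_mult W x poly_DERIV) simp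
    from deriv_eq_0_if_vanishes[OF x _ this] v0
    have "v 1 x = ?W x * e x / (1 - x\<^sup>2) * ?P x + ?P' x * ?W x" by simp
    then show ?thesis using s[OF x] by (simp add: g_def field_simps)
  qed
  define g' where "g' = (- (2 * x) * ?P' x + ?P'' x * (1 - x\<^sup>2)) + (- (\<alpha> + \<beta>) * ?P x + ?P' x * e x)"
  have g: "(g has_real_derivative g') (at x)"
    unfolding g_def g'_def e_def by (intro DERIV_add DERIV_mult poly_DERIV) (auto intro!: derivative_eq_intros)
  have "((\<lambda>x. (1 - x\<^sup>2) * v 1 x - ?W x * g x) has_real_derivative
      (- (2 * x) * v 1 x + v 2 x * (1 - x\<^sup>2)) - (?W x * e x / (1 - x\<^sup>2) * g x + g' * ?W x)) (at x)"
    using v[OF x, of 1]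
    by (intro DERIV_diff DERIV_mult g W x) (auto intro!: derivative_eq_intros simp: numeral_2_eq_2)
  from deriv_eq_0_if_vanishes[OF x v1 this]
  have 1: "(1 - x\<^sup>2) * v 2 x = 2 * x * v 1 x + ?W x * e x / (1 - x\<^sup>2) * g x + g' * ?W x" by (simp add: algebra_simps)
  have "?W x * g x = (1 - x\<^sup>2) * v 1 x" using v1[OF x] by simp
  then have "?W x * e x / (1 - x\<^sup>2) * g x = e x * ((1 - x\<^sup>2) * v 1 x) / (1 - x\<^sup>2)" by (simp add: mult_ac)
  then have 2: "?W x * e x / (1 - x\<^sup>2) * g x = e x * v 1 x" using s[OF x] by simp
  have "c * 0 = (1 - x\<^sup>2) * v 2 x + ((\<alpha> - \<beta>) + (\<alpha> + \<beta> - 2) * x) * v 1 x + (real n + 1) * (\<alpha> + \<beta> + real n) * v 0 x"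
    unfolding rodrigues_deriv_ode[OF x, of "\<alpha> + real n" "\<beta> + real n" n, symmetric] v_def
    by (simp add: algebra_simps)
  then have "g' * ?W x = - ((real n + 1) * (\<alpha> + \<beta> + real n)) * ?P x * ?W x"
    unfolding 1 2 v0[OF x] by (simp add: e_def algebra_simps)
  moreover have "?W x \<noteq> 0" using jacobi_weight_pos[OF x, of \<alpha> \<beta>] by simp
  ultimately have "g' = - ((real n + 1) * (\<alpha> + \<beta> + real n)) * ?P x"
    using mult_right_cancel by blast
  then show ?thesis unfolding g'_def e_def by (simp add: algebra_simps)
qed

text \<open>If \<open>k\<close> is the degree, the coefficients of \<open>x\<^sup>k\<close> in the differential equation give
\<open>k (k + \<alpha> + \<beta> + 1) = n (n + \<alpha> + \<beta> + 1)\<close>, which is impossible for \<open>k > n\<close>.\<close>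

lemma degree_jacobi_poly_le:
  assumes s: "- 1 \<le> \<alpha> + \<beta>"
  shows "degree (jacobi_poly \<alpha> \<beta> n) \<le> n"
proof (rule ccontr)
  define P where "P = jacobi_poly \<alpha> \<beta> n"
  define k where "k = degree P"
  define c where "c = coeff P k"
  assume "\<not> degree (jacobi_poly \<alpha> \<beta> n) \<le> n"
  then have k: "n < k" by (simp add: k_def P_def)
  then have c: "c \<noteq> 0" unfolding c_def k_def by (metis degree_0 leading_coeff_neq_0 not_less_zero)
  define R where "R = pderiv (pderiv P) - monom 1 2 * pderiv (pderiv P) - smult (\<alpha> - \<beta>) (pderiv P)
      - smult (\<alpha> + \<beta> + 2) (monom 1 1 * pderiv P) + smult (real n * (real n + \<alpha> + \<beta> + 1)) P"
  have "poly R x = 0" if "x \<in> {-1<..<1}" for x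
    using jacobi_poly_ode[OF that, of \<alpha> \<beta> n] unfolding R_def P_def[symmetric] by (simp add: poly_monom algebra_simps)
  then have "{-1<..<1} \<subseteq> {x. poly R x = 0}" by blast
  moreover have "infinite {-1<..<1::real}" by simp
  ultimately have "infinite {x. poly R x = 0}" using finite_subset by blast
  then have "R = 0" using poly_roots_finite[of R] by auto
  then have "coeff R k = 0" by simp
  moreover have "coeff (pderiv P) k = 0" "coeff (pderiv (pderiv P)) k = 0"
    by (simp_all add: coeff_pderiv k_def coeff_eq_0)
  moreover have "coeff (monom 1 1 * pderiv P) k = real k * c"
    using k by (simp add: coeff_monom_mult coeff_pderiv c_def)
  moreover have "coeff (monom 1 2 * pderiv (pderiv P)) k = real k * (real k - 1) * c"
  proof (cases "2 \<le> k")
    case True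
    then obtain j where "k = Suc (Suc j)" by (metis add_2_eq_Suc le_Suc_ex)
    then show ?thesis by (simp add: coeff_monom_mult coeff_pderiv c_def numeral_2_eq_2)
  next
    case False
    then show ?thesis using k by (simp add: coeff_monom_mult)
  qed
  ultimately have "(real n * (real n + \<alpha> + \<beta> + 1) - real k * (real k + \<alpha> + \<beta> + 1)) * c = 0"
    by (simp add: R_def c_def[symmetric] algebra_simps)
  then have "real n * (real n + \<alpha> + \<beta> + 1) - real k * (real k + \<alpha> + \<beta> + 1) = 0"
    using c mult_eq_0_iff by blast
  then have "real n * (real n + (\<alpha> + \<beta> + 1)) = real k * (real k + (\<alpha> + \<beta> + 1))" by (simp add: algebra_simps)
  moreover have "real n * (real n + (\<alpha> + \<beta> + 1)) < real k * (real k + (\<alpha> + \<beta> + 1))"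
    using k s by (intro mult_strict_mono') auto
  ultimately show False by simp
qed

text \<open>Integration by parts moves a derivative to \<open>f\<close>.  The boundary terms vanish because the exponents of the
lower derivatives are positive.\<close>

lemma rodrigues_deriv_orthogonal:
  assumes "real k - 1 < p" "real k - 1 < q" "degree f < k \<or> f = 0"
  shows "((\<lambda>x. poly f x * rodrigues_deriv p q k x) has_integral 0) {-1..1}"
  using assms
proof (induction k arbitrary: f)
  case 0
  then have "f = 0" by simp
  then show ?case by simp
next
  case (Suc k)
  let ?u = "rodrigues_deriv p q"
  obtain r where r: "\<And>x. x \<in> {-1<..<1} \<Longrightarrow> ?u k x = jacobi_weight (p - real k) (q - real k) x * poly r x"
    using rodrigues_deriv_form[of p q k] by blast
  define F where "F x = poly f x * (jacobi_weight (p - real k) (q - real k) x * poly r x)" for x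
  have "((\<lambda>x. poly (pderiv f) x * ?u k x + ?u (Suc k) x * poly f x) has_integral (F 1 - F (- 1))) {-1..1}"
  proof (rule fundamental_theorem_of_calculus_interior)
    have "continuous_on {-1..1} (\<lambda>x::real. (1 - x) powr (p - real k))" "continuous_on {-1..1} (\<lambda>x::real. (1 + x) powr (q - real k))"
      by (rule continuous_on_powr'; use Suc.prems in \<open>auto intro!: continuous_intros\<close>)+
    then show "continuous_on {-1..1} F"
      unfolding F_def jacobi_weight_def by (intro continuous_on_mult continuous_on_poly continuous_on_id)
    fix x :: real assume x: "x \<in> {-1<..<1}"
    have "((\<lambda>x. poly f x * ?u k x) has_real_derivative poly (pderiv f) x * ?u k x + ?u (Suc k) x * poly f x) (at x)"
      by (intro DERIV_mult poly_DERIV rodrigues_deriv_deriv x)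
    then have "(F has_real_derivative poly (pderiv f) x * ?u k x + ?u (Suc k) x * poly f x) (at x)"
      by (rule has_field_derivative_transform_within_open[of _ _ _ "{-1<..<1}"]) (use x r in \<open>auto simp: F_def\<close>)
    then show "(F has_vector_derivative poly (pderiv f) x * ?u k x + ?u (Suc k) x * poly f x) (at x)"
      by (simp add: has_real_derivative_iff_has_vector_derivative)
  qed simp
  moreover have "F 1 = 0" "F (- 1) = 0" by (simp_all add: F_def jacobi_weight_def)
  moreover have "((\<lambda>x. poly (pderiv f) x * ?u k x) has_integral 0) {-1..1}"
  proof (rule Suc.IH)
    show "degree (pderiv f) < k \<or> pderiv f = 0"
      using Suc.prems(3) by (auto simp: degree_pderiv pderiv_eq_0_iff)
  qed (use Suc.prems in auto)
  ultimately have "((\<lambda>x. (poly (pderiv f) x * ?u k x + ?u (Suc k) x * poly f x) - poly (pderiv f) x * ?u k x) has_integral 0 - 0) {-1..1}"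
    by (intro has_integral_diff) auto
  then show ?case by (simp add: mult.commute)
qed

lemma jacobi_poly_orthogonal:
  assumes "- 1 < \<alpha>" "- 1 < \<beta>" "degree f < n"
  shows "((\<lambda>x. jacobi_weight \<alpha> \<beta> x * (poly f x * poly (jacobi_poly \<alpha> \<beta> n) x)) has_integral 0) {-1..1}"
proof -
  define c :: real where "c = (-1) ^ n / (2 ^ n * fact n)"
  have "((\<lambda>x. c * (poly f x * rodrigues_deriv (\<alpha> + real n) (\<beta> + real n) n x)) has_integral c * 0) {-1..1}"
    by (intro has_integral_mult_right rodrigues_deriv_orthogonal) (use assms in auto)
  then have "((\<lambda>x. c * (poly f x * rodrigues_deriv (\<alpha> + real n) (\<beta> + real n) n x)) has_integral 0) {-1..1}"
    by simp
  then show ?thesis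
  proof (rule has_integral_spike[of "{-1, 1}", rotated -1])
    fix x :: real assume "x \<in> {-1..1} - {-1, 1}"
    then have "x \<in> {-1<..<1}" by auto
    from jacobi_poly_eq_rodrigues_deriv[OF this, of \<alpha> \<beta> n]
    show "jacobi_weight \<alpha> \<beta> x * (poly f x * poly (jacobi_poly \<alpha> \<beta> n) x) = c * (poly f x * rodrigues_deriv (\<alpha> + real n) (\<beta> + real n) n x)"
      by (simp add: c_def mult_ac)
  qed simp
qed

lemma jacobi_poly_equation:
  assumes "- 1/2 \<le> \<alpha>" "- 1/2 \<le> \<beta>" "1 \<le> n"
  shows "jacobi_equation (\<alpha> + 1/2) (\<beta> + 1/2) (real n * (real n + \<alpha> + \<beta> + 1))
     (poly (jacobi_poly \<alpha> \<beta> n)) (poly (pderiv (jacobi_poly \<alpha> \<beta> n))) (poly (pderiv (pderiv (jacobi_poly \<alpha> \<beta> n))))"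
proof
  show "0 < real n * (real n + \<alpha> + \<beta> + 1)" using assms by (intro mult_pos_pos) auto
  fix x :: real assume "x \<in> {-1<..<1}"
  from jacobi_poly_ode[OF this, of \<alpha> \<beta> n]
  show "(1 - x\<^sup>2) * poly (pderiv (pderiv (jacobi_poly \<alpha> \<beta> n))) x =
     ((\<alpha> + 1/2) * (1 + x) - (\<beta> + 1/2) * (1 - x) + x) * poly (pderiv (jacobi_poly \<alpha> \<beta> n)) x
     - real n * (real n + \<alpha> + \<beta> + 1) * poly (jacobi_poly \<alpha> \<beta> n) x"
  proof -
    have "(\<alpha> + 1/2) * (1 + x) - (\<beta> + 1/2) * (1 - x) + x = \<alpha> - \<beta> + (\<alpha> + \<beta> + 2) * x"
      by (simp add: field_simps)
    then show ?thesis using jacobi_poly_ode[OF \<open>x \<in> {-1<..<1}\<close>, of \<alpha> \<beta> n] by simp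
  qed
qed (use assms poly_DERIV in auto)

section \<open>The heat kernel\<close>

text \<open>A way to pass from gauge integrals, for which the fundamental theorem is available with end point
singularities, to the Lebesgue integrals in the definitions.\<close>

lemma set_integrable_lborel_of_bound:
  fixes f :: "real \<Rightarrow> 'a :: euclidean_space" and g :: "real \<Rightarrow> real"
  assumes f: "f \<in> borel_measurable borel" and g: "g integrable_on S" and S: "S \<in> sets borel"
    and le: "\<And>x. x \<in> S \<Longrightarrow> norm (f x) \<le> g x"
  shows "set_integrable lborel S f"
proof -
  have "f absolutely_integrable_on S"
  proof (rule measurable_bounded_by_integrable_imp_absolutely_integrable[OF _ _ g])
    show "f \<in> borel_measurable (lebesgue_on S)"
      using f by (intro measurable_restrict_space1 measurable_completion) simp
  qed (use S le in auto)
  then have "integrable lebesgue (\<lambda>x. indicator S x *\<^sub>R f x)"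
    by (simp add: set_integrable_def)
  moreover have "(\<lambda>x. indicator S x *\<^sub>R f x) \<in> borel_measurable lborel"
    using f S by simp
  ultimately show ?thesis
    unfolding set_integrable_def by (simp add: integrable_completion)
qed

lemma has_integral_cos_substitution:
  fixes h :: "real \<Rightarrow> real"
  assumes h: "continuous_on {-1..1} h"
  shows "((\<lambda>x. h x / sqrt (1 - x\<^sup>2)) has_integral integral {0..pi} (\<lambda>\<theta>. h (cos \<theta>))) {-1..1}"
proof -
  define H where "H \<theta> = integral {0..\<theta>} (\<lambda>s. h (cos s))" for \<theta>
  have c: "continuous_on {0..pi} (\<lambda>s. h (cos s))"
    by (rule continuous_on_compose2[OF h]) (auto intro!: continuous_intros)
  have H: "(H has_real_derivative h (cos \<theta>)) (at \<theta> within {0..pi})" if "\<theta> \<in> {0..pi}" for \<theta>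
    unfolding H_def using that by (intro integral_has_real_derivative[OF c])
  have "((\<lambda>x. h x / sqrt (1 - x\<^sup>2)) has_integral (- H (arccos 1) - - H (arccos (- 1)))) {-1..1}"
  proof (rule fundamental_theorem_of_calculus_interior)
    have "continuous_on {0..pi} H" using H by (rule DERIV_continuous_on)
    then have "continuous_on {-1..1} (\<lambda>x. H (arccos x))"
      by (rule continuous_on_compose2) (auto intro!: continuous_on_arccos' arccos_lbound arccos_ubound)
    then show "continuous_on {-1..1} (\<lambda>x. - H (arccos x))" by (intro continuous_intros)
    fix x :: real assume x: "x \<in> {-1<..<1}"
    have t: "0 < arccos x" "arccos x < pi" using arccos_lt_bounded[of x] x by auto
    have "(H has_real_derivative h (cos (arccos x))) (at (arccos x))"
      using H[of "arccos x"] t at_within_Icc_at[of 0 "arccos x" pi] by auto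
    then have "(H has_real_derivative h x) (at (arccos x))" using x by simp
    then have "((\<lambda>x. - H (arccos x)) has_real_derivative - (h x * inverse (- sqrt (1 - x\<^sup>2)))) (at x)"
      using x by (intro DERIV_minus DERIV_chain2[of H] DERIV_arccos) auto
    then show "((\<lambda>x. - H (arccos x)) has_vector_derivative h x / sqrt (1 - x\<^sup>2)) (at x)"
      by (simp add: has_real_derivative_iff_has_vector_derivative divide_inverse)
  qed simp
  moreover have "H 0 = 0" by (simp add: H_def)
  ultimately show ?thesis by (simp add: H_def)
qed

lemma borel_measurable_jacobi_weight [measurable]: "jacobi_weight a b \<in> borel_measurable borel"
  unfolding jacobi_weight_def[abs_def] by measurable

lemma integral_jacobi_measure:
  fixes f :: "real \<Rightarrow> real"
  assumes f [measurable]: "f \<in> borel_measurable borel"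
  shows "(LINT x|jacobi_measure \<alpha> \<beta>. f x) = (LINT x:{-1..1}|lborel. jacobi_weight \<alpha> \<beta> x * f x)"
proof -
  let ?M = "restrict_space lborel {-1..1::real}"
  have "(LINT x|jacobi_measure \<alpha> \<beta>. f x) = (LINT x|?M. jacobi_weight \<alpha> \<beta> x *\<^sub>R f x)"
    unfolding jacobi_measure_def jacobi_weight_def[symmetric]
    by (rule integral_density) (auto simp: jacobi_weight_nonneg intro!: measurable_restrict_space1)
  also have "\<dots> = (LINT x:{-1..1}|lborel. jacobi_weight \<alpha> \<beta> x * f x)"
    unfolding set_lebesgue_integral_def by (subst integral_restrict_space) auto
  finally show ?thesis .
qed

text \<open>At the end points both sides are 0, since \<open>0 powr \<alpha>\<close> and \<open>1 / 0\<close> are 0.\<close>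

lemma jacobi_weight_half_shift:
  assumes x: "x \<in> {-1..1}"
  shows "jacobi_weight \<alpha> \<beta> x = jacobi_weight (\<alpha> + 1/2) (\<beta> + 1/2) x * (1 / sqrt (1 - x\<^sup>2))"
proof (cases "x \<in> {-1<..<1}")
  case True
  have s: "1 - x\<^sup>2 = (1 - x) * (1 + x)" by (simp add: power2_eq_square algebra_simps)
  have "(1 - x) powr (\<alpha> + 1/2) = (1 - x) powr \<alpha> * sqrt (1 - x)" "(1 + x) powr (\<beta> + 1/2) = (1 + x) powr \<beta> * sqrt (1 + x)"
    using True by (simp_all add: powr_add powr_half_sqrt)
  then show ?thesis using True by (simp add: jacobi_weight_def s real_sqrt_mult)
next
  case False
  then have "x = 1 \<or> x = -1" using x by auto
  then show ?thesis by (auto simp: jacobi_weight_def)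
qed

lemma jacobi_weight_le_const:
  assumes "0 \<le> a" "0 \<le> b" "x \<in> {-1..1}"
  shows "jacobi_weight a b x \<le> 2 powr (a + b)"
proof -
  have "jacobi_weight a b x \<le> 2 powr a * 2 powr b"
    unfolding jacobi_weight_def using assms by (intro mult_mono powr_mono2) auto
  then show ?thesis by (simp add: powr_add)
qed

lemma set_integrable_jacobi_weight:
  assumes ab: "- 1/2 \<le> \<alpha>" "- 1/2 \<le> \<beta>" and f: "continuous_on UNIV f"
  shows "set_integrable lborel {-1..1} (\<lambda>x. jacobi_weight \<alpha> \<beta> x * f x)"
proof (rule set_integrable_lborel_of_bound)
  have c: "continuous_on {-1..1} f" using f by (rule continuous_on_subset) simp
  have [measurable]: "f \<in> borel_measurable borel" using f by (rule borel_measurable_continuous_onI)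
  show "(\<lambda>x. jacobi_weight \<alpha> \<beta> x * f x) \<in> borel_measurable borel" by measurable
  have "((\<lambda>x. (2 powr (\<alpha> + 1/2 + (\<beta> + 1/2)) * \<bar>f x\<bar>) / sqrt (1 - x\<^sup>2)) has_integral
     integral {0..pi} (\<lambda>\<theta>. 2 powr (\<alpha> + 1/2 + (\<beta> + 1/2)) * \<bar>f (cos \<theta>)\<bar>)) {-1..1}"
    by (rule has_integral_cos_substitution) (intro continuous_intros c)
  then show "(\<lambda>x. (2 powr (\<alpha> + 1/2 + (\<beta> + 1/2)) * \<bar>f x\<bar>) / sqrt (1 - x\<^sup>2)) integrable_on {-1..1}"
    by (rule has_integral_integrable)
  fix x :: real assume x: "x \<in> {-1..1}"
  have s: "0 \<le> 1 - x\<^sup>2" using x by (simp add: abs_square_le_1 abs_le_iff)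
  have "\<bar>jacobi_weight \<alpha> \<beta> x * f x\<bar> = jacobi_weight (\<alpha> + 1/2) (\<beta> + 1/2) x * (\<bar>f x\<bar> / sqrt (1 - x\<^sup>2))"
    unfolding jacobi_weight_half_shift[OF x, of \<alpha> \<beta>] using s by (simp add: abs_mult jacobi_weight_nonneg)
  also have "\<dots> \<le> 2 powr (\<alpha> + 1/2 + (\<beta> + 1/2)) * (\<bar>f x\<bar> / sqrt (1 - x\<^sup>2))"
    using ab x s by (intro mult_right_mono jacobi_weight_le_const) auto
  finally show "norm (jacobi_weight \<alpha> \<beta> x * f x) \<le> (2 powr (\<alpha> + 1/2 + (\<beta> + 1/2)) * \<bar>f x\<bar>) / sqrt (1 - x\<^sup>2)"
    by simp
qed simp

lemma has_integral_jacobi_measure: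
  assumes ab: "- 1/2 \<le> \<alpha>" "- 1/2 \<le> \<beta>" and f: "continuous_on UNIV f"
  shows "((\<lambda>x. jacobi_weight \<alpha> \<beta> x * f x) has_integral (LINT x|jacobi_measure \<alpha> \<beta>. f x)) {-1..1}"
proof -
  have m: "f \<in> borel_measurable borel" using f by (rule borel_measurable_continuous_onI)
  show ?thesis
    unfolding integral_jacobi_measure[OF m]
    using set_borel_integral_eq_integral[OF set_integrable_jacobi_weight[OF ab f]] by (simp add: has_integral_integrable_integral)
qed

lemma continuous_jacobi_normalized: "continuous_on S (jacobi_normalized \<alpha> \<beta> n)"
  unfolding jacobi_normalized_def[abs_def] divide_inverse by (intro continuous_intros)

text \<open>The general bound applies when the eigenvalue \<open>n (n + \<alpha> + \<beta> + 1)\<close> is large.  The finitely many remaining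
functions are polynomials, hence bounded on \<open>{-1..1}\<close>.\<close>

lemma jacobi_normalized_bound:
  assumes ab: "- 1/2 \<le> \<alpha>" "- 1/2 \<le> \<beta>"
  obtains B where "0 \<le> B"
    "\<And>n x. x \<in> {-1<..<1} \<Longrightarrow> jacobi_weight (\<alpha> + 1/2) (\<beta> + 1/2) x * (jacobi_normalized \<alpha> \<beta> n x)\<^sup>2 \<le> B"
proof -
  let ?w = "jacobi_weight (\<alpha> + 1/2) (\<beta> + 1/2)"
  let ?P = "\<lambda>n. poly (jacobi_poly \<alpha> \<beta> n)"
  define N where "N n = (LINT y|jacobi_measure \<alpha> \<beta>. (?P n y)\<^sup>2)" for n
  have N: "((\<lambda>x. jacobi_weight \<alpha> \<beta> x * (?P n x)\<^sup>2) has_integral N n) {-1..1}" for n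
    unfolding N_def by (intro has_integral_jacobi_measure ab continuous_intros)
  have N0: "0 \<le> N n" for n unfolding N_def by (rule integral_nonneg_AE) simp
  have p: "(jacobi_normalized \<alpha> \<beta> n x)\<^sup>2 = (?P n x)\<^sup>2 / N n" for n x
    using N0[of n] by (simp add: jacobi_normalized_def N_def[symmetric] power_divide)
  have ab': "0 \<le> \<alpha> + 1/2" "0 \<le> \<beta> + 1/2" using ab by auto
  obtain B \<Lambda> where B: "0 < \<Lambda>" "0 \<le> B" and
    bern: "\<And>lam y y1 y2 N x. jacobi_equation (\<alpha> + 1/2) (\<beta> + 1/2) lam y y1 y2 \<Longrightarrow> \<Lambda> \<le> lam \<Longrightarrow>
      ((\<lambda>x. jacobi_weight (\<alpha> + 1/2 - 1/2) (\<beta> + 1/2 - 1/2) x * (y x)\<^sup>2) has_integral N) {-1..1} \<Longrightarrow>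
      x \<in> {-1<..<1} \<Longrightarrow> ?w x * (y x)\<^sup>2 \<le> B * N"
    by (rule bernstein_bound[OF ab'], rule that)
  obtain n0 :: nat where n0: "\<Lambda> \<le> real n0" "1 \<le> n0"
    using real_arch_simple[of "max \<Lambda> 1"] by force
  have large: "?w x * (jacobi_normalized \<alpha> \<beta> n x)\<^sup>2 \<le> B" if n: "n0 \<le> n" and x: "x \<in> {-1<..<1}" for n x
  proof -
    have n1: "1 \<le> n" using n n0 by simp
    have "\<Lambda> \<le> real n * 1" using n n0 by simp
    also have "\<dots> \<le> real n * (real n + \<alpha> + \<beta> + 1)" using ab n1 by (intro mult_left_mono) auto
    finally have "\<Lambda> \<le> real n * (real n + \<alpha> + \<beta> + 1)" .
    from bern[OF jacobi_poly_equation[OF ab n1] this _ x, of "N n"] N[of n]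
    have le: "?w x * (?P n x)\<^sup>2 \<le> B * N n" by simp
    \<comment> \<open>for \<open>N n = 0\<close> the normalized function is 0 because \<open>x / 0 = 0\<close>\<close>
    show ?thesis
    proof (cases "N n = 0")
      case True
      then show ?thesis using B by (simp add: p)
    next
      case False
      then show ?thesis using le N0[of n] by (simp add: p field_simps)
    qed
  qed
  have small: "\<exists>C\<ge>0. \<forall>x\<in>{-1<..<1}. ?w x * (jacobi_normalized \<alpha> \<beta> n x)\<^sup>2 \<le> C" for n
  proof -
    have "compact ((\<lambda>x. (jacobi_normalized \<alpha> \<beta> n x)\<^sup>2) ` {-1..1})"
      by (intro compact_continuous_image continuous_intros continuous_jacobi_normalized) simp
    then obtain M where "\<forall>x\<in>{-1..1}. norm ((jacobi_normalized \<alpha> \<beta> n x)\<^sup>2) \<le> M"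
      unfolding bounded_iff using compact_imp_bounded bounded_iff by (metis imageI)
    then have M: "(jacobi_normalized \<alpha> \<beta> n x)\<^sup>2 \<le> M" if "x \<in> {-1..1}" for x
      using that by force
    have "0 \<le> M" using M[of 0] order_trans[OF zero_le_power2] by auto
    moreover have "?w x * (jacobi_normalized \<alpha> \<beta> n x)\<^sup>2 \<le> 2 powr (\<alpha> + 1/2 + (\<beta> + 1/2)) * M" if "x \<in> {-1<..<1}" for x
      using that by (intro mult_mono jacobi_weight_le_const ab' M) auto
    ultimately show ?thesis by (intro exI[of _ "2 powr (\<alpha> + 1/2 + (\<beta> + 1/2)) * M"]) auto
  qed
  then obtain C where C: "\<And>n. 0 \<le> C n" "\<And>n x. x \<in> {-1<..<1} \<Longrightarrow> ?w x * (jacobi_normalized \<alpha> \<beta> n x)\<^sup>2 \<le> C n"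
    by metis
  show ?thesis
  proof (rule that[of "B + (\<Sum>n<n0. C n)"])
    show "0 \<le> B + (\<Sum>n<n0. C n)" using B C by (intro add_nonneg_nonneg sum_nonneg) auto
    fix n and x :: real assume x: "x \<in> {-1<..<1}"
    show "?w x * (jacobi_normalized \<alpha> \<beta> n x)\<^sup>2 \<le> B + (\<Sum>n<n0. C n)"
    proof (cases "n0 \<le> n")
      case True
      have "0 \<le> (\<Sum>n<n0. C n)" using C by (intro sum_nonneg) auto
      then show ?thesis using large[OF True x] by linarith
    next
      case False
      have "C n \<le> (\<Sum>n<n0. C n)" using False C by (intro member_le_sum) auto
      then show ?thesis using C(2)[OF x, of n] B by linarith
    qed
  qed
qed

text \<open>If \<open>m < n\<close>, then \<open>q p\<^sub>m\<close> has degree less than \<open>n\<close>.\<close>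

lemma jacobi_normalized_orthogonal:
  assumes ab: "- 1/2 \<le> \<alpha>" "- 1/2 \<le> \<beta>" and q: "degree q < nat \<bar>int m - int n\<bar>"
  shows "((\<lambda>x. jacobi_weight \<alpha> \<beta> x * (poly q x * jacobi_normalized \<alpha> \<beta> m x * jacobi_normalized \<alpha> \<beta> n x)) has_integral 0) {-1..1}"
proof -
  have less: "((\<lambda>x. jacobi_weight \<alpha> \<beta> x * (poly q x * jacobi_normalized \<alpha> \<beta> m x * jacobi_normalized \<alpha> \<beta> n x)) has_integral 0) {-1..1}"
    if q: "degree q < n - m" for m n
  proof -
    define c where "c k = inverse (sqrt (LINT y|jacobi_measure \<alpha> \<beta>. (poly (jacobi_poly \<alpha> \<beta> k) y)\<^sup>2))" for k
    have p: "jacobi_normalized \<alpha> \<beta> k x = c k * poly (jacobi_poly \<alpha> \<beta> k) x" for k x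
      by (simp add: jacobi_normalized_def c_def divide_inverse)
    have "degree (q * jacobi_poly \<alpha> \<beta> m) \<le> degree q + degree (jacobi_poly \<alpha> \<beta> m)" by (rule degree_mult_le)
    also have "\<dots> \<le> degree q + m" using degree_jacobi_poly_le[of \<alpha> \<beta> m] ab by simp
    also have "\<dots> < n" using q by simp
    finally have "((\<lambda>x. jacobi_weight \<alpha> \<beta> x * (poly (q * jacobi_poly \<alpha> \<beta> m) x * poly (jacobi_poly \<alpha> \<beta> n) x)) has_integral 0) {-1..1}"
      using ab by (intro jacobi_poly_orthogonal) auto
    from has_integral_mult_right[OF this, of "c m * c n"] show ?thesis
      by (simp add: p mult_ac)
  qed
  show ?thesis
  proof (cases "m \<le> n")
    case True
    then show ?thesis using q by (intro less) (auto simp: nat_diff_distrib)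
  next
    case False
    then have "degree q < m - n" using q by auto
    from less[OF this] show ?thesis by (simp add: mult_ac)
  qed
qed

text \<open>Subtracting \<open>q\<close> from the exponential does not change the integral, and \<open>\<bar>p\<^sub>m p\<^sub>n\<bar> d\<mu> \<le> B dx / sqrt (1 - x\<^sup>2)\<close> by the
Bernstein bound.  The case \<open>q = 0\<close> is the one that also covers \<open>m = n\<close>.\<close>

lemma heat_kernel_le_approximation:
  assumes ab: "- 1/2 \<le> \<alpha>" "- 1/2 \<le> \<beta>"
    and B: "\<And>n x. x \<in> {-1<..<1} \<Longrightarrow> jacobi_weight (\<alpha> + 1/2) (\<beta> + 1/2) x * (jacobi_normalized \<alpha> \<beta> n x)\<^sup>2 \<le> B"
    and B0: "0 \<le> B"
    and q: "degree q < nat \<bar>int m - int n\<bar> \<or> q = 0"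
  shows "\<bar>heat_kernel \<alpha> \<beta> t m n\<bar> \<le> B * integral {-pi..pi} (\<lambda>x. \<bar>exp (- (1 - cos x) * t) - poly q (cos x)\<bar>)"
proof -
  let ?p = "jacobi_normalized \<alpha> \<beta>"
  define e where "e x = exp (- (1 - x) * t) - poly q x" for x
  have K: "((\<lambda>x. jacobi_weight \<alpha> \<beta> x * (exp (- (1 - x) * t) * ?p m x * ?p n x)) has_integral heat_kernel \<alpha> \<beta> t m n) {-1..1}"
    unfolding heat_kernel_def by (intro has_integral_jacobi_measure ab continuous_intros continuous_jacobi_normalized)
  have Q: "((\<lambda>x. jacobi_weight \<alpha> \<beta> x * (poly q x * ?p m x * ?p n x)) has_integral 0) {-1..1}"
    using q jacobi_normalized_orthogonal[OF ab, of q m n] by (cases "q = 0") auto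
  have E: "((\<lambda>x. jacobi_weight \<alpha> \<beta> x * (e x * ?p m x * ?p n x)) has_integral heat_kernel \<alpha> \<beta> t m n) {-1..1}"
    using has_integral_diff[OF K Q] by (simp add: e_def algebra_simps)
  have S: "((\<lambda>x. (B * \<bar>e x\<bar>) / sqrt (1 - x\<^sup>2)) has_integral integral {0..pi} (\<lambda>\<theta>. B * \<bar>e (cos \<theta>)\<bar>)) {-1..1}"
    by (rule has_integral_cos_substitution) (unfold e_def, intro continuous_intros)
  have le: "\<bar>jacobi_weight \<alpha> \<beta> x * (e x * ?p m x * ?p n x)\<bar> \<le> (B * \<bar>e x\<bar>) / sqrt (1 - x\<^sup>2)" if x: "x \<in> {-1..1}" for x
  proof (cases "x \<in> {-1<..<1}")
    case True
    let ?w = "jacobi_weight (\<alpha> + 1/2) (\<beta> + 1/2) x"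
    have s: "0 \<le> 1 - x\<^sup>2" using x by (simp add: abs_square_le_1 abs_le_iff)
    have "2 * \<bar>?p m x\<bar> * \<bar>?p n x\<bar> \<le> (?p m x)\<^sup>2 + (?p n x)\<^sup>2"
      using sum_squares_bound[of "\<bar>?p m x\<bar>" "\<bar>?p n x\<bar>"] by simp
    from mult_left_mono[OF this jacobi_weight_nonneg[of "\<alpha> + 1/2" "\<beta> + 1/2" x]]
    have "2 * (?w * (\<bar>?p m x\<bar> * \<bar>?p n x\<bar>)) \<le> ?w * (?p m x)\<^sup>2 + ?w * (?p n x)\<^sup>2"
      by (simp add: distrib_left mult_ac)
    then have pp: "?w * (\<bar>?p m x\<bar> * \<bar>?p n x\<bar>) \<le> B" using B[OF True, of m] B[OF True, of n] by linarith
    have "\<bar>jacobi_weight \<alpha> \<beta> x * (e x * ?p m x * ?p n x)\<bar> = (?w * (\<bar>?p m x\<bar> * \<bar>?p n x\<bar>)) * (\<bar>e x\<bar> / sqrt (1 - x\<^sup>2))"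
      unfolding jacobi_weight_half_shift[OF x, of \<alpha> \<beta>] using s by (simp add: abs_mult jacobi_weight_nonneg mult_ac)
    also have "\<dots> \<le> B * (\<bar>e x\<bar> / sqrt (1 - x\<^sup>2))" using pp s by (intro mult_right_mono) auto
    finally show ?thesis by simp
  next
    case False
    then have "x = 1 \<or> x = -1" using x by auto
    then show ?thesis by (auto simp: jacobi_weight_def)
  qed
  have "\<bar>heat_kernel \<alpha> \<beta> t m n\<bar> \<le> integral {0..pi} (\<lambda>\<theta>. B * \<bar>e (cos \<theta>)\<bar>)"
    using Henstock_Kurzweil_Integration.integral_norm_bound_integral[OF has_integral_integrable[OF E] has_integral_integrable[OF S]] le
    unfolding integral_unique[OF E] integral_unique[OF S] by simp
  also have "\<dots> = B * integral {0..pi} (\<lambda>\<theta>. \<bar>e (cos \<theta>)\<bar>)"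
    by (rule integral_cmult)
  also have "\<dots> \<le> B * integral {-pi..pi} (\<lambda>\<theta>. \<bar>e (cos \<theta>)\<bar>)"
  proof (intro mult_left_mono B0 integral_subset_le)
    have c: "continuous_on T (\<lambda>\<theta>. \<bar>e (cos \<theta>)\<bar>)" for T unfolding e_def by (intro continuous_intros)
    show "(\<lambda>\<theta>. \<bar>e (cos \<theta>)\<bar>) integrable_on {0..pi}" "(\<lambda>\<theta>. \<bar>e (cos \<theta>)\<bar>) integrable_on {-pi..pi}"
      by (intro integrable_continuous_real c)+
    show "{0..pi} \<subseteq> {-pi..pi}" using pi_ge_zero by (auto intro: order_trans[of _ 0])
  qed auto
  finally show ?thesis unfolding e_def .
qed

text \<open>The choice \<open>q = 0\<close> gives a bound of order \<open>1 / r\<close>, which is used for \<open>\<bar>m - n\<bar> \<le> r\<close>; Jackson's theorem with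
\<open>d = \<bar>m - n\<bar>\<close> gives a bound of order \<open>r / (m - n)\<^sup>2\<close>, which is used otherwise.\<close>

lemma heat_kernel_bound:
  assumes ab: "- 1/2 \<le> \<alpha>" "- 1/2 \<le> \<beta>"
  obtains C where "0 < C"
    "\<And>t m n. 0 < t \<Longrightarrow> \<bar>heat_kernel \<alpha> \<beta> t m n\<bar>
       \<le> C * (max 1 (sqrt t) / ((max 1 (sqrt t))\<^sup>2 + (real m - real n)\<^sup>2))"
proof -
  obtain B where B: "0 \<le> B"
    "\<And>n x. x \<in> {-1<..<1} \<Longrightarrow> jacobi_weight (\<alpha> + 1/2) (\<beta> + 1/2) x * (jacobi_normalized \<alpha> \<beta> n x)\<^sup>2 \<le> B"
    using jacobi_normalized_bound[OF ab] by blast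
  note approx = heat_kernel_le_approximation[OF ab B(2) B(1)]
  \<comment> \<open>the constant of \<open>heat_poly_approx\<close>, which exceeds those of the bounds with \<open>q = 0\<close>\<close>
  define M where "M = 48 * pi ^ 3"
  have pi1: "1 \<le> pi" using pi_ge_two by linarith
  have "pi * 1 \<le> pi * pi ^ 2" by (intro mult_left_mono one_le_power pi1) auto
  then have M: "3 * pi \<le> M" "2 * pi \<le> M" "0 \<le> M" by (simp_all add: M_def power3_eq_cube power2_eq_square)
  have main: "\<bar>heat_kernel \<alpha> \<beta> t m n\<bar> \<le> (2 * B * M) * (r / (r\<^sup>2 + (real m - real n)\<^sup>2))"
    if t: "0 < t" and r_def: "r = max 1 (sqrt t)" for t m n r
  proof -
    define \<delta> where "\<delta> = (real m - real n)\<^sup>2"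
    have r: "1 \<le> r" "sqrt t \<le> r" by (auto simp: r_def)
    have near: "\<bar>heat_kernel \<alpha> \<beta> t m n\<bar> \<le> B * (M / r)"
    proof -
      define I where "I = integral {-pi..pi} (\<lambda>x. exp (- (1 - cos x) * t))"
      have "\<bar>heat_kernel \<alpha> \<beta> t m n\<bar> \<le> B * I"
        using approx[of 0 m n t] by (simp add: I_def)
      moreover have "I \<le> M / r"
      proof (cases "sqrt t \<le> 1")
        case True
        have "I \<le> integral {-pi..pi} (\<lambda>x::real. 1)"
          unfolding I_def
          by (intro integral_le integrable_continuous_real continuous_intros) (use t in \<open>auto intro!: mult_nonpos_nonneg\<close>)
        also have "\<dots> = 2 * pi" by simp
        finally show ?thesis using True M by (simp add: r_def)
      next
        case False
        have "I \<le> 3 * pi / sqrt t" unfolding I_def by (rule heat_L1_le[OF t])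
        also have "\<dots> \<le> M / sqrt t" using M t by (intro divide_right_mono) auto
        finally show ?thesis using False by (simp add: r_def)
      qed
      ultimately show ?thesis using mult_left_mono[OF _ B(1)] order_trans by blast
    qed
    have far: "\<bar>heat_kernel \<alpha> \<beta> t m n\<bar> \<le> B * (M * (r / \<delta>))" if mn: "m \<noteq> n"
    proof -
      let ?d = "nat \<bar>int m - int n\<bar>"
      have d: "1 \<le> ?d" using mn by auto
      have d2: "(real ?d)\<^sup>2 = \<delta>"
      proof -
        have "real ?d = \<bar>real m - real n\<bar>" by (simp add: of_nat_nat)
        then show ?thesis by (simp add: \<delta>_def)
      qed
      obtain q where q: "degree q < ?d" "integral {-pi..pi} (\<lambda>x. \<bar>exp (- (1 - cos x) * t) - poly q (cos x)\<bar>)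
         \<le> 48 * pi ^ 3 * (sqrt t / (real ?d)\<^sup>2)"
        using heat_poly_approx[OF less_imp_le[OF t] d] by blast
      have "\<bar>heat_kernel \<alpha> \<beta> t m n\<bar> \<le> B * (48 * pi ^ 3 * (sqrt t / (real ?d)\<^sup>2))"
        using approx[of q m n t] q mult_left_mono[OF q(2) B(1)] by linarith
      also have "\<dots> \<le> B * (M * (r / \<delta>))"
        unfolding M_def d2 using r B by (intro mult_left_mono divide_right_mono) (auto simp: \<delta>_def)
      finally show ?thesis .
    qed
    have r2: "0 < r\<^sup>2 + \<delta>" using r by (intro add_pos_nonneg) (auto simp: \<delta>_def)
    show ?thesis
    proof (cases "\<delta> \<le> r\<^sup>2")
      case True
      have "1 / r = 2 * (r / (r\<^sup>2 + r\<^sup>2))" using r by (simp add: power2_eq_square)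
      also have "\<dots> \<le> 2 * (r / (r\<^sup>2 + \<delta>))" using True r r2 by (intro mult_left_mono divide_left_mono mult_pos_pos) auto
      finally have "B * M * (1 / r) \<le> B * M * (2 * (r / (r\<^sup>2 + \<delta>)))" using B M by (intro mult_left_mono) auto
      then show ?thesis using near by (simp add: \<delta>_def mult_ac)
    next
      case False
      then have dpos: "0 < \<delta>" using zero_le_power2[of r] by linarith
      then have mn: "m \<noteq> n" by (auto simp: \<delta>_def)
      have "r / \<delta> = 2 * (r / (\<delta> + \<delta>))" using dpos by simp
      also have "\<dots> \<le> 2 * (r / (r\<^sup>2 + \<delta>))" using False r r2 dpos by (intro mult_left_mono divide_left_mono mult_pos_pos) auto
      finally have "B * M * (r / \<delta>) \<le> B * M * (2 * (r / (r\<^sup>2 + \<delta>)))" using B M by (intro mult_left_mono) auto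
      then show ?thesis using far[OF mn] by (simp add: \<delta>_def mult_ac)
    qed
  qed
  show ?thesis
  proof (rule that[of "2 * B * M + 1"])
    show "0 < 2 * B * M + 1" using B M by (simp add: add_nonneg_pos)
    fix t :: real and m n :: nat assume t: "0 < t"
    let ?k = "max 1 (sqrt t) / ((max 1 (sqrt t))\<^sup>2 + (real m - real n)\<^sup>2)"
    have "\<bar>heat_kernel \<alpha> \<beta> t m n\<bar> \<le> (2 * B * M) * ?k" by (rule main[OF t refl])
    also have "\<dots> \<le> (2 * B * M + 1) * ?k" by (intro mult_right_mono) auto
    finally show "\<bar>heat_kernel \<alpha> \<beta> t m n\<bar> \<le> (2 * B * M + 1) * ?k" .
  qed
qed

section \<open>The Poisson maximal operator\<close>

lemma right_max_mono:
  assumes "n \<le> N" "N \<le> N'"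
  shows "right_max v N f n \<le> right_max v N' f n"
  unfolding right_max_def using assms by (intro Max_mono) auto

lemma two_sided_max_mono:
  assumes "n \<le> N" "N \<le> N'"
  shows "two_sided_max v N f n \<le> two_sided_max v N' f n"
  unfolding two_sided_max_def using right_max_mono[OF assms, of v f] by simp

text \<open>The supremum is only meaningful where the cut-off maximal functions are bounded.\<close>

definition hl_max :: "(nat \<Rightarrow> real) \<Rightarrow> nat \<Rightarrow> real" where
  "hl_max F n = (SUP i. hl_cut (n + i) F n)"

lemma hl_max_limit:
  assumes bd: "\<And>N. n \<le> N \<Longrightarrow> hl_cut N F n \<le> K"
  shows "(\<lambda>N. hl_cut N F n) \<longlonglongrightarrow> hl_max F n"
    and "n \<le> N \<Longrightarrow> hl_cut N F n \<le> hl_max F n"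
proof -
  let ?X = "\<lambda>i. hl_cut (n + i) F n"
  have bdd: "bdd_above (range ?X)" by (rule bdd_aboveI[of _ K]) (use bd in auto)
  have "incseq ?X" by (intro incseq_SucI two_sided_max_mono) auto
  from LIMSEQ_incseq_SUP[OF bdd this] have "?X \<longlonglongrightarrow> hl_max F n" by (simp add: hl_max_def)
  then have "(\<lambda>i. hl_cut (i + n) F n) \<longlonglongrightarrow> hl_max F n" by (simp add: add.commute)
  then show "(\<lambda>N. hl_cut N F n) \<longlonglongrightarrow> hl_max F n" by (rule LIMSEQ_offset)
  show "hl_cut N F n \<le> hl_max F n" if "n \<le> N" for N
    using cSUP_upper[OF UNIV_I bdd, of "N - n"] that by (simp add: hl_max_def)
qed

lemma borel_measurable_heat_kernel [measurable]: "(\<lambda>t. heat_kernel \<alpha> \<beta> t m n) \<in> borel_measurable borel"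
proof -
  have [measurable]: "jacobi_normalized \<alpha> \<beta> k \<in> borel_measurable borel" for k
    by (rule borel_measurable_continuous_onI[OF continuous_jacobi_normalized])
  have "heat_kernel \<alpha> \<beta> t m n = (LINT x|lborel. indicator {-1..1} x *\<^sub>R
      (jacobi_weight \<alpha> \<beta> x * (exp (- (1 - x) * t) * jacobi_normalized \<alpha> \<beta> m x * jacobi_normalized \<alpha> \<beta> n x)))" for t
    unfolding heat_kernel_def by (subst integral_jacobi_measure) (auto simp: set_lebesgue_integral_def)
  then show ?thesis by simp
qed

text \<open>\<open>Gamma (1/2) = sqrt pi\<close> makes the Poisson operator a mean of heat operators.  At \<open>u = 0\<close> the integrand has the
value 0.\<close>

lemma gamma_half_has_integral: "((\<lambda>u. exp (- u) / sqrt u) has_integral sqrt pi) {0<..}"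
proof -
  have "((\<lambda>t::real. t powr (1/2 - 1) / exp t) has_integral Gamma (1/2)) {0..}"
    by (rule Gamma_integral_real) simp
  then have "((\<lambda>t::real. t powr (1/2 - 1) / exp t) has_integral sqrt pi) {0..}"
    by (simp add: Gamma_one_half_real)
  moreover have "t powr (1/2 - 1) / exp t = (if t \<in> {0<..} then exp (- t) / sqrt t else 0)" if "t \<in> {0..}" for t :: real
    using that by (auto simp: powr_minus_divide powr_half_sqrt exp_minus field_simps)
  ultimately have "((\<lambda>t::real. if t \<in> {0<..} then exp (- t) / sqrt t else 0) has_integral sqrt pi) {0..}"
    by (rule has_integral_eq[rotated])
  then show ?thesis by (subst (asm) has_integral_restrict) auto
qed

lemma heat_op_bound:
  fixes f :: "nat \<Rightarrow> complex"
  defines "F \<equiv> \<lambda>m. cmod (f m)"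
  assumes C: "0 < C"
    "\<And>t m n. 0 < t \<Longrightarrow> \<bar>heat_kernel \<alpha> \<beta> t m n\<bar>
       \<le> C * (max 1 (sqrt t) / ((max 1 (sqrt t))\<^sup>2 + (real m - real n)\<^sup>2))"
    and bd: "\<And>N. n \<le> N \<Longrightarrow> hl_cut N F n \<le> K" and t: "0 < t"
  shows "summable (\<lambda>m. f m * complex_of_real (heat_kernel \<alpha> \<beta> t m n))"
    and "cmod (heat_op \<alpha> \<beta> t f n) \<le> 3 * C * K"
proof -
  let ?g = "\<lambda>m. f m * complex_of_real (heat_kernel \<alpha> \<beta> t m n)"
  define r where "r = max 1 (sqrt t)"
  have r: "1 \<le> r" by (simp add: r_def)
  have part: "(\<Sum>m\<le>N. norm (?g m)) \<le> 3 * C * K" if N: "n \<le> N" for N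
  proof -
    have "(\<Sum>m\<le>N. norm (?g m)) \<le> (\<Sum>m\<le>N. F m * (C * (r / (r\<^sup>2 + (real m - real n)\<^sup>2))))"
    proof (rule sum_mono)
      fix m
      have "norm (?g m) = F m * \<bar>heat_kernel \<alpha> \<beta> t m n\<bar>" by (simp add: norm_mult F_def)
      also have "\<dots> \<le> F m * (C * (r / (r\<^sup>2 + (real m - real n)\<^sup>2)))"
        unfolding r_def F_def by (intro mult_left_mono C(2) t) simp
      finally show "norm (?g m) \<le> F m * (C * (r / (r\<^sup>2 + (real m - real n)\<^sup>2)))" .
    qed
    also have "\<dots> = C * (\<Sum>m\<le>N. F m * (r / (r\<^sup>2 + (real m - real n)\<^sup>2)))"
      by (simp add: sum_distrib_left mult_ac)
    also have "\<dots> \<le> C * (3 * hl_cut N F n)"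
      using C(1) by (intro mult_left_mono poisson_sum_le_two_sided_max r N) (auto simp: F_def)
    also have "\<dots> \<le> C * (3 * K)"
      using C(1) bd[OF N] by (intro mult_left_mono) auto
    finally show ?thesis by simp
  qed
  have part': "(\<Sum>m<N. norm (?g m)) \<le> 3 * C * K" for N
  proof -
    have "(\<Sum>m<N. norm (?g m)) \<le> (\<Sum>m\<le>max n N. norm (?g m))"
      by (intro sum_mono2) auto
    also have "\<dots> \<le> 3 * C * K" by (rule part) simp
    finally show ?thesis .
  qed
  have sn: "summable (\<lambda>m. norm (?g m))"
    by (rule summableI_nonneg_bounded[of _ "3 * C * K"]) (use part' in auto)
  then show "summable ?g" by (rule summable_norm_cancel)
  have "cmod (heat_op \<alpha> \<beta> t f n) \<le> (\<Sum>m. norm (?g m))"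
    unfolding heat_op_def by (rule summable_norm[OF sn])
  also have "\<dots> \<le> 3 * C * K" by (rule suminf_le_const[OF sn part'])
  finally show "cmod (heat_op \<alpha> \<beta> t f n) \<le> 3 * C * K" .
qed

lemma poisson_op_bound:
  fixes f :: "nat \<Rightarrow> complex"
  assumes t: "0 < t"
    and sum: "\<And>s. 0 < s \<Longrightarrow> summable (\<lambda>m. f m * complex_of_real (heat_kernel \<alpha> \<beta> s m n))"
    and K: "\<And>s. 0 < s \<Longrightarrow> cmod (heat_op \<alpha> \<beta> s f n) \<le> K"
  shows "poisson_defined \<alpha> \<beta> t f n" and "cmod (poisson_op \<alpha> \<beta> t f n) \<le> K"
proof -
  define h where "h u = (exp (- u) / sqrt u) *\<^sub>R heat_op \<alpha> \<beta> (t\<^sup>2 / (4 * u)) f n" for u :: real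
  have pos: "0 < t\<^sup>2 / (4 * u)" if "0 < u" for u using t that by simp
  have m: "h \<in> borel_measurable borel" unfolding h_def[abs_def] heat_op_def by measurable
  have g: "((\<lambda>u. exp (- u) / sqrt u * K) has_integral sqrt pi * K) {0<..}"
    by (rule has_integral_mult_left[OF gamma_half_has_integral])
  have le: "norm (h u) \<le> exp (- u) / sqrt u * K" if "u \<in> {0<..}" for u
  proof -
    have "norm (h u) = exp (- u) / sqrt u * cmod (heat_op \<alpha> \<beta> (t\<^sup>2 / (4 * u)) f n)"
      using that by (simp add: h_def)
    also have "\<dots> \<le> exp (- u) / sqrt u * K"
      using that K[OF pos] by (intro mult_left_mono) auto
    finally show ?thesis .
  qed
  have si: "set_integrable lborel {0<..} h"
    by (rule set_integrable_lborel_of_bound[OF m has_integral_integrable[OF g] _ le]) auto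
  show "poisson_defined \<alpha> \<beta> t f n"
    unfolding poisson_defined_def using si sum pos by (auto simp: h_def[abs_def])
  have "norm (integral {0<..} h) \<le> integral {0<..} (\<lambda>u. exp (- u) / sqrt u * K)"
    by (rule Henstock_Kurzweil_Integration.integral_norm_bound_integral
        [OF set_borel_integral_eq_integral(1)[OF si] has_integral_integrable[OF g] le])
  also have "\<dots> = sqrt pi * K" by (rule integral_unique[OF g])
  finally have "norm (LINT u:{0<..}|lborel. h u) \<le> sqrt pi * K"
    by (simp add: set_borel_integral_eq_integral(2)[OF si])
  then have "1 / sqrt pi * norm (LINT u:{0<..}|lborel. h u) \<le> 1 / sqrt pi * (sqrt pi * K)"
    by (intro mult_left_mono) auto
  then show "cmod (poisson_op \<alpha> \<beta> t f n) \<le> K"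
    unfolding poisson_op_def h_def by simp
qed

text \<open>The bound \<open>K\<close> only guarantees that the maximal function of \<open>\<bar>f\<bar>\<close> is finite at \<open>n\<close>; the constant \<open>C\<close> is independent
of it.\<close>

lemma poisson_max_le_hl_max:
  assumes ab: "- 1/2 \<le> \<alpha>" "- 1/2 \<le> \<beta>"
  obtains C where "0 < C"
    "\<And>f n K t. (\<And>N. n \<le> N \<Longrightarrow> hl_cut N (\<lambda>m. cmod (f m)) n \<le> K) \<Longrightarrow> 0 < t \<Longrightarrow> poisson_defined \<alpha> \<beta> t f n"
    "\<And>f n K. (\<And>N. n \<le> N \<Longrightarrow> hl_cut N (\<lambda>m. cmod (f m)) n \<le> K) \<Longrightarrow>
       poisson_max \<alpha> \<beta> f n \<le> ennreal (C * hl_max (\<lambda>m. cmod (f m)) n)"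
proof -
  obtain C where C: "0 < C"
    "\<And>t m n. 0 < t \<Longrightarrow> \<bar>heat_kernel \<alpha> \<beta> t m n\<bar>
       \<le> C * (max 1 (sqrt t) / ((max 1 (sqrt t))\<^sup>2 + (real m - real n)\<^sup>2))"
    using heat_kernel_bound[OF ab] by blast
  show ?thesis
  proof (rule that[of "3 * C"])
    show "0 < 3 * C" using C by simp
  next
    fix f n K and t :: real
    assume bd: "\<And>N. n \<le> N \<Longrightarrow> hl_cut N (\<lambda>m. cmod (f m)) n \<le> K" and t: "0 < t"
    show "poisson_defined \<alpha> \<beta> t f n"
      by (rule poisson_op_bound(1)[OF t heat_op_bound[OF C bd]])
  next
    fix f n K
    assume bd: "\<And>N. n \<le> N \<Longrightarrow> hl_cut N (\<lambda>m. cmod (f m)) n \<le> K"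
    note bd' = hl_max_limit(2)[OF bd]
    have "cmod (poisson_op \<alpha> \<beta> t f n) \<le> 3 * C * hl_max (\<lambda>m. cmod (f m)) n" if "0 < t" for t
      by (rule poisson_op_bound(2)[OF that heat_op_bound[OF C bd']])
    then show "poisson_max \<alpha> \<beta> f n \<le> ennreal (3 * C * hl_max (\<lambda>m. cmod (f m)) n)"
      unfolding poisson_max_def by (intro SUP_least ennreal_leI) auto
  qed
qed

lemma ennreal_powr_ennreal: "0 \<le> x \<Longrightarrow> ennreal_powr (ennreal x) p = ennreal (x powr p)"
  by (simp add: ennreal_powr_def)

lemma ennreal_powr_mono:
  assumes "x \<le> y" "0 < p"
  shows "ennreal_powr x p \<le> ennreal_powr y p"
proof (cases "y = top")
  case False
  then have "x \<noteq> top" using assms(1) top.extremum_unique by auto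
  moreover have "enn2real x \<le> enn2real y"
    using assms(1) False by (intro enn2real_mono) (auto simp: less_top)
  ultimately show ?thesis using False assms(2)
    by (auto simp: ennreal_powr_def intro!: ennreal_leI powr_mono2)
qed (simp add: ennreal_powr_def)

lemma lp_norm_finiteE:
  assumes p: "0 < p" and w: "\<And>n. 0 < w n" and F: "\<And>n. 0 \<le> F n"
    and fin: "lp_norm p w (\<lambda>m. ennreal (F m)) < top"
  obtains S where "0 \<le> S" "lp_norm p w (\<lambda>m. ennreal (F m)) = ennreal (S powr (1 / p))"
    "\<And>N. (\<Sum>m\<le>N. F m powr p * w m) \<le> S"
proof -
  let ?T = "\<Sum>m. ennreal_powr (ennreal (F m)) p * ennreal (w m)"
  have T: "?T = (\<Sum>m. ennreal (F m powr p * w m))"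
    using w F by (simp add: ennreal_powr_ennreal ennreal_mult less_imp_le)
  have "?T \<noteq> top" using fin by (auto simp: lp_norm_def ennreal_powr_def)
  then obtain S where S: "0 \<le> S" "?T = ennreal S" by (cases ?T) auto
  have "(\<Sum>m\<le>N. F m powr p * w m) \<le> S" for N
  proof -
    have "ennreal (\<Sum>m\<le>N. F m powr p * w m) = (\<Sum>m\<le>N. ennreal (F m powr p * w m))"
      using w by (subst sum_ennreal) (auto intro!: mult_nonneg_nonneg intro: less_imp_le)
    also have "\<dots> \<le> (\<Sum>m. ennreal (F m powr p * w m))"
      by (intro sum_le_suminf summableI) auto
    also have "\<dots> = ennreal S" using S T by simp
    finally show ?thesis using S by simp
  qed
  moreover have "lp_norm p w (\<lambda>m. ennreal (F m)) = ennreal (S powr (1 / p))"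
    unfolding lp_norm_def S(2) using S(1) by (rule ennreal_powr_ennreal)
  ultimately show ?thesis using S(1) that by blast
qed

text \<open>The bound for the cut-off maximal functions is uniform in the cut-off.  It shows first that they are bounded
at every point, so that the Poisson operator is defined, and then, in the limit, that the norm inequality holds.\<close>

lemma poisson_strong_bound:
  assumes ab: "- 1/2 \<le> \<alpha>" "- 1/2 \<le> \<beta>" and p: "1 < p" and Ap: "Ap_weight p w"
  shows "(\<forall>f\<in>lp_space p w. \<forall>t>0. \<forall>n. poisson_defined \<alpha> \<beta> t f n) \<and>
    (\<exists>C>0. \<forall>f\<in>lp_space p w.
       lp_norm p w (poisson_max \<alpha> \<beta> f) \<le> ennreal C * lp_norm p w (\<lambda>m. ennreal (cmod (f m))))"
proof -
  have w: "0 < w n" for n using Ap by (simp add: Ap_weight_def weight_def)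
  obtain A where A: "0 < A"
    "\<And>N F. (\<And>k. 0 \<le> F k) \<Longrightarrow>
       (\<Sum>n\<le>N. hl_cut N F n powr p * w n) \<le> A * (\<Sum>n\<le>N. F n powr p * w n)"
    by (rule Ap_maximal_bound[OF p Ap], rule that, assumption) blast
  obtain C where C: "0 < C"
    "\<And>f n K t. (\<And>N. n \<le> N \<Longrightarrow> hl_cut N (\<lambda>m. cmod (f m)) n \<le> K) \<Longrightarrow> 0 < t \<Longrightarrow> poisson_defined \<alpha> \<beta> t f n"
    "\<And>f n K. (\<And>N. n \<le> N \<Longrightarrow> hl_cut N (\<lambda>m. cmod (f m)) n \<le> K) \<Longrightarrow>
       poisson_max \<alpha> \<beta> f n \<le> ennreal (C * hl_max (\<lambda>m. cmod (f m)) n)"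
    by (rule poisson_max_le_hl_max[OF ab], rule that, assumption) blast+
  have key: "(\<forall>t>0. \<forall>n. poisson_defined \<alpha> \<beta> t f n) \<and>
      lp_norm p w (poisson_max \<alpha> \<beta> f) \<le> ennreal (C * A powr (1 / p)) * lp_norm p w (\<lambda>m. ennreal (cmod (f m)))"
    if f: "f \<in> lp_space p w" for f
  proof -
    define F where "F m = cmod (f m)" for m
    have F: "0 \<le> F m" for m by (simp add: F_def)
    obtain S where S: "0 \<le> S" "lp_norm p w (\<lambda>m. ennreal (F m)) = ennreal (S powr (1 / p))"
      "\<And>N. (\<Sum>m\<le>N. F m powr p * w m) \<le> S"
      by (rule lp_norm_finiteE[of p w F]) (use f p w F in \<open>auto simp: lp_space_def F_def\<close>)
    let ?M = "\<lambda>N. hl_cut N F"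
    have M0: "0 \<le> ?M N n" if "n \<le> N" for n N using that F by (intro two_sided_max_nonneg) auto
    have MS: "(\<Sum>n\<le>N. ?M N n powr p * w n) \<le> A * S" for N
      using A(2)[of F N, OF F] mult_left_mono[OF S(3)[of N] less_imp_le[OF A(1)]] by linarith
    have bd: "?M N n \<le> (A * S / w n) powr (1 / p)" if n: "n \<le> N" for n N
    proof -
      have "?M N n powr p * w n \<le> (\<Sum>n\<le>N. ?M N n powr p * w n)"
        using n w by (intro member_le_sum) (auto intro!: mult_nonneg_nonneg intro: less_imp_le)
      also note MS
      finally have "?M N n powr p \<le> A * S / w n" using w[of n] by (simp add: pos_le_divide_eq)
      then have "(?M N n powr p) powr (1 / p) \<le> (A * S / w n) powr (1 / p)" using p by (intro powr_mono2) auto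
      then show ?thesis using M0[OF n] p by (simp add: powr_powr)
    qed
    define G where "G n = hl_max F n" for n
    have lim: "(\<lambda>N. ?M N n) \<longlonglongrightarrow> G n" and le: "n \<le> N \<Longrightarrow> ?M N n \<le> G n" for n N
      unfolding G_def using hl_max_limit[OF bd] by auto
    have G0: "0 \<le> G n" for n using le[of n n] M0[of n n] by simp
    have GS: "(\<Sum>n<N. G n powr p * w n) \<le> A * S" for N
    proof (rule LIMSEQ_le_const2)
      show "(\<lambda>N'. \<Sum>n<N. ?M N' n powr p * w n) \<longlonglongrightarrow> (\<Sum>n<N. G n powr p * w n)"
        using p by (intro tendsto_sum tendsto_mult tendsto_const tendsto_powr' lim)
          (auto simp: eventually_sequentially intro!: exI[of _ N] M0)
      show "\<exists>N0. \<forall>N'\<ge>N0. (\<Sum>n<N. ?M N' n powr p * w n) \<le> A * S"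
      proof (intro exI allI impI)
        fix N' assume "N \<le> N'"
        then have "(\<Sum>n<N. ?M N' n powr p * w n) \<le> (\<Sum>n\<le>N'. ?M N' n powr p * w n)"
          using w by (intro sum_mono2) (auto intro!: mult_nonneg_nonneg intro: less_imp_le)
        then show "(\<Sum>n<N. ?M N' n powr p * w n) \<le> A * S" using MS[of N'] by linarith
      qed
    qed
    have def: "poisson_defined \<alpha> \<beta> t f n" if "0 < t" for t n
      using C(2)[OF bd[unfolded F_def] that] by simp
    have max: "poisson_max \<alpha> \<beta> f n \<le> ennreal (C * G n)" for n
      using C(3)[OF bd[unfolded F_def]] unfolding G_def F_def by simp
    have "(\<Sum>n. ennreal_powr (poisson_max \<alpha> \<beta> f n) p * ennreal (w n)) \<le> ennreal (C powr p * (A * S))"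
    proof (rule suminf_le_const[OF summableI])
      fix N
      have "(\<Sum>n<N. ennreal_powr (poisson_max \<alpha> \<beta> f n) p * ennreal (w n))
          \<le> (\<Sum>n<N. ennreal (C powr p * (G n powr p * w n)))"
      proof (rule sum_mono)
        fix n
        have "ennreal_powr (poisson_max \<alpha> \<beta> f n) p \<le> ennreal_powr (ennreal (C * G n)) p"
          using p by (intro ennreal_powr_mono max) auto
        also have "\<dots> = ennreal (C powr p * G n powr p)"
          using C(1) G0[of n] by (simp add: ennreal_powr_ennreal powr_mult)
        finally have "ennreal_powr (poisson_max \<alpha> \<beta> f n) p * ennreal (w n) \<le> ennreal (C powr p * G n powr p) * ennreal (w n)"
          by (rule mult_right_mono) simp
        also have "\<dots> = ennreal (C powr p * (G n powr p * w n))"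
          using w[of n] by (simp add: ennreal_mult[symmetric] mult.assoc less_imp_le)
        finally show "ennreal_powr (poisson_max \<alpha> \<beta> f n) p * ennreal (w n) \<le> ennreal (C powr p * (G n powr p * w n))" .
      qed
      also have "\<dots> = ennreal (\<Sum>n<N. C powr p * (G n powr p * w n))"
        using w by (intro sum_ennreal) (auto intro!: mult_nonneg_nonneg intro: less_imp_le)
      also have "\<dots> \<le> ennreal (C powr p * (A * S))"
        using GS[of N] by (intro ennreal_leI) (simp add: sum_distrib_left[symmetric] mult_left_mono)
      finally show "(\<Sum>n<N. ennreal_powr (poisson_max \<alpha> \<beta> f n) p * ennreal (w n)) \<le> ennreal (C powr p * (A * S))" .
    qed
    then have "lp_norm p w (poisson_max \<alpha> \<beta> f) \<le> ennreal_powr (ennreal (C powr p * (A * S))) (1 / p)"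
      unfolding lp_norm_def using p by (intro ennreal_powr_mono) auto
    also have "\<dots> = ennreal ((C powr p * (A * S)) powr (1 / p))"
      using A(1) S(1) by (intro ennreal_powr_ennreal) auto
    also have "(C powr p * (A * S)) powr (1 / p) = C * A powr (1 / p) * S powr (1 / p)"
      using p C(1) by (simp add: powr_mult powr_powr)
    also have "ennreal \<dots> = ennreal (C * A powr (1 / p)) * ennreal (S powr (1 / p))"
      using C(1) by (intro ennreal_mult) auto
    finally show ?thesis using def S(2) unfolding F_def by auto
  qed
  have "0 < C * A powr (1 / p)" using A C by simp
  with key show ?thesis by blast
qed

text \<open>As for \<open>p > 1\<close>.  A finite set of points where \<open>hl_max\<close> exceeds \<open>x\<close> is contained in the level set of a cut-off
maximal function with a sufficiently large cut-off.\<close>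

lemma poisson_weak_bound:
  assumes ab: "- 1/2 \<le> \<alpha>" "- 1/2 \<le> \<beta>" and A1: "A1_weight w"
  shows "(\<forall>f\<in>lp_space 1 w. \<forall>t>0. \<forall>n. poisson_defined \<alpha> \<beta> t f n) \<and>
    (\<exists>C>0. \<forall>f\<in>lp_space 1 w.
       weak_l1_norm w (poisson_max \<alpha> \<beta> f) \<le> ennreal C * lp_norm 1 w (\<lambda>m. ennreal (cmod (f m))))"
proof -
  have w: "0 < w n" for n using A1 by (simp add: A1_weight_def weight_def)
  obtain A where A: "0 < A"
    "\<And>N F x. (\<And>k. 0 \<le> F k) \<Longrightarrow>
       x * (\<Sum>n\<in>{n\<in>{..N}. x < hl_cut N F n}. w n) \<le> A * (\<Sum>n\<le>N. F n * w n)"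
    by (rule A1_maximal_bound[OF A1], rule that, assumption) blast
  obtain C where C: "0 < C"
    "\<And>f n K t. (\<And>N. n \<le> N \<Longrightarrow> hl_cut N (\<lambda>m. cmod (f m)) n \<le> K) \<Longrightarrow> 0 < t \<Longrightarrow> poisson_defined \<alpha> \<beta> t f n"
    "\<And>f n K. (\<And>N. n \<le> N \<Longrightarrow> hl_cut N (\<lambda>m. cmod (f m)) n \<le> K) \<Longrightarrow>
       poisson_max \<alpha> \<beta> f n \<le> ennreal (C * hl_max (\<lambda>m. cmod (f m)) n)"
    by (rule poisson_max_le_hl_max[OF ab], rule that, assumption) blast+
  have key: "(\<forall>t>0. \<forall>n. poisson_defined \<alpha> \<beta> t f n) \<and>
      weak_l1_norm w (poisson_max \<alpha> \<beta> f) \<le> ennreal (C * A) * lp_norm 1 w (\<lambda>m. ennreal (cmod (f m)))"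
    if f: "f \<in> lp_space 1 w" for f
  proof -
    define F where "F m = cmod (f m)" for m
    have F: "0 \<le> F m" for m by (simp add: F_def)
    obtain S where S: "0 \<le> S" "lp_norm 1 w (\<lambda>m. ennreal (F m)) = ennreal (S powr (1 / 1))"
      "\<And>N. (\<Sum>m\<le>N. F m powr 1 * w m) \<le> S"
      by (rule lp_norm_finiteE[of 1 w F]) (use f w F in \<open>auto simp: lp_space_def F_def\<close>)
    let ?M = "\<lambda>N. hl_cut N F"
    have MS: "x * (\<Sum>n\<in>{n\<in>{..N}. x < ?M N n}. w n) \<le> A * S" for N x
    proof -
      have "(\<Sum>m\<le>N. F m * w m) \<le> S" using S(3)[of N] F by simp
      from mult_left_mono[OF this less_imp_le[OF A(1)]] show ?thesis using A(2)[of F x N, OF F] by linarith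
    qed
    have bd: "?M N n \<le> A * S / w n" if n: "n \<le> N" for n N
    proof (rule dense_le)
      fix x assume x: "x < ?M N n"
      show "x \<le> A * S / w n"
      proof (cases "0 \<le> x")
        case True
        have "w n \<le> (\<Sum>n\<in>{n\<in>{..N}. x < ?M N n}. w n)"
          using n x w by (intro member_le_sum) (auto intro!: mult_nonneg_nonneg intro: less_imp_le)
        from mult_left_mono[OF this True] have "x * w n \<le> A * S" using MS[of x N] by linarith
        then show ?thesis using w[of n] by (simp add: pos_le_divide_eq)
      next
        case False
        have "0 \<le> A * S / w n" using A(1) S(1) w[of n] by simp
        then show ?thesis using False by linarith
      qed
    qed
    define G where "G n = hl_max F n" for n
    have lim: "(\<lambda>N. ?M N n) \<longlonglongrightarrow> G n" for n
      unfolding G_def using hl_max_limit[OF bd] by auto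
    have GS: "x * (\<Sum>n\<in>{n\<in>{..<N}. x < G n}. w n) \<le> A * S" if x: "0 < x" for x N
    proof -
      have "\<forall>\<^sub>F N' in sequentially. \<forall>n\<in>{n\<in>{..<N}. x < G n}. x < ?M N' n"
        by (intro eventually_ball_finite ballI order_tendstoD(1)[OF lim]) auto
      then have "\<forall>\<^sub>F N' in sequentially. N \<le> N' \<and> (\<forall>n\<in>{n\<in>{..<N}. x < G n}. x < ?M N' n)"
        by (intro eventually_conj eventually_ge_at_top)
      then obtain N' where N': "N \<le> N'" "\<forall>n\<in>{n\<in>{..<N}. x < G n}. x < ?M N' n"
        using eventually_happens'[OF sequentially_bot] by blast
      have "(\<Sum>n\<in>{n\<in>{..<N}. x < G n}. w n) \<le> (\<Sum>n\<in>{n\<in>{..N'}. x < ?M N' n}. w n)"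
        using N' w by (intro sum_mono2) (auto intro!: mult_nonneg_nonneg intro: less_imp_le)
      from mult_left_mono[OF this less_imp_le[OF x]] show ?thesis using MS[of x N'] by linarith
    qed
    have def: "poisson_defined \<alpha> \<beta> t f n" if "0 < t" for t n
      using C(2)[OF bd[unfolded F_def] that] by simp
    have max: "poisson_max \<alpha> \<beta> f n \<le> ennreal (C * G n)" for n
      using C(3)[OF bd[unfolded F_def]] unfolding G_def F_def by simp
    have "weak_l1_norm w (poisson_max \<alpha> \<beta> f) \<le> ennreal (C * A * S)"
      unfolding weak_l1_norm_def
    proof (rule SUP_least)
      fix t :: real assume "t \<in> {0<..}"
      then have t: "0 < t" by simp
      have big: "t / C < G n" if "poisson_max \<alpha> \<beta> f n > ennreal t" for n
      proof -
        have "ennreal t < ennreal (C * G n)" using that max[of n] by (rule less_le_trans)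
        then have "t < C * G n" using t by (simp add: ennreal_less_iff)
        then show ?thesis using C(1) by (simp add: pos_divide_less_eq mult.commute)
      qed
      have "(\<Sum>m. if poisson_max \<alpha> \<beta> f m > ennreal t then ennreal (w m) else 0) \<le> ennreal (C * A * S / t)"
      proof (rule suminf_le_const[OF summableI])
        fix N
        have "(\<Sum>m<N. if poisson_max \<alpha> \<beta> f m > ennreal t then ennreal (w m) else 0)
            \<le> (\<Sum>m<N. if t / C < G m then ennreal (w m) else 0)"
          using big by (intro sum_mono) auto
        also have "\<dots> = (\<Sum>m\<in>{m\<in>{..<N}. t / C < G m}. ennreal (w m))"
          by (rule sum.inter_filter[symmetric]) simp
        also have "\<dots> = ennreal (\<Sum>m\<in>{m\<in>{..<N}. t / C < G m}. w m)"
          using w by (intro sum_ennreal) (auto intro!: mult_nonneg_nonneg intro: less_imp_le)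
        also have "\<dots> \<le> ennreal (C * A * S / t)"
        proof (rule ennreal_leI)
          have "t / C * (\<Sum>m\<in>{m\<in>{..<N}. t / C < G m}. w m) \<le> A * S" using t C(1) by (intro GS) simp
          then show "(\<Sum>m\<in>{m\<in>{..<N}. t / C < G m}. w m) \<le> C * A * S / t"
            using t C(1) by (simp add: field_simps)
        qed
        finally show "(\<Sum>m<N. if poisson_max \<alpha> \<beta> f m > ennreal t then ennreal (w m) else 0) \<le> ennreal (C * A * S / t)" .
      qed
      then have "ennreal t * (\<Sum>m. if poisson_max \<alpha> \<beta> f m > ennreal t then ennreal (w m) else 0)
          \<le> ennreal t * ennreal (C * A * S / t)"
        by (rule mult_left_mono) simp
      also have "\<dots> = ennreal (t * (C * A * S / t))"
        using t C(1) A(1) S(1) by (intro ennreal_mult[symmetric]) auto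
      also have "t * (C * A * S / t) = C * A * S" using t by simp
      finally show "ennreal t * (\<Sum>m. if poisson_max \<alpha> \<beta> f m > ennreal t then ennreal (w m) else 0) \<le> ennreal (C * A * S)" .
    qed
    also have "ennreal (C * A * S) = ennreal (C * A) * lp_norm 1 w (\<lambda>m. ennreal (F m))"
      unfolding S(2) using C(1) A(1) S(1) by (subst ennreal_mult[symmetric]) auto
    finally show ?thesis using def unfolding F_def by auto
  qed
  have "0 < C * A" using A C by simp
  with key show ?thesis by blast
qed

theorem corollary4p2:
  fixes \<alpha> \<beta> :: real
  assumes "\<alpha> \<ge> - 1 / 2" and "\<beta> \<ge> - 1 / 2"
  shows "(\<forall>p w. 1 < p \<and> Ap_weight p w \<longrightarrow>
            (\<forall>f\<in>lp_space p w. \<forall>t>0. \<forall>n. poisson_defined \<alpha> \<beta> t f n) \<and>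
            (\<exists>C>0. \<forall>f\<in>lp_space p w.
               lp_norm p w (poisson_max \<alpha> \<beta> f)
                 \<le> ennreal C * lp_norm p w (\<lambda>m. ennreal (cmod (f m)))))
       \<and> (\<forall>w. A1_weight w \<longrightarrow>
            (\<forall>f\<in>lp_space 1 w. \<forall>t>0. \<forall>n. poisson_defined \<alpha> \<beta> t f n) \<and>
            (\<exists>C>0. \<forall>f\<in>lp_space 1 w.
               weak_l1_norm w (poisson_max \<alpha> \<beta> f)
                 \<le> ennreal C * lp_norm 1 w (\<lambda>m. ennreal (cmod (f m)))))"
proof (intro conjI allI impI; (elim conjE)?)
  fix p w assume "1 < p" "Ap_weight p w"
  note strong = poisson_strong_bound[OF assms this]
  show "\<forall>f\<in>lp_space p w. \<forall>t>0. \<forall>n. poisson_defined \<alpha> \<beta> t f n"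
    using strong by (rule conjunct1)
  show "\<exists>C>0. \<forall>f\<in>lp_space p w. lp_norm p w (poisson_max \<alpha> \<beta> f)
      \<le> ennreal C * lp_norm p w (\<lambda>m. ennreal (cmod (f m)))"
    using strong by (rule conjunct2)
next
  fix w assume "A1_weight w"
  note weak = poisson_weak_bound[OF assms this]
  show "\<forall>f\<in>lp_space 1 w. \<forall>t>0. \<forall>n. poisson_defined \<alpha> \<beta> t f n"
    using weak by (rule conjunct1)
  show "\<exists>C>0. \<forall>f\<in>lp_space 1 w. weak_l1_norm w (poisson_max \<alpha> \<beta> f)
      \<le> ennreal C * lp_norm 1 w (\<lambda>m. ennreal (cmod (f m)))"
    using weak by (rule conjunct2)
qed

end
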